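(* Let $n\ge p$, and let $X$ ($m\times p$) and $S$ ($p\times p$) be independent with $X\sim \mathcal N_{m\times p}(\Theta, I_m\otimes\Sigma)$ and $S\sim\mathcal W_p(n,\Sigma)$. Let $p>m$, $a+2m+p=n$, and $$k_0=\frac{a-c+p+m-1}{a+2m+p}=\frac{n-(m+c+1)}{n}.$$ With $\widehat\Sigma_0=n^{-1}S$, the generalized Bayes estimator $$\widehat\Sigma^{GB}=\widehat\Sigma_0+n^{-1}k_0X^\top\{I_m+(1-k_0)XS^{-1}X^\top\}^{-1}X$$ dominates $\widehat\Sigma_0$ relative to the Stein loss $L_S(\widehat\Sigma,\Sigma)=\mathrm{tr}(\widehat\Sigma\Sigma^{-1})-\log|\widehat\Sigma\Sigma^{-1}|-p$ if $c$ satisfies $$\max\Big\{-2,\ \frac{n(n-p+m)}{n+p-m}-m-1\Big\}<c<n-2m.$$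
   Context: $\mathcal N_{m\times p}(M,A\otimes\Sigma)$ denotes the matrix normal distribution with density proportional to $\exp[-\tfrac12\mathrm{tr}\{A^{-1}(X-M)\Sigma^{-1}(X-M)^\top\}]$; $\mathcal W_p(n,\Sigma)$ is the Wishart distribution with $n$ degrees of freedom and scale matrix $\Sigma$ ($p\times p$ positive definite). Both $\Theta$ and $\Sigma$ are unknown. $\widehat\Sigma^{GB}$ is the generalized Bayes estimator $(E[\Sigma^{-1}\mid X,S])^{-1}$ for the hierarchical prior $\Theta\mid\Sigma,\Omega\sim\mathcal N_{m\times p}(0,\Omega\otimes\Sigma)$, $\pi(\Omega)\propto|I_m+\Omega|^{-a/2-m}|\Omega|^{c/2}$ ($\Omega$ positive definite $m\times m$), $\pi(\Sigma^{-1})\propto|\Sigma^{-1}|^{(b-1)/2}$ with $b=a+m-n$; for the present claim it is given by the displayed formula. $\delta_1$ dominates $\delta_2$ relative to a loss if the expected loss of $\delta_1$ is at most that of $\delta_2$ for all $(\Theta,\Sigma)$ with strict inequality for some $(\Theta,\Sigma)$. *)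

theory Defs
  imports "HOL-Probability.Probability"
begin

definition pos_def :: "real^'n^'n \<Rightarrow> bool" where
  "pos_def A \<longleftrightarrow> transpose A = A \<and> (\<forall>x. x \<noteq> 0 \<longrightarrow> x \<bullet> (A *v x) > 0)"

(* Elements of real^'p^'m have CARD('m) rows and CARD('p) columns, so A is the covariance
   between rows and \<Sigma> the covariance within each row. *)
definition matrix_normal ::
    "real^'p^'m \<Rightarrow> real^'m^'m \<Rightarrow> real^'p^'p \<Rightarrow> (real^'p^'m) measure" where
  "matrix_normal M A \<Sigma> = density lborel (\<lambda>X. ennreal
     (exp (- (1/2) * trace (matrix_inv A ** (X - M) ** matrix_inv \<Sigma> ** transpose (X - M)))
      / ((2 * pi) powr (real CARD('m) * real CARD('p) / 2)
         * det A powr (real CARD('p) / 2) * det \<Sigma> powr (real CARD('m) / 2))))"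

(* The law of the sum of z_i z_i^T over n independent z_i distributed as N_p(0, \<Sigma>).
   Each z_i is represented by its transpose Z i, a 1 x p matrix. *)
definition wishart :: "nat \<Rightarrow> real^'p^'p \<Rightarrow> (real^'p^'p) measure" where
  "wishart n \<Sigma> = distr (PiM {..<n} (\<lambda>_. matrix_normal (0 :: real^'p^1) (mat 1) \<Sigma>)) borel
     (\<lambda>Z. \<Sum>i<n. transpose (Z i) ** Z i)"

definition stein_loss :: "real^'p^'p \<Rightarrow> real^'p^'p \<Rightarrow> real" where
  "stein_loss D \<Sigma> =
     trace (D ** matrix_inv \<Sigma>) - ln (det (D ** matrix_inv \<Sigma>)) - real CARD('p)"

(* The library's indep_var only covers two random variables with values in the same type. *)
definition indep_rvs ::
    "'w measure \<Rightarrow> ('w \<Rightarrow> 'a::topological_space) \<Rightarrow> ('w \<Rightarrow> 'b::topological_space) \<Rightarrow> bool" where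
  "indep_rvs P X Y \<longleftrightarrow> X \<in> borel_measurable P \<and> Y \<in> borel_measurable P \<and>
     prob_space.indep_set P {X -` A \<inter> space P | A. A \<in> sets borel}
                            {Y -` B \<inter> space P | B. B \<in> sets borel}"

(* The expected loss takes values in [0, \<infinity>], so no integrability has to be presupposed.
   This is meant for almost surely nonnegative losses, such as the Stein loss of an almost surely
   positive definite estimator; ennreal would cut negative values off at 0. *)
definition risk ::
    "'w measure \<Rightarrow> (real^'p^'p \<Rightarrow> real^'p^'p \<Rightarrow> real) \<Rightarrow> ('w \<Rightarrow> real^'p^'p) \<Rightarrow> real^'p^'p \<Rightarrow> ennreal"
  where "risk P L \<delta> \<Sigma> = (\<integral>\<^sup>+ \<omega>. ennreal (L (\<delta> \<omega>) \<Sigma>) \<partial>P)"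

(* P is a statistical model: P \<Theta> \<Sigma> is the probability measure on the sample space under the
   parameter (\<Theta>, \<Sigma>). *)
definition dominates ::
    "(real^'p^'m \<Rightarrow> real^'p^'p \<Rightarrow> 'w measure) \<Rightarrow> (real^'p^'p \<Rightarrow> real^'p^'p \<Rightarrow> real)
      \<Rightarrow> ('w \<Rightarrow> real^'p^'p) \<Rightarrow> ('w \<Rightarrow> real^'p^'p) \<Rightarrow> bool" where
  "dominates P L \<delta>\<^sub>1 \<delta>\<^sub>2 \<longleftrightarrow>
     (\<forall>\<Theta> \<Sigma>. pos_def \<Sigma> \<longrightarrow> risk (P \<Theta> \<Sigma>) L \<delta>\<^sub>1 \<Sigma> \<le> risk (P \<Theta> \<Sigma>) L \<delta>\<^sub>2 \<Sigma>) \<and>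
     (\<exists>\<Theta> \<Sigma>. pos_def \<Sigma> \<and> risk (P \<Theta> \<Sigma>) L \<delta>\<^sub>1 \<Sigma> < risk (P \<Theta> \<Sigma>) L \<delta>\<^sub>2 \<Sigma>)"

definition Sigma0_hat :: "nat \<Rightarrow> real^'p^'p \<Rightarrow> real^'p^'p" where
  "Sigma0_hat n S = (1 / real n) *\<^sub>R S"

definition SigmaGB_hat :: "nat \<Rightarrow> real \<Rightarrow> real^'p^'m \<Rightarrow> real^'p^'p \<Rightarrow> real^'p^'p" where
  "SigmaGB_hat n k\<^sub>0 X S = Sigma0_hat n S + (k\<^sub>0 / real n) *\<^sub>R
     (transpose X ** matrix_inv (mat 1 + (1 - k\<^sub>0) *\<^sub>R (X ** matrix_inv S ** transpose X)) ** X)"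

end

theory Submission
  imports Defs
begin

text \<open>
  Write \<open>\<kappa> = 1 - k\<^sub>0\<close>, \<open>\<nu> = n - p + m\<close> and \<open>T = X\<^sup>T (I + \<kappa> X S\<^sup>-\<^sup>1 X\<^sup>T)\<^sup>-\<^sup>1 X\<close>, so that the estimator is
  \<open>(S + k\<^sub>0 T) / n\<close>. Passing from \<open>S / n\<close> to it changes the Stein loss by
  \<open>(k\<^sub>0 / n) tr (T \<Sigma>\<^sup>-\<^sup>1) - ln det (I + k\<^sub>0 S\<^sup>-\<^sup>1 T)\<close>. The eigenvalues of \<open>S\<^sup>-\<^sup>1 T\<close> lie in \<open>[0, 1 / \<kappa>]\<close>, and on
  this interval the concave function \<open>t \<mapsto> ln (1 + k\<^sub>0 t)\<close> lies above its chord \<open>t \<mapsto> \<kappa> ln (1 / \<kappa>) t\<close>.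
  Hence the loss increases by at most
  \<open>(k\<^sub>0 / n) tr (T \<Sigma>\<^sup>-\<^sup>1) - \<kappa> ln (1 / \<kappa>) tr (S\<^sup>-\<^sup>1 T)\<close>. The lower bound on \<open>c\<close> is what makes
  \<open>\<kappa> ln (1 / \<kappa>) > k\<^sub>0 \<nu> / n\<close> (\<open>shrinkage_threshold\<close>). Everything therefore follows from

    \<open>E tr (T \<Sigma>\<^sup>-\<^sup>1) \<le> \<nu> E tr (S\<^sup>-\<^sup>1 T)\<close> for every fixed \<open>X\<close>.

  For this, diagonalize \<open>\<Sigma> = A A\<^sup>T\<close> and \<open>\<kappa> X\<^sup>T X = A B A\<^sup>T\<close> simultaneously, \<open>B = diag b\<close>, where at most \<open>m\<close>
  of the \<open>b\<^sub>j\<close> are nonzero. Then \<open>S = A W A\<^sup>T\<close> with \<open>W\<close> a standard Wishart matrix, and Woodbury's formula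
  turns the two traces into \<open>\<Sum>\<^sub>j (b\<^sub>j - b\<^sub>j\<^sup>2 r\<^sub>j) / \<kappa>\<close> and \<open>\<Sum>\<^sub>j b\<^sub>j r\<^sub>j / \<kappa>\<close> with \<open>r\<^sub>j\<close> the diagonal entries of
  \<open>(W + B)\<^sup>-\<^sup>1\<close> (\<open>stein_loss_SigmaGB_le\<close>). So it is enough that \<open>E r\<^sub>j \<ge> 1 / (\<nu> + b\<^sub>j)\<close> whenever
  \<open>b\<^sub>j \<noteq> 0\<close> (\<open>expected_regularized_inverse_diagonal\<close>). Now \<open>1 / r\<^sub>j\<close> is the minimum of the quadratic form of
  \<open>W + B\<close> over vectors with \<open>j\<close>-th coordinate \<open>1\<close>; letting the minimum run only over the coordinates
  with \<open>b\<^sub>k = 0\<close>, where \<open>B\<close> costs nothing, gives \<open>1 / r\<^sub>j \<le> b\<^sub>j + d\<close>, where \<open>d\<close> is the squared distance of a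
  standard Gaussian vector in \<open>\<real>\<^sup>n\<close> from an independent random subspace of dimension at least \<open>p - m\<close>. Since
  \<open>E d \<le> n - (p - m) = \<nu>\<close>, Jensen's inequality finishes the argument.

  To pass from a negative expected difference of the losses to a strict inequality of the risks, one needs
  the risk of \<open>S / n\<close> to be finite, that is, an integrable logarithm of \<open>det W\<close>. This, together with the almost sure nonsingularity of \<open>W\<close>, is obtained by revealing
  one diagonal entry of a square block of the data matrix at a time
  (\<open>gram_nonsingular_and_log_integrable\<close>). The density of the matrix normal distribution enters through
  a linear change of variables, which identifies the Wishart law with the law of \<open>A W A\<^sup>T\<close>
  (\<open>wishart_eq_distr_gram\<close>).
\<close>

section \<open>Diagonal matrices and the spectral theorem\<close>

definition diag_mat :: "('n \<Rightarrow> real) \<Rightarrow> real^'n^'n" where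
  "diag_mat d = (\<chi> i j. if i = j then d i else 0)"

lemma diag_mat_nth [simp]: "diag_mat d $ i $ j = (if i = j then d i else 0)"
  by (simp add: diag_mat_def)

lemma transpose_diag_mat [simp]: "transpose (diag_mat d) = diag_mat d"
  by (simp add: vec_eq_iff transpose_def)

lemma matrix_mult_diag_nth: "(A ** diag_mat d) $ i $ j = A $ i $ j * d j"
proof -
  have "(A ** diag_mat d) $ i $ j = (\<Sum>k\<in>UNIV. if k = j then A $ i $ k * d k else 0)"
    by (simp add: matrix_matrix_mult_def if_distrib cong: if_cong)
  then show ?thesis by simp
qed

lemma diag_mult_matrix_nth: "(diag_mat d ** A) $ i $ j = d i * A $ i $ j"
proof -
  have "(diag_mat d ** A) $ i $ j = (\<Sum>k\<in>UNIV. if i = k then d i * A $ k $ j else 0)"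
    by (simp add: matrix_matrix_mult_def if_distrib[of "\<lambda>x. x * _"] cong: if_cong)
  then show ?thesis by simp
qed

lemma diag_mat_mult: "diag_mat d ** diag_mat e = diag_mat (\<lambda>i. d i * e i)"
  by (simp add: vec_eq_iff matrix_mult_diag_nth)

lemma diag_mat_vec: "(diag_mat d *v x) $ i = d i * x $ i"
proof -
  have "(diag_mat d *v x) $ i = (\<Sum>j\<in>UNIV. if i = j then d i * x $ j else 0)"
    by (simp add: matrix_vector_mult_def if_distrib[of "\<lambda>x. x * _"] cong: if_cong)
  then show ?thesis by simp
qed

lemma diag_mat_one: "diag_mat (\<lambda>_. 1) = mat 1"
  by (simp add: vec_eq_iff mat_def)

lemma det_diag_mat: "det (diag_mat d) = prod d UNIV"
  by (subst det_diagonal) auto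

lemma trace_diag_mat: "trace (diag_mat d) = sum d UNIV"
  by (simp add: trace_def)

lemma det_scaleR: "det (c *\<^sub>R A) = c ^ CARD('n) * det A" for A :: "real^'n^'n"
proof -
  have "c *\<^sub>R A = diag_mat (\<lambda>_. c) ** A"
    by (simp add: vec_eq_iff diag_mult_matrix_nth)
  then show ?thesis by (simp add: det_mul det_diag_mat)
qed

lemma inner_transpose: "x \<bullet> (A *v y) = (transpose A *v x) \<bullet> y" for A :: "real^'n^'m"
  by (metis dot_lmul_matrix transpose_matrix_vector)

text \<open>A maximiser of the Rayleigh quotient on the unit sphere of the invariant subspace is an
  eigenvector, because the quotient is stationary there.\<close>

lemma symmetric_eigenvector_in_invariant_subspace:
  fixes M :: "real^'n^'n"
  assumes sym: "transpose M = M" and V: "subspace V" and inv: "\<And>x. x \<in> V \<Longrightarrow> M *v x \<in> V"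
    and ne: "V \<noteq> {0}"
  obtains v l where "v \<in> V" "norm v = 1" "M *v v = l *\<^sub>R v"
proof -
  define K where "K = V \<inter> sphere 0 1"
  have "compact K"
    unfolding K_def using closed_subspace[OF V] by (simp add: closed_Int_compact)
  obtain w where w: "w \<in> V" "w \<noteq> 0"
    using ne subspace_0[OF V] by auto
  then have "w /\<^sub>R norm w \<in> K"
    using V by (simp add: K_def subspace_scale)
  then have "K \<noteq> {}" by auto
  have "continuous_on K (\<lambda>x. x \<bullet> (M *v x))"
    by (intro continuous_on_inner continuous_on_id matrix_vector_mult_linear_continuous_on)
  then obtain v where v: "v \<in> K" and max: "\<And>x. x \<in> K \<Longrightarrow> x \<bullet> (M *v x) \<le> v \<bullet> (M *v v)"
    using continuous_attains_sup[OF \<open>compact K\<close> \<open>K \<noteq> {}\<close>] by blast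
  define l where "l = v \<bullet> (M *v v)"
  have vV: "v \<in> V" and nv: "norm v = 1" using v by (auto simp: K_def)
  then have vv: "v \<bullet> v = 1" by (simp add: dot_square_norm)
  have le: "y \<bullet> (M *v y) \<le> l * (y \<bullet> y)" if "y \<in> V" for y
  proof (cases "y = 0")
    case False
    have "(y /\<^sub>R norm y) \<bullet> (M *v (y /\<^sub>R norm y)) \<le> l"
      unfolding l_def using False that V by (intro max) (simp add: K_def subspace_scale)
    then have "(y \<bullet> (M *v y)) / (norm y * norm y) \<le> l"
      by (simp add: matrix_vector_mult_scaleR divide_inverse mult_ac)
    with False show ?thesis
      by (simp add: divide_le_eq dot_square_norm power2_eq_square)
  qed simp
  define w where "w = l *\<^sub>R v - M *v v"
  have wV: "w \<in> V"
    unfolding w_def using V vV inv by (simp add: subspace_diff subspace_scale)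
  define q where "q = l * (w \<bullet> w) - w \<bullet> (M *v w)"
  have quad: "0 \<le> 2 * t * (w \<bullet> w) + t\<^sup>2 * q" for t
  proof -
    have "(v + t *\<^sub>R w) \<bullet> (M *v (v + t *\<^sub>R w)) \<le> l * ((v + t *\<^sub>R w) \<bullet> (v + t *\<^sub>R w))"
      using V vV wV by (intro le) (simp add: subspace_add subspace_scale)
    moreover have "v \<bullet> (M *v w) = w \<bullet> (M *v v)"
      using inner_transpose[of v M w] sym by (simp add: inner_commute)
    ultimately have "l + 2 * t * (w \<bullet> (M *v v)) + t\<^sup>2 * (w \<bullet> (M *v w))
        \<le> l + 2 * t * (l * (v \<bullet> w)) + t\<^sup>2 * (l * (w \<bullet> w))"
      using vv by (simp add: matrix_vector_right_distrib matrix_vector_mult_scaleR inner_add_left inner_add_right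
          inner_commute[of w v] power2_eq_square algebra_simps flip: l_def)
    moreover have "w \<bullet> w = l * (v \<bullet> w) - w \<bullet> (M *v v)"
      using arg_cong[OF w_def, of "\<lambda>z. w \<bullet> z"] by (simp add: inner_diff_right inner_commute)
    then have "2 * t * (w \<bullet> w) = 2 * t * (l * (v \<bullet> w)) - 2 * t * (w \<bullet> (M *v v))"
      by (simp only: right_diff_distrib)
    moreover have "t\<^sup>2 * q = t\<^sup>2 * (l * (w \<bullet> w)) - t\<^sup>2 * (w \<bullet> (M *v w))"
      by (simp add: q_def algebra_simps)
    ultimately show ?thesis by linarith
  qed
  have "w \<bullet> w = 0"
  proof (rule ccontr)
    assume "w \<bullet> w \<noteq> 0"
    then have pos: "w \<bullet> w > 0" by (metis inner_ge_zero order_le_less)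
    define t where "t = - (w \<bullet> w) / (\<bar>q\<bar> + 1)"
    have "t * (w \<bullet> w) < 0" using pos by (simp add: t_def divide_neg_pos mult_neg_pos)
    have "t\<^sup>2 * q \<le> t\<^sup>2 * (\<bar>q\<bar> + 1)" by (intro mult_left_mono) auto
    also have "\<dots> = - t * (w \<bullet> w)"
      by (simp add: t_def power2_eq_square)
    finally show False
      using quad[of t] \<open>t * (w \<bullet> w) < 0\<close> by linarith
  qed
  then have "M *v v = l *\<^sub>R v" by (simp add: w_def)
  then show ?thesis using that vV nv by blast
qed

text \<open>A maximal orthonormal family of eigenvectors spans the space: otherwise its orthogonal
  complement, which is again invariant, would contribute a further eigenvector.\<close>

lemma symmetric_diagonalization:
  fixes M :: "real^'n^'n"
  assumes sym: "transpose M = M"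
  obtains Q d where "orthogonal_matrix Q" "M = Q ** diag_mat d ** transpose Q"
proof -
  define \<B> where "\<B> = {B. pairwise orthogonal B \<and> (\<forall>v\<in>B. norm v = 1 \<and> (\<exists>l. M *v v = l *\<^sub>R v))}"
  have indep: "independent B" if "B \<in> \<B>" for B
    using that by (intro pairwise_orthogonal_independent) (auto simp: \<B>_def)
  have card_le: "card B \<le> DIM(real^'n)" if "B \<in> \<B>" for B
    using indep[OF that] independent_bound by blast
  have "{} \<in> \<B>" by (simp add: \<B>_def)
  then obtain B where B: "B \<in> \<B>" and max: "\<And>C. C \<in> \<B> \<Longrightarrow> card C \<le> card B"
    using ex_has_greatest_nat[of "\<lambda>B. B \<in> \<B>" "{}" card "Suc DIM(real^'n)"] card_le
    by (auto simp: less_Suc_eq_le)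
  have orth: "pairwise orthogonal B" and unit: "\<And>v. v \<in> B \<Longrightarrow> norm v = 1"
    and eig: "\<And>v. v \<in> B \<Longrightarrow> \<exists>l. M *v v = l *\<^sub>R v"
    using B by (auto simp: \<B>_def)
  have fin: "finite B" using indep[OF B] independent_bound by blast
  define V where "V = {x. \<forall>b\<in>B. x \<bullet> b = 0}"
  have sV: "subspace V"
    unfolding V_def by (auto simp: subspace_def inner_add_left)
  have "V = {0}"
  proof (rule ccontr)
    assume "V \<noteq> {0}"
    have "M *v x \<in> V" if "x \<in> V" for x
    proof -
      have "(M *v x) \<bullet> b = 0" if b: "b \<in> B" for b
      proof -
        obtain l where "M *v b = l *\<^sub>R b" using eig[OF b] by auto
        then have "b \<bullet> (M *v x) = l * (b \<bullet> x)"
          using inner_transpose[of b M x] sym by simp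
        then show ?thesis
          using \<open>x \<in> V\<close> b by (simp add: V_def inner_commute)
      qed
      then show ?thesis by (simp add: V_def)
    qed
    then obtain v l where v: "v \<in> V" "norm v = 1" "M *v v = l *\<^sub>R v"
      using symmetric_eigenvector_in_invariant_subspace[OF sym sV _ \<open>V \<noteq> {0}\<close>] by blast
    have "v \<notin> B" using v by (auto simp: V_def)
    have "insert v B \<in> \<B>"
      using B v by (auto simp: \<B>_def V_def pairwise_insert orthogonal_def inner_commute)
    from max[OF this] show False using \<open>v \<notin> B\<close> fin by simp
  qed
  have "span B = UNIV"
  proof (rule ccontr)
    assume "span B \<noteq> UNIV"
    then have "span B \<subset> span UNIV" by auto
    then obtain a where a: "a \<noteq> 0" "\<And>x. x \<in> span B \<Longrightarrow> orthogonal a x"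
      using orthogonal_to_subspace_exists_gen[of B UNIV] by blast
    then have "a \<in> V" by (auto simp: V_def orthogonal_def span_base)
    with \<open>V = {0}\<close> a show False by auto
  qed
  then have "card B = CARD('n)"
    using dim_eq_card_independent[OF indep[OF B]] dim_span[of B] by simp
  then obtain f where f: "bij_betw f (UNIV :: 'n set) B"
    using finite_same_card_bij[OF finite_class.finite_UNIV fin] by auto
  obtain e where e: "\<And>v. v \<in> B \<Longrightarrow> M *v v = e v *\<^sub>R v"
    using eig by metis
  define Q :: "real^'n^'n" where "Q = (\<chi> i j. f j $ i)"
  have col: "column j Q = f j" for j by (simp add: Q_def column_def vec_eq_iff)
  have fB: "f j \<in> B" for j using f by (auto simp: bij_betw_def)
  have Q: "orthogonal_matrix Q"
    unfolding orthogonal_matrix_orthonormal_columns col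
    using unit fB orth f by (fastforce simp: pairwise_def bij_betw_def inj_def)
  have "(M ** Q) $ i $ j = (Q ** diag_mat (e \<circ> f)) $ i $ j" for i j
  proof -
    have "(M ** Q) $ i $ j = (M *v f j) $ i"
      by (simp add: matrix_matrix_mult_def matrix_vector_mult_def Q_def)
    then show ?thesis by (simp add: e fB matrix_mult_diag_nth Q_def)
  qed
  then have MQ: "M ** Q = Q ** diag_mat (e \<circ> f)" by (simp add: vec_eq_iff)
  have "M = M ** (Q ** transpose Q)" using Q by (simp add: orthogonal_matrix_def)
  also have "\<dots> = Q ** diag_mat (e \<circ> f) ** transpose Q" using MQ by (simp add: matrix_mul_assoc)
  finally show ?thesis using that Q by blast
qed

section \<open>Positive definite matrices\<close>

(* Vectors are multiplied by matrices from the left throughout, transposed or not. *)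
declare transpose_matrix_vector [simp del] vector_transpose_matrix [simp del]

lemma matrix_diff_ldistrib: "A ** (B - C) = A ** B - A ** C" for A :: "real^'n^'m"
  by (vector matrix_matrix_mult_def sum_subtractf[symmetric] right_diff_distrib)

lemma matrix_diff_rdistrib: "(A - B) ** C = A ** C - B ** C" for A :: "real^'n^'m"
  by (vector matrix_matrix_mult_def sum_subtractf[symmetric] left_diff_distrib)

lemma matrix_add_rdistrib: "(A + B) ** C = A ** C + B ** C" for A :: "real^'n^'m"
  by (vector matrix_matrix_mult_def sum.distrib[symmetric] distrib_right)

lemmas matrix_distribs = matrix_add_ldistrib matrix_add_rdistrib matrix_diff_ldistrib matrix_diff_rdistrib
  scalar_matrix_assoc[symmetric] matrix_scalar_ac

lemma transpose_add: "transpose (A + B) = transpose A + transpose B" for A :: "real^'n^'m"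
  by (simp add: vec_eq_iff transpose_def)

lemma trace_scaleR: "trace (k *\<^sub>R A) = k * trace A" for A :: "real^'n^'n"
  by (simp add: trace_def sum_distrib_left)

lemma matrix_inv_mult:
  fixes A :: "real^'n^'n"
  assumes "invertible A"
  shows "A ** matrix_inv A = mat 1" "matrix_inv A ** A = mat 1"
  using someI_ex[OF assms[unfolded invertible_def]] by (simp_all add: matrix_inv_def)

lemma matrix_inv_eqI:
  fixes A :: "real^'n^'n"
  assumes "A ** B = mat 1"
  shows "matrix_inv A = B"
proof -
  have "B ** A = mat 1" using assms by (simp add: matrix_left_right_inverse)
  then have "invertible A" using assms by (auto simp: invertible_def)
  then have "matrix_inv A ** (A ** B) = B"
    by (simp add: matrix_mul_assoc matrix_inv_mult)
  then show ?thesis by (simp add: assms)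
qed

lemma matrix_inv_congruence:
  fixes A M :: "real^'n^'n"
  assumes "invertible A" "invertible M"
  shows "matrix_inv (A ** M ** transpose A)
    = transpose (matrix_inv A) ** matrix_inv M ** matrix_inv A"
proof (rule matrix_inv_eqI)
  have "transpose A ** transpose (matrix_inv A) = mat 1"
    using assms by (simp add: matrix_inv_mult flip: matrix_transpose_mul)
  then have "A ** M ** (transpose A ** transpose (matrix_inv A)) ** matrix_inv M ** matrix_inv A = mat 1"
    using assms matrix_inv_mult[of A] matrix_inv_mult[of M]
    by (metis matrix_mul_assoc matrix_mul_rid)
  then show "A ** M ** transpose A ** (transpose (matrix_inv A) ** matrix_inv M ** matrix_inv A) = mat 1"
    by (simp add: matrix_mul_assoc)
qed

lemma matrix_inv_mat_1 [simp]: "matrix_inv (mat 1 :: real^'n^'n) = mat 1"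
  by (rule matrix_inv_eqI) simp


lemma trace_conjugate:
  fixes A M :: "real^'n^'n"
  assumes "invertible A"
  shows "trace (A ** M ** matrix_inv A) = trace M"
proof -
  have "trace (A ** M ** matrix_inv A) = trace (matrix_inv A ** (A ** M))" by (rule trace_mul_sym)
  then show ?thesis using assms by (simp add: matrix_mul_assoc matrix_inv_mult)
qed

definition pos_semidef :: "real^'n^'n \<Rightarrow> bool" where
  "pos_semidef A \<longleftrightarrow> transpose A = A \<and> (\<forall>x. 0 \<le> x \<bullet> (A *v x))"

lemma pos_def_imp_pos_semidef: "pos_def A \<Longrightarrow> pos_semidef A"
  unfolding pos_def_def pos_semidef_def by (metis inner_zero_left order_le_less)

lemma pos_def_add_pos_semidef: "pos_def A \<Longrightarrow> pos_semidef B \<Longrightarrow> pos_def (A + B)"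
  by (simp add: pos_def_def pos_semidef_def transpose_add matrix_vector_mult_add_rdistrib
      inner_add_right add_pos_nonneg)

lemma pos_def_scaleR: "pos_def A \<Longrightarrow> 0 < k \<Longrightarrow> pos_def (k *\<^sub>R A)"
  by (simp add: pos_def_def transpose_scalar flip: scaleR_matrix_vector_assoc)

lemma pos_semidef_scaleR: "pos_semidef A \<Longrightarrow> 0 \<le> k \<Longrightarrow> pos_semidef (k *\<^sub>R A)"
  by (simp add: pos_semidef_def transpose_scalar flip: scaleR_matrix_vector_assoc)

lemma quadratic_form_congruence:
  "x \<bullet> ((A ** M ** transpose A) *v x) = (transpose A *v x) \<bullet> (M *v (transpose A *v x))"
  for A :: "real^'n^'m"
  by (simp add: inner_transpose[of x A] flip: matrix_vector_mul_assoc)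

lemma pos_semidef_congruence:
  "pos_semidef M \<Longrightarrow> pos_semidef (A ** M ** transpose A)" for A :: "real^'n^'m"
  unfolding pos_semidef_def quadratic_form_congruence
  by (simp add: matrix_transpose_mul matrix_mul_assoc)

lemma pos_semidef_gram: "pos_semidef (transpose X ** X)" for X :: "real^'n^'m"
  using inner_transpose[of _ "transpose X"]
  by (auto simp: pos_semidef_def matrix_transpose_mul simp flip: matrix_vector_mul_assoc)

lemma invertible_mult_vec_eq_0_iff:
  "invertible A \<Longrightarrow> A *v x = 0 \<longleftrightarrow> x = 0" for A :: "real^'n^'n"
  by (metis invertible_def matrix_vector_mul_assoc matrix_vector_mul_lid matrix_vector_mult_0_right)

lemma pos_def_congruence:
  fixes A M :: "real^'n^'n"
  assumes "invertible A" "pos_def M"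
  shows "pos_def (A ** M ** transpose A)"
  using assms unfolding pos_def_def quadratic_form_congruence
  by (simp add: matrix_transpose_mul matrix_mul_assoc invertible_mult_vec_eq_0_iff transpose_invertible)

lemma pos_def_diag_mat_iff: "pos_def (diag_mat d) \<longleftrightarrow> (\<forall>i. 0 < d i)"
proof
  assume *: "pos_def (diag_mat d)"
  have "axis i 1 \<bullet> (diag_mat d *v axis i 1) = d i" for i
    by (simp add: inner_axis' diag_mat_vec)
  then show "\<forall>i. 0 < d i"
    using * by (metis pos_def_def axis_eq_0_iff zero_neq_one)
next
  assume d: "\<forall>i. 0 < d i"
  have "0 < x \<bullet> (diag_mat d *v x)" if x: "x \<noteq> 0" for x
  proof -
    obtain i where "x $ i \<noteq> 0" using x by (metis vec_eq_iff zero_index)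
    then show ?thesis
      unfolding inner_vec_def diag_mat_vec inner_real_def using d
      by (intro sum_pos2[of _ i]) (auto simp: mult.left_commute mult_pos_pos less_imp_le zero_less_mult_iff)
  qed
  then show "pos_def (diag_mat d)" by (simp add: pos_def_def)
qed

lemma pos_def_mat_1: "pos_def (mat 1 :: real^'n^'n)"
  using pos_def_diag_mat_iff[of "\<lambda>_::'n. 1"] by (simp add: diag_mat_one)

lemma pos_semidef_diag_mat_iff: "pos_semidef (diag_mat d) \<longleftrightarrow> (\<forall>i. 0 \<le> d i)"
proof
  assume *: "pos_semidef (diag_mat d)"
  have "axis i 1 \<bullet> (diag_mat d *v axis i 1) = d i" for i
    by (simp add: inner_axis' diag_mat_vec)
  then show "\<forall>i. 0 \<le> d i"
    using * by (metis pos_semidef_def)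
next
  assume d: "\<forall>i. 0 \<le> d i"
  have "0 \<le> x \<bullet> (diag_mat d *v x)" for x
    unfolding inner_vec_def diag_mat_vec inner_real_def using d
    by (intro sum_nonneg) (simp add: mult.left_commute)
  then show "pos_semidef (diag_mat d)" by (simp add: pos_semidef_def)
qed

lemma congruence_cancel:
  fixes A M :: "real^'n^'n"
  assumes "invertible A"
  shows "matrix_inv A ** (A ** M ** transpose A) ** transpose (matrix_inv A) = M"
proof -
  have "transpose A ** transpose (matrix_inv A) = mat 1"
    using assms by (simp add: matrix_inv_mult flip: matrix_transpose_mul)
  moreover have "matrix_inv A ** (A ** M ** transpose A) ** transpose (matrix_inv A)
    = (matrix_inv A ** A) ** M ** (transpose A ** transpose (matrix_inv A))"
    by (simp add: matrix_mul_assoc)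
  ultimately show ?thesis using assms by (simp add: matrix_inv_mult)
qed

lemma invertible_matrix_inv: "invertible A \<Longrightarrow> invertible (matrix_inv A)" for A :: "real^'n^'n"
  by (auto simp: invertible_def[of "matrix_inv A"] intro: matrix_inv_mult)

lemma pos_def_congruence_iff:
  "invertible A \<Longrightarrow> pos_def (A ** M ** transpose A) \<longleftrightarrow> pos_def M" for A :: "real^'n^'n"
  by (metis congruence_cancel invertible_matrix_inv pos_def_congruence)

lemma pos_semidef_congruence_iff:
  "invertible A \<Longrightarrow> pos_semidef (A ** M ** transpose A) \<longleftrightarrow> pos_semidef M" for A :: "real^'n^'n"
  by (metis congruence_cancel pos_semidef_congruence)

text \<open>Reduce \<open>P\<close> to the identity by the inverse of a square root \<open>L\<close> of it, then diagonalize the transformed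
  \<open>T\<close> by an orthogonal matrix, which leaves the identity unchanged.\<close>

lemma pos_def_simultaneous_diagonalization:
  fixes P T :: "real^'n^'n"
  assumes P: "pos_def P" and T: "transpose T = T"
  obtains A :: "real^'n^'n" and t where "invertible A" "P = A ** transpose A" "T = A ** diag_mat t ** transpose A"
proof -
  obtain Q d where Q: "orthogonal_matrix Q" and PQ: "P = Q ** diag_mat d ** transpose Q"
    using symmetric_diagonalization[of P] P by (auto simp: pos_def_def)
  have Qi: "invertible Q" and QQ: "Q ** transpose Q = mat 1" "transpose Q ** Q = mat 1"
    using Q by (auto simp: orthogonal_matrix_def invertible_def)
  have "pos_def (diag_mat d)"
    using P PQ Qi pos_def_congruence_iff by blast
  then have d: "0 < d i" for i by (simp add: pos_def_diag_mat_iff)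
  define L where "L = Q ** diag_mat (\<lambda>i. sqrt (d i))"
  define L' where "L' = diag_mat (\<lambda>i. 1 / sqrt (d i)) ** transpose Q"
  have "diag_mat (\<lambda>i. sqrt (d i)) ** diag_mat (\<lambda>i. 1 / sqrt (d i)) = mat 1"
    using d by (simp add: diag_mat_mult diag_mat_one less_imp_neq[symmetric] flip: diag_mat_one)
  moreover have "L ** L' = Q ** (diag_mat (\<lambda>i. sqrt (d i)) ** diag_mat (\<lambda>i. 1 / sqrt (d i))) ** transpose Q"
    by (simp add: L_def L'_def matrix_mul_assoc)
  ultimately have LL': "L ** L' = mat 1" by (simp add: QQ)
  then have L: "invertible L"
    using matrix_left_right_inverse by (auto simp: invertible_def)
  have PL: "P = L ** transpose L"
  proof -
    have "diag_mat (\<lambda>i. sqrt (d i)) ** diag_mat (\<lambda>i. sqrt (d i)) = diag_mat d"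
      using d by (simp add: diag_mat_mult less_imp_le)
    moreover have "L ** transpose L
        = Q ** (diag_mat (\<lambda>i. sqrt (d i)) ** diag_mat (\<lambda>i. sqrt (d i))) ** transpose Q"
      by (simp add: L_def matrix_transpose_mul matrix_mul_assoc)
    ultimately show ?thesis by (simp add: PQ)
  qed
  have "transpose (L' ** T ** transpose L') = L' ** T ** transpose L'"
    by (simp add: matrix_transpose_mul T matrix_mul_assoc)
  then obtain Q1 t where Q1: "orthogonal_matrix Q1"
    and TQ: "L' ** T ** transpose L' = Q1 ** diag_mat t ** transpose Q1"
    using symmetric_diagonalization by blast
  define A where "A = L ** Q1"
  have "invertible A"
    unfolding A_def using L Q1 by (intro invertible_mult) (auto simp: orthogonal_matrix_def invertible_def)
  moreover have "P = A ** transpose A"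
  proof -
    have "A ** transpose A = L ** (Q1 ** transpose Q1) ** transpose L"
      by (simp add: A_def matrix_transpose_mul matrix_mul_assoc)
    then show ?thesis using Q1 PL by (simp add: orthogonal_matrix_def)
  qed
  moreover have "T = A ** diag_mat t ** transpose A"
  proof -
    have "A ** diag_mat t ** transpose A = L ** (Q1 ** diag_mat t ** transpose Q1) ** transpose L"
      by (simp add: A_def matrix_transpose_mul matrix_mul_assoc)
    also have "\<dots> = (L ** L') ** T ** transpose (L ** L')"
      by (simp only: flip: TQ) (simp add: matrix_transpose_mul matrix_mul_assoc)
    finally show ?thesis by (simp add: LL')
  qed
  ultimately show ?thesis by (rule that)
qed

lemma pos_def_det_pos:
  fixes P :: "real^'n^'n"
  assumes "pos_def P"
  shows "0 < det P"
proof -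
  obtain A :: "real^'n^'n" and t where "invertible A" "P = A ** transpose A"
    using pos_def_simultaneous_diagonalization[OF assms, of P] assms by (auto simp: pos_def_def)
  then show ?thesis by (simp add: det_mul invertible_det_nz flip: power2_eq_square)
qed

lemma pos_def_invertible: "pos_def P \<Longrightarrow> invertible P"
  using pos_def_det_pos invertible_det_nz by force

lemma symmetric_matrix_inv:
  fixes P :: "real^'n^'n"
  assumes "invertible P" "transpose P = P"
  shows "transpose (matrix_inv P) = matrix_inv P"
  by (metis assms matrix_inv_eqI matrix_inv_mult(2) matrix_transpose_mul transpose_mat)

lemma pos_def_matrix_inv:
  fixes P :: "real^'n^'n"
  assumes "pos_def P"
  shows "pos_def (matrix_inv P)"
proof -
  have inv: "invertible P" and sym: "transpose P = P"
    using assms by (auto simp: pos_def_invertible pos_def_def)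
  have "pos_def (matrix_inv P ** P ** transpose (matrix_inv P))"
    using assms inv by (intro pos_def_congruence invertible_matrix_inv)
  then show ?thesis
    by (simp add: matrix_inv_mult inv symmetric_matrix_inv sym)
qed

text \<open>Completing the square: the defect is the quadratic form of \<open>M\<close> at \<open>M\<inverse> y - x\<close>.\<close>

lemma matrix_inv_quadratic_form_lower_bound:
  fixes M :: "real^'n^'n"
  assumes "pos_def M"
  shows "2 * (x \<bullet> y) - x \<bullet> (M *v x) \<le> y \<bullet> (matrix_inv M *v y)"
proof -
  define z where "z = matrix_inv M *v y"
  have Mz: "M *v z = y"
    using assms by (simp add: z_def matrix_vector_mul_assoc matrix_inv_mult pos_def_invertible)
  have "0 \<le> (z - x) \<bullet> (M *v (z - x))"
    using pos_def_imp_pos_semidef[OF assms] by (simp add: pos_semidef_def)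
  moreover have "z \<bullet> (M *v x) = x \<bullet> y"
    using inner_transpose[of z M x] assms by (simp add: pos_def_def Mz inner_commute)
  ultimately show ?thesis
    by (simp add: matrix_vector_mult_diff_distrib inner_diff_left inner_diff_right Mz inner_commute
        flip: z_def)
qed

lemma det_mono_pos_semidef:
  fixes A T :: "real^'n^'n"
  assumes A: "pos_def A" and T: "pos_semidef T"
  shows "det A \<le> det (A + T)"
proof -
  obtain C :: "real^'n^'n" and t where C: "invertible C" and AC: "A = C ** transpose C"
    and TC: "T = C ** diag_mat t ** transpose C"
    using pos_def_simultaneous_diagonalization[OF A, of T] T by (auto simp: pos_semidef_def)
  have t: "0 \<le> t j" for j
    using T pos_semidef_congruence_iff[OF C] by (simp add: TC pos_semidef_diag_mat_iff)
  have "diag_mat (\<lambda>j. 1 + t j) = mat 1 + diag_mat t"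
    by (simp add: vec_eq_iff mat_def)
  then have "A + T = C ** diag_mat (\<lambda>j. 1 + t j) ** transpose C"
    by (simp add: AC TC matrix_distribs)
  then have "det (A + T) = det A * (\<Prod>j\<in>UNIV. 1 + t j)"
    by (simp add: AC det_mul det_diag_mat)
  moreover have "1 \<le> (\<Prod>j\<in>UNIV. 1 + t j)" using t by (intro prod_ge_1) simp
  ultimately show ?thesis
    using pos_def_det_pos[OF A] by (simp add: mult_le_cancel_left1)
qed

lemma quadratic_form_sum_outer:
  "x \<bullet> ((\<chi> j k. \<Sum>i\<in>I. u i j * u i k) *v x) = (\<Sum>i\<in>I. (\<Sum>j\<in>UNIV. u i j * x $ j :: real)\<^sup>2)"
proof -
  have "x \<bullet> ((\<chi> j k. \<Sum>i\<in>I. u i j * u i k) *v x)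
      = (\<Sum>j\<in>UNIV. \<Sum>k\<in>UNIV. \<Sum>i\<in>I. (u i j * x $ j) * (u i k * x $ k))"
    by (simp add: inner_vec_def matrix_vector_mult_def sum_distrib_left sum_distrib_right mult_ac)
  also have "\<dots> = (\<Sum>j\<in>UNIV. \<Sum>i\<in>I. \<Sum>k\<in>UNIV. (u i j * x $ j) * (u i k * x $ k))"
    by (intro sum.cong refl sum.swap)
  also have "\<dots> = (\<Sum>i\<in>I. \<Sum>j\<in>UNIV. \<Sum>k\<in>UNIV. (u i j * x $ j) * (u i k * x $ k))"
    by (rule sum.swap)
  finally show ?thesis by (simp add: power2_eq_square sum_product)
qed

lemma pos_semidef_sum_outer: "pos_semidef (\<chi> j k. \<Sum>i\<in>I. u i j * u i k)"
  unfolding pos_semidef_def quadratic_form_sum_outer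
  by (auto simp: transpose_def vec_eq_iff mult.commute intro!: sum_nonneg)

section \<open>Scalar inequalities\<close>

text \<open>The difference of the two sides has derivative
  \<open>1 / (1 + y) - 4 / (2 + y)\<^sup>2\<close>, which is nonnegative because \<open>4 (1 + y) \<le> (2 + y)\<^sup>2\<close>.\<close>

lemma ln_one_plus_lower_bound:
  fixes y :: real
  assumes "0 \<le> y"
  shows "2 * y / (2 + y) \<le> ln (1 + y)"
proof -
  define f where "f = (\<lambda>y. ln (1 + y) - 2 * y / (2 + y :: real))"
  have "\<exists>D. (f has_real_derivative D) (at x) \<and> 0 \<le> D" if "0 \<le> x" "x \<le> y" for x
  proof (intro exI conjI)
    show "(f has_real_derivative 1 / (1 + x) - 4 / (2 + x)\<^sup>2) (at x)"
      unfolding f_def using that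
      by (auto intro!: derivative_eq_intros simp: power2_eq_square)
    have "4 * (1 + x) \<le> (2 + x)\<^sup>2"
      by (simp add: power2_eq_square algebra_simps)
    then show "0 \<le> 1 / (1 + x) - 4 / (2 + x)\<^sup>2"
      using that by (simp add: field_simps)
  qed
  then have "f 0 \<le> f y"
    using DERIV_nonneg_imp_nondecreasing[OF assms] by blast
  then show ?thesis by (simp add: f_def)
qed

text \<open>With \<open>y = (1 - \<kappa>) / \<kappa>\<close> the bound \<open>2 y / (2 + y) \<le> ln (1 + y)\<close> becomes
  \<open>2 (1 - \<kappa>) / (1 + \<kappa>) \<le> ln (1 / \<kappa>)\<close>, and the lower bound on \<open>\<kappa>\<close> says that
  \<open>2 \<kappa> / (1 + \<kappa>)\<close> exceeds \<open>\<nu> / n\<close>.\<close>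

lemma shrinkage_threshold:
  fixes \<kappa> \<nu> n :: real
  assumes "0 < \<kappa>" "\<kappa> < 1" "0 < \<nu>" "\<nu> < n" "\<nu> / (2 * n - \<nu>) < \<kappa>"
  shows "(1 - \<kappa>) * \<nu> / n < \<kappa> * ln (1 / \<kappa>)"
proof -
  have "2 * ((1 - \<kappa>) / \<kappa>) / (2 + (1 - \<kappa>) / \<kappa>) \<le> ln (1 + (1 - \<kappa>) / \<kappa>)"
    using assms by (intro ln_one_plus_lower_bound) simp
  also have "1 + (1 - \<kappa>) / \<kappa> = 1 / \<kappa>" using assms by (simp add: field_simps)
  also have "2 * ((1 - \<kappa>) / \<kappa>) / (2 + (1 - \<kappa>) / \<kappa>) = 2 * (1 - \<kappa>) / (1 + \<kappa>)"
  proof -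
    have "2 + (1 - \<kappa>) / \<kappa> = (1 + \<kappa>) / \<kappa>" using assms by (simp add: field_simps)
    then show ?thesis using assms by simp
  qed
  finally have ln: "2 * (1 - \<kappa>) / (1 + \<kappa>) \<le> ln (1 / \<kappa>)" .
  have "\<nu> < \<kappa> * (2 * n - \<nu>)" using assms by (simp add: pos_divide_less_eq)
  then have "\<nu> * (1 + \<kappa>) < 2 * \<kappa> * n" by (simp add: algebra_simps)
  then have "\<nu> / n < 2 * \<kappa> / (1 + \<kappa>)" using assms by (simp add: divide_simps)
  then have "(1 - \<kappa>) * (\<nu> / n) < (1 - \<kappa>) * (2 * \<kappa> / (1 + \<kappa>))"
    using assms by (intro mult_strict_left_mono) auto
  also have "\<dots> = \<kappa> * (2 * (1 - \<kappa>) / (1 + \<kappa>))" by simp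
  also have "\<dots> \<le> \<kappa> * ln (1 / \<kappa>)" using ln assms by (intro mult_left_mono) auto
  finally show ?thesis by simp
qed

text \<open>The chord of the concave function \<open>ln\<close> between \<open>1\<close> and \<open>1 / \<kappa>\<close>.\<close>

lemma ln_chord:
  fixes \<kappa> t :: real
  assumes "0 < \<kappa>" "\<kappa> < 1" "0 \<le> t" "\<kappa> * t \<le> 1"
  shows "t * (\<kappa> * ln (1 / \<kappa>)) \<le> ln (1 + (1 - \<kappa>) * t)"
proof -
  have "(1 - \<kappa> * t) * ln 1 + \<kappa> * t * ln (1 / \<kappa>) \<le> ln ((1 - \<kappa> * t) *\<^sub>R 1 + (\<kappa> * t) *\<^sub>R (1 / \<kappa>))"
    using assms by (intro concave_onD[OF ln_concave]) auto
  also have "(1 - \<kappa> * t) *\<^sub>R 1 + (\<kappa> * t) *\<^sub>R (1 / \<kappa>) = 1 + (1 - \<kappa>) * t"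
    using assms by (simp add: algebra_simps)
  finally show ?thesis by (simp add: mult_ac)
qed

section \<open>The Stein loss of the shrunken estimator\<close>

text \<open>In terms of the eigenvalues \<open>t\<^sub>i\<close> of \<open>D \<Sigma>\<^sup>-\<^sup>1\<close> the loss is \<open>\<Sum>\<^sub>i (t\<^sub>i - 1 - ln t\<^sub>i)\<close>.\<close>

lemma stein_loss_nonneg:
  fixes D \<Sigma> :: "real^'n^'n"
  assumes D: "pos_def D" and \<Sigma>: "pos_def \<Sigma>"
  shows "0 \<le> stein_loss D \<Sigma>"
proof -
  obtain A :: "real^'n^'n" and t where A: "invertible A" "\<Sigma> = A ** transpose A"
    and DA: "D = A ** diag_mat t ** transpose A"
    using pos_def_simultaneous_diagonalization[OF \<Sigma>, of D] D by (auto simp: pos_def_def)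
  have t: "0 < t i" for i
    using D A pos_def_congruence_iff[OF A(1)] by (simp add: DA pos_def_diag_mat_iff)
  have "\<Sigma> = A ** mat 1 ** transpose A" using A by simp
  then have "D ** matrix_inv \<Sigma> = A ** diag_mat t ** transpose A ** (transpose (matrix_inv A) ** matrix_inv A)"
    using matrix_inv_congruence[OF A(1), of "mat 1"] matrix_inv_eqI[of "mat 1 :: real^'n^'n" "mat 1"]
    by (simp add: DA invertible_def[of "mat 1"])
  also have "\<dots> = A ** diag_mat t ** transpose (matrix_inv A ** A) ** matrix_inv A"
    by (simp only: matrix_transpose_mul matrix_mul_assoc)
  finally have eq: "D ** matrix_inv \<Sigma> = A ** diag_mat t ** matrix_inv A"
    by (simp add: matrix_inv_mult A)
  have "trace (D ** matrix_inv \<Sigma>) = trace (matrix_inv A ** (A ** diag_mat t))"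
    unfolding eq by (rule trace_mul_sym)
  also have "\<dots> = sum t UNIV"
    by (simp add: matrix_mul_assoc matrix_inv_mult A trace_diag_mat)
  finally have tr: "trace (D ** matrix_inv \<Sigma>) = sum t UNIV" .
  have "det A * det (matrix_inv A) = 1"
    using A by (simp add: matrix_inv_mult flip: det_mul)
  then have "det (D ** matrix_inv \<Sigma>) = prod t UNIV"
    by (simp add: eq det_mul det_diag_mat mult_ac)
  then have "ln (det (D ** matrix_inv \<Sigma>)) = (\<Sum>i\<in>UNIV. ln (t i))"
    using t by (simp add: ln_prod less_imp_neq[symmetric])
  also have "\<dots> \<le> (\<Sum>i\<in>UNIV. t i - 1)"
    by (intro sum_mono ln_le_minus_one t)
  finally show ?thesis by (simp add: stein_loss_def tr sum_subtractf)
qed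

text \<open>A rank-\<open>m\<close> instance of the Sherman--Morrison--Woodbury formula.\<close>

lemma woodbury:
  fixes X :: "real^'p^'m" and S :: "real^'p^'p"
  assumes S: "pos_def S" and k: "0 \<le> k"
  defines "G \<equiv> matrix_inv (mat 1 + k *\<^sub>R (X ** matrix_inv S ** transpose X))"
    and "R \<equiv> matrix_inv (S + k *\<^sub>R (transpose X ** X))"
  shows "pos_def G" and "k *\<^sub>R (transpose X ** G ** X) = S - S ** R ** S"
proof -
  define F where "F = X ** matrix_inv S ** transpose X"
  have "pos_semidef F"
    unfolding F_def by (intro pos_semidef_congruence pos_def_imp_pos_semidef pos_def_matrix_inv S)
  moreover have "pos_def (mat 1 :: real^'m^'m)" by (rule pos_def_mat_1)
  ultimately have pdH: "pos_def (mat 1 + k *\<^sub>R F)"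
    by (intro pos_def_add_pos_semidef pos_semidef_scaleR k)
  then show "pos_def G" unfolding G_def F_def[symmetric] by (rule pos_def_matrix_inv)
  have Si: "S ** matrix_inv S = mat 1" "matrix_inv S ** S = mat 1"
    using S by (simp_all add: matrix_inv_mult pos_def_invertible)
  have HG: "G + k *\<^sub>R (F ** G) = mat 1"
    using matrix_inv_mult(1)[OF pos_def_invertible[OF pdH]]
    by (simp add: G_def F_def matrix_distribs)
  define U where "U = transpose X ** G ** X"
  have "R = matrix_inv S - k *\<^sub>R (matrix_inv S ** U ** matrix_inv S)"
    unfolding R_def
  proof (rule matrix_inv_eqI)
    have 1: "S ** (matrix_inv S ** U ** matrix_inv S) = U ** matrix_inv S"
      by (simp add: matrix_mul_assoc Si)
    have "transpose X ** X ** (matrix_inv S ** U ** matrix_inv S) = transpose X ** (F ** G) ** X ** matrix_inv S"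
      by (simp add: F_def U_def matrix_mul_assoc)
    then have "k *\<^sub>R (transpose X ** X ** (matrix_inv S ** U ** matrix_inv S))
        = transpose X ** (k *\<^sub>R (F ** G)) ** X ** matrix_inv S"
      by (simp add: matrix_distribs)
    also have "k *\<^sub>R (F ** G) = mat 1 - G"
      using HG by (simp add: algebra_simps)
    finally have 2: "k *\<^sub>R (transpose X ** X ** (matrix_inv S ** U ** matrix_inv S))
        = transpose X ** X ** matrix_inv S - U ** matrix_inv S"
      by (simp add: matrix_distribs U_def)
    show "(S + k *\<^sub>R (transpose X ** X)) ** (matrix_inv S - k *\<^sub>R (matrix_inv S ** U ** matrix_inv S)) = mat 1"
      by (simp add: matrix_distribs 1 2 Si scaleR_diff_right)
  qed
  then have "S ** R ** S = S - k *\<^sub>R (S ** (matrix_inv S ** U ** matrix_inv S) ** S)"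
    by (simp add: matrix_distribs Si)
  also have "S ** (matrix_inv S ** U ** matrix_inv S) ** S = (S ** matrix_inv S) ** U ** (matrix_inv S ** S)"
    by (simp only: matrix_mul_assoc)
  finally show "k *\<^sub>R (transpose X ** G ** X) = S - S ** R ** S"
    by (simp add: Si U_def)
qed

text \<open>In the basis given by \<open>C\<close>, replacing \<open>S\<close> by \<open>S + k T\<close> multiplies the determinant by \<open>\<Prod>\<^sub>j (1 + k t\<^sub>j)\<close>.\<close>

lemma stein_loss_perturbation:
  fixes C S \<Sigma> :: "real^'n^'n"
  assumes C: "invertible C" and S: "S = C ** transpose C" and \<Sigma>: "pos_def \<Sigma>"
    and T: "T = C ** diag_mat t ** transpose C" and t: "\<And>j. 0 \<le> t j" and k: "0 \<le> k" and r: "0 < r"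
  shows "stein_loss (r *\<^sub>R (S + k *\<^sub>R T)) \<Sigma> = stein_loss (r *\<^sub>R S) \<Sigma>
    + r * k * trace (T ** matrix_inv \<Sigma>) - (\<Sum>j\<in>UNIV. ln (1 + k * t j))"
proof -
  have S': "pos_def S"
  proof -
    have "pos_def (mat 1 :: real^'n^'n)" by (rule pos_def_mat_1)
    from pos_def_congruence[OF C this] show ?thesis by (simp add: S)
  qed
  define E where "E = (r *\<^sub>R S) ** matrix_inv \<Sigma>"
  define K where "K = C ** diag_mat (\<lambda>j. 1 + k * t j) ** matrix_inv C"
  have "diag_mat (\<lambda>j. 1 + k * t j) = mat 1 + k *\<^sub>R diag_mat t"
    by (simp add: vec_eq_iff mat_def)
  then have "S + k *\<^sub>R T = C ** diag_mat (\<lambda>j. 1 + k * t j) ** transpose C"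
    by (simp add: S T matrix_distribs)
  also have "\<dots> = C ** diag_mat (\<lambda>j. 1 + k * t j) ** (matrix_inv C ** C) ** transpose C"
    by (simp add: matrix_inv_mult C)
  also have "\<dots> = K ** S"
    by (simp only: K_def S matrix_mul_assoc)
  finally have "det (r *\<^sub>R (S + k *\<^sub>R T) ** matrix_inv \<Sigma>) = det (K ** E)"
    by (simp add: E_def matrix_mul_assoc matrix_distribs)
  also have "\<dots> = det K * det E" by (rule det_mul)
  also have "det K = (\<Prod>j\<in>UNIV. 1 + k * t j)"
  proof -
    have "det C * det (matrix_inv C) = 1"
      using C by (simp add: matrix_inv_mult flip: det_mul)
    then show ?thesis by (simp add: K_def det_mul det_diag_mat mult_ac)
  qed
  finally have det: "det (r *\<^sub>R (S + k *\<^sub>R T) ** matrix_inv \<Sigma>) = (\<Prod>j\<in>UNIV. 1 + k * t j) * det E" .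
  have pos: "0 < 1 + k * t j" for j using t k by (simp add: add_pos_nonneg)
  have "det E = det (r *\<^sub>R S) * det (matrix_inv \<Sigma>)" by (simp add: E_def det_mul)
  then have "0 < det E"
    using S' r \<Sigma> by (simp add: pos_def_det_pos pos_def_scaleR pos_def_matrix_inv)
  then have "ln (det (r *\<^sub>R (S + k *\<^sub>R T) ** matrix_inv \<Sigma>)) = (\<Sum>j\<in>UNIV. ln (1 + k * t j)) + ln (det E)"
    unfolding det using pos by (subst ln_mult_pos) (auto simp: prod_pos ln_prod less_imp_neq[symmetric])
  moreover have "trace (r *\<^sub>R (S + k *\<^sub>R T) ** matrix_inv \<Sigma>) = trace E + r * k * trace (T ** matrix_inv \<Sigma>)"
    by (simp add: E_def matrix_distribs scaleR_add_right trace_add trace_scaleR algebra_simps flip: scalar_matrix_assoc)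
  ultimately show ?thesis by (simp add: stein_loss_def E_def)
qed

text \<open>The loss comparison for fixed data. In the coordinates given by \<open>A\<close>, both \<open>tr (T \<Sigma>\<^sup>-\<^sup>1)\<close> and
  \<open>tr (S\<^sup>-\<^sup>1 T)\<close> depend on \<open>W\<close> only through the diagonal of \<open>(W + diag b)\<^sup>-\<^sup>1\<close>: by Woodbury's formula
  \<open>\<kappa> T = S - S R S\<close> with \<open>R = (S + \<kappa> X\<^sup>T X)\<^sup>-\<^sup>1\<close>, and \<open>W - W R' W = B - B R' B\<close> for
  \<open>R' = (W + B)\<^sup>-\<^sup>1\<close>.\<close>

lemma stein_loss_SigmaGB_le:
  fixes X :: "real^'p^'m" and S A W :: "real^'p^'p" and k :: real and n :: nat
  assumes W: "pos_def W" and k: "0 < k" "k < 1" and n: "0 < n" and A: "invertible A"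
    and S: "S = A ** W ** transpose A" and XX: "transpose X ** X = A ** diag_mat l ** transpose A"
    and l: "\<And>j. 0 \<le> l j"
  defines "b \<equiv> \<lambda>j. (1 - k) * l j"
    and "\<Sigma> \<equiv> A ** transpose A"
  defines "r \<equiv> \<lambda>j. matrix_inv (W + diag_mat b) $ j $ j"
  shows "pos_def (SigmaGB_hat n k X S)"
    and "(1 - k) * (stein_loss (SigmaGB_hat n k X S) \<Sigma> - stein_loss (Sigma0_hat n S) \<Sigma>)
      \<le> k / real n * (\<Sum>j\<in>UNIV. b j - (b j)\<^sup>2 * r j)
        - (1 - k) * ln (1 / (1 - k)) * (\<Sum>j\<in>UNIV. b j * r j)"
proof -
  define \<kappa> where "\<kappa> = 1 - k"
  have \<kappa>: "0 < \<kappa>" "\<kappa> < 1" using k by (auto simp: \<kappa>_def)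
  have pS: "pos_def S" unfolding S using A W by (rule pos_def_congruence)
  have p1: "pos_def (mat 1 :: real^'p^'p)" by (rule pos_def_mat_1)
  have p\<Sigma>: "pos_def \<Sigma>" unfolding \<Sigma>_def using pos_def_congruence[OF A p1] by simp
  define G where "G = matrix_inv (mat 1 + \<kappa> *\<^sub>R (X ** matrix_inv S ** transpose X))"
  define R where "R = matrix_inv (S + \<kappa> *\<^sub>R (transpose X ** X))"
  define T where "T = transpose X ** G ** X"
  have pG: "pos_def G" and wood: "\<kappa> *\<^sub>R T = S - S ** R ** S"
    unfolding G_def R_def T_def using woodbury[OF pS, of \<kappa> X] \<kappa> by auto
  have pT: "pos_semidef T"
    unfolding T_def using pos_semidef_congruence[OF pos_def_imp_pos_semidef[OF pG], of "transpose X"]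
    by simp
  have pR: "pos_def R"
    unfolding R_def using \<kappa> pS
    by (intro pos_def_matrix_inv pos_def_add_pos_semidef pos_semidef_scaleR pos_semidef_gram) auto
  have GB: "SigmaGB_hat n k X S = (1 / real n) *\<^sub>R (S + k *\<^sub>R T)"
    by (simp add: SigmaGB_hat_def Sigma0_hat_def T_def G_def \<kappa>_def scaleR_add_right)
  show "pos_def (SigmaGB_hat n k X S)"
    unfolding GB using n k pT pS
    by (intro pos_def_scaleR pos_def_add_pos_semidef pos_semidef_scaleR) auto

  \<comment> \<open>The generalized eigenvalues \<open>t\<close> of \<open>T\<close> with respect to \<open>S\<close> lie in \<open>[0, 1 / \<kappa>]\<close>, the upper bound
    because \<open>S - \<kappa> T = S R S\<close> is positive semidefinite.\<close>
  obtain C :: "real^'p^'p" and t where C: "invertible C" and SC: "S = C ** transpose C"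
    and TC: "T = C ** diag_mat t ** transpose C"
    using pos_def_simultaneous_diagonalization[OF pS, of T] pT by (auto simp: pos_semidef_def)
  have t0: "0 \<le> t j" for j
    using pT pos_semidef_congruence_iff[OF C] by (simp add: TC pos_semidef_diag_mat_iff)
  have t1: "\<kappa> * t j \<le> 1" for j
  proof -
    have "pos_semidef (S ** R ** transpose S)"
      by (intro pos_semidef_congruence pos_def_imp_pos_semidef pR)
    moreover have "transpose S = S" using pS by (simp add: pos_def_def)
    ultimately have "pos_semidef (S - \<kappa> *\<^sub>R T)" using wood by simp
    moreover have "diag_mat (\<lambda>j. 1 - \<kappa> * t j) = mat 1 - \<kappa> *\<^sub>R diag_mat t"
      by (simp add: vec_eq_iff mat_def)
    then have "S - \<kappa> *\<^sub>R T = C ** diag_mat (\<lambda>j. 1 - \<kappa> * t j) ** transpose C"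
      by (simp add: SC TC matrix_distribs)
    ultimately show ?thesis
      using pos_semidef_congruence_iff[OF C] by (simp add: pos_semidef_diag_mat_iff)
  qed
  have Ai: "A ** matrix_inv A = mat 1" "matrix_inv A ** A = mat 1"
    "transpose A ** transpose (matrix_inv A) = mat 1" "transpose (matrix_inv A) ** transpose A = mat 1"
    using A by (simp_all add: matrix_inv_mult flip: matrix_transpose_mul)
  have Ci: "C ** matrix_inv C = mat 1" "matrix_inv C ** C = mat 1"
    "transpose C ** transpose (matrix_inv C) = mat 1" "transpose (matrix_inv C) ** transpose C = mat 1"
    using C by (simp_all add: matrix_inv_mult flip: matrix_transpose_mul)
  have inv1: "matrix_inv (mat 1 :: real^'p^'p) = mat 1" by (rule matrix_inv_eqI) simp
  have trt: "trace (matrix_inv S ** T) = (\<Sum>j\<in>UNIV. t j)"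
  proof -
    have "matrix_inv S = transpose (matrix_inv C) ** matrix_inv C"
      using matrix_inv_congruence[OF C, of "mat 1"] p1 by (simp add: SC pos_def_invertible inv1)
    then have "matrix_inv S ** T = transpose (matrix_inv C) ** (matrix_inv C ** C) ** diag_mat t ** transpose C"
      by (simp add: TC matrix_mul_assoc)
    then have "trace (matrix_inv S ** T) = trace (transpose C ** (transpose (matrix_inv C) ** diag_mat t))"
      by (simp add: Ci trace_mul_sym[of _ "transpose C"])
    then show ?thesis by (simp add: matrix_mul_assoc Ci trace_diag_mat)
  qed

  define B where "B = diag_mat b"
  define M where "M = W + B"
  define R' where "R' = matrix_inv M"
  have b: "0 \<le> b j" for j using l k by (simp add: b_def)
  have "pos_semidef B" using b by (simp add: B_def pos_semidef_diag_mat_iff)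
  then have pM: "pos_def M" unfolding M_def using W by (intro pos_def_add_pos_semidef)
  have Mi: "M ** R' = mat 1" "R' ** M = mat 1"
    using pM by (simp_all add: R'_def matrix_inv_mult pos_def_invertible)
  have "B = \<kappa> *\<^sub>R diag_mat l" by (simp add: B_def b_def \<kappa>_def vec_eq_iff)
  then have "S + \<kappa> *\<^sub>R (transpose X ** X) = A ** M ** transpose A"
    by (simp add: S XX M_def matrix_distribs)
  then have R: "R = transpose (matrix_inv A) ** R' ** matrix_inv A"
    unfolding R_def R'_def using A pM by (simp add: matrix_inv_congruence pos_def_invertible)
  have WM: "W = M - B" by (simp add: M_def)
  have RS: "R ** S = transpose (matrix_inv A) ** R' ** W ** transpose A"
  proof -
    have "R ** S = transpose (matrix_inv A) ** R' ** (matrix_inv A ** A) ** W ** transpose A"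
      by (simp add: R S matrix_mul_assoc)
    then show ?thesis by (simp add: Ai)
  qed
  have SRS: "S ** R ** S = A ** (W ** R' ** W) ** transpose A"
  proof -
    have "S ** R ** S = S ** (R ** S)" by (simp add: matrix_mul_assoc)
    also have "\<dots> = A ** W ** (transpose A ** transpose (matrix_inv A)) ** R' ** W ** transpose A"
      unfolding RS by (simp only: S matrix_mul_assoc)
    finally show ?thesis by (simp add: Ai matrix_mul_assoc)
  qed
  have WRW: "W - W ** R' ** W = B - B ** R' ** B"
  proof -
    have "W ** R' = mat 1 - B ** R'" by (simp add: WM matrix_distribs Mi)
    then have "W ** R' ** W = W - B ** R' ** W" by (simp add: matrix_distribs)
    moreover have "B ** R' ** W = B ** (R' ** M) - B ** R' ** B" by (simp add: WM matrix_distribs matrix_mul_assoc)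
    ultimately show ?thesis by (simp add: Mi)
  qed
  have tr1: "\<kappa> * trace (T ** matrix_inv \<Sigma>) = (\<Sum>j\<in>UNIV. b j - (b j)\<^sup>2 * r j)"
  proof -
    have "matrix_inv \<Sigma> = transpose (matrix_inv A) ** matrix_inv A"
      using matrix_inv_congruence[OF A, of "mat 1"] p1 by (simp add: \<Sigma>_def pos_def_invertible inv1)
    moreover have "\<kappa> *\<^sub>R T = A ** (B - B ** R' ** B) ** transpose A"
      unfolding wood SRS WRW[symmetric] by (simp add: S matrix_distribs)
    ultimately have "(\<kappa> *\<^sub>R T) ** matrix_inv \<Sigma>
        = A ** (B - B ** R' ** B) ** (transpose A ** transpose (matrix_inv A)) ** matrix_inv A"
      by (simp only: matrix_mul_assoc)
    then have "trace ((\<kappa> *\<^sub>R T) ** matrix_inv \<Sigma>) = trace (B - B ** R' ** B)"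
      using A by (simp add: Ai trace_conjugate)
    also have "\<dots> = (\<Sum>j\<in>UNIV. b j - (b j)\<^sup>2 * r j)"
      unfolding trace_def
      by (simp add: B_def matrix_mult_diag_nth diag_mult_matrix_nth r_def R'_def M_def power2_eq_square mult_ac)
    finally show ?thesis by (simp add: trace_scaleR flip: scalar_matrix_assoc)
  qed
  have tr2: "\<kappa> * (\<Sum>j\<in>UNIV. t j) = (\<Sum>j\<in>UNIV. b j * r j)"
  proof -
    have "matrix_inv S ** (\<kappa> *\<^sub>R T) = mat 1 - R ** S"
      unfolding wood using matrix_inv_mult(2)[OF pos_def_invertible[OF pS]]
      by (simp add: matrix_distribs matrix_mul_assoc)
    then have "\<kappa> * trace (matrix_inv S ** T) = trace (mat 1 :: real^'p^'p) - trace (R ** S)"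
      by (simp add: matrix_distribs trace_scaleR trace_sub flip: trace_scaleR trace_sub)
    also have "trace (R ** S) = trace (transpose A ** (transpose (matrix_inv A) ** R' ** W))"
      unfolding RS by (rule trace_mul_sym)
    also have "\<dots> = trace (R' ** W)" by (simp add: matrix_mul_assoc Ai)
    also have "R' ** W = mat 1 - R' ** B" by (simp add: WM matrix_distribs Mi)
    finally show ?thesis
      by (simp add: trt trace_sub) (simp add: trace_def B_def matrix_mult_diag_nth r_def R'_def M_def mult.commute)
  qed
  have "stein_loss (SigmaGB_hat n k X S) \<Sigma> - stein_loss (Sigma0_hat n S) \<Sigma>
      = 1 / real n * k * trace (T ** matrix_inv \<Sigma>) - (\<Sum>j\<in>UNIV. ln (1 + k * t j))"
    unfolding GB Sigma0_hat_def using n k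
    by (subst stein_loss_perturbation[OF C SC p\<Sigma> TC t0]) auto
  also have "\<dots> \<le> 1 / real n * k * trace (T ** matrix_inv \<Sigma>) - (\<Sum>j\<in>UNIV. t j * (\<kappa> * ln (1 / \<kappa>)))"
    using ln_chord[OF \<kappa> t0 t1] by (intro diff_left_mono sum_mono) (simp add: \<kappa>_def)
  finally have "\<kappa> * (stein_loss (SigmaGB_hat n k X S) \<Sigma> - stein_loss (Sigma0_hat n S) \<Sigma>)
      \<le> \<kappa> * (1 / real n * k * trace (T ** matrix_inv \<Sigma>) - (\<Sum>j\<in>UNIV. t j * (\<kappa> * ln (1 / \<kappa>))))"
    using \<kappa> by (intro mult_left_mono) auto
  also have "\<dots> = k / real n * (\<kappa> * trace (T ** matrix_inv \<Sigma>)) - \<kappa> * ln (1 / \<kappa>) * (\<kappa> * (\<Sum>j\<in>UNIV. t j))"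
    by (simp add: algebra_simps sum_distrib_left sum_distrib_right)
  finally show "(1 - k) * (stein_loss (SigmaGB_hat n k X S) \<Sigma> - stein_loss (Sigma0_hat n S) \<Sigma>)
      \<le> k / real n * (\<Sum>j\<in>UNIV. b j - (b j)\<^sup>2 * r j)
        - (1 - k) * ln (1 / (1 - k)) * (\<Sum>j\<in>UNIV. b j * r j)"
    unfolding tr1 tr2 by (simp add: \<kappa>_def)
qed

text \<open>For the \<open>j\<close>-th column \<open>z\<close> of \<open>(W + diag b)\<^sup>-\<^sup>1\<close> one has
  \<open>r = z \<bullet> (W + diag b) z \<ge> b\<^sub>j z\<^sub>j\<^sup>2 = b\<^sub>j r\<^sup>2\<close>.\<close>

lemma regularized_inverse_diagonal_bounds:
  fixes W :: "real^'p^'p" and j :: 'p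
  assumes W: "pos_def W" and b: "\<And>j. 0 \<le> b j"
  defines "r \<equiv> matrix_inv (W + diag_mat b) $ j $ j"
  shows "0 < r" and "b j * r \<le> 1"
proof -
  define M where "M = W + diag_mat b"
  have pB: "pos_semidef (diag_mat b)" using b by (simp add: pos_semidef_diag_mat_iff)
  have pM: "pos_def M" unfolding M_def using W pB by (rule pos_def_add_pos_semidef)
  define e where "e = (axis j 1 :: real^'p)"
  define z where "z = matrix_inv M *v e"
  have r: "r = e \<bullet> (matrix_inv M *v e)"
    by (simp add: r_def M_def e_def inner_axis' matrix_vector_mul_component inner_axis)
  show "0 < r"
    unfolding r using pos_def_matrix_inv[OF pM] by (simp add: pos_def_def e_def)
  have "e \<bullet> z = z $ j" by (simp add: e_def inner_axis')
  moreover have "M *v z = e"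
    using pM by (simp add: z_def matrix_vector_mul_assoc matrix_inv_mult pos_def_invertible)
  ultimately have zr: "z $ j = r" and "r = z \<bullet> (M *v z)" by (simp_all add: r z_def inner_commute)
  then have "r = z \<bullet> (W *v z) + z \<bullet> (diag_mat b *v z)"
    by (simp add: M_def matrix_vector_mult_add_rdistrib inner_add_right)
  moreover have "0 \<le> z \<bullet> (W *v z)"
    using pos_def_imp_pos_semidef[OF W] by (simp add: pos_semidef_def)
  moreover have "z $ j * (b j * z $ j) \<le> z \<bullet> (diag_mat b *v z)"
    unfolding inner_vec_def diag_mat_vec inner_real_def
    using b by (intro member_le_sum) (auto simp: mult.left_commute)
  ultimately have "(b j * r) * r \<le> 1 * r" by (simp add: zr mult_ac)
  with \<open>0 < r\<close> show "b j * r \<le> 1" by (simp only: mult_le_cancel_right_pos)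
qed

text \<open>\<open>X A\<^sup>-\<^sup>T\<close> has pairwise orthogonal columns of squared lengths \<open>l\<close>; at most \<open>m\<close> of them can be
  nonzero because they live in a space of dimension \<open>m\<close>.\<close>

lemma gram_diagonalization:
  fixes X :: "real^'p^'m" and A :: "real^'p^'p"
  assumes A: "invertible A" and XX: "transpose X ** X = A ** diag_mat l ** transpose A"
  shows "0 \<le> l j" and "card {j. l j \<noteq> 0} \<le> CARD('m)" and "X \<noteq> 0 \<Longrightarrow> \<exists>j. l j \<noteq> 0"
proof -
  define Y where "Y = X ** transpose (matrix_inv A)"
  have YY: "transpose Y ** Y = diag_mat l"
    using congruence_cancel[OF A, of "diag_mat l"] unfolding XX[symmetric] Y_def
    by (simp add: matrix_transpose_mul matrix_mul_assoc)
  have col: "column i Y \<bullet> column j Y = (if i = j then l i else 0)" for i j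
    using arg_cong[OF YY, of "\<lambda>M. M $ i $ j"]
    by (simp add: matrix_mult_transpose_dot_column)
  show "0 \<le> l j" for j using col[of j j] inner_ge_zero[of "column j Y"] by simp
  let ?J = "{j. l j \<noteq> 0}"
  have inj: "inj_on (\<lambda>j. column j Y) ?J"
  proof (rule inj_onI)
    fix i j assume "i \<in> ?J" "column i Y = column j Y"
    then show "i = j" using col[of i j] col[of i i] by (auto split: if_splits)
  qed
  have "independent ((\<lambda>j. column j Y) ` ?J)"
  proof (rule pairwise_orthogonal_independent)
    show "pairwise orthogonal ((\<lambda>j. column j Y) ` ?J)"
      by (auto simp: pairwise_def orthogonal_def col)
    show "0 \<notin> (\<lambda>j. column j Y) ` ?J"
    proof
      assume "0 \<in> (\<lambda>j. column j Y) ` ?J"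
      then obtain j where "l j \<noteq> 0" "column j Y = 0" by auto
      then show False using col[of j j] by simp
    qed
  qed
  then have "card ((\<lambda>j. column j Y) ` ?J) \<le> DIM(real^'m)" by (rule independent_card_le)
  then show "card ?J \<le> CARD('m)" by (simp add: card_image inj)
  show "\<exists>j. l j \<noteq> 0" if "X \<noteq> 0"
  proof (rule ccontr)
    assume "\<nexists>j. l j \<noteq> 0"
    then have "column j Y = 0" for j using col[of j j] by simp
    then have "Y = 0" by (simp add: vec_eq_iff column_def)
    moreover have "Y ** transpose A = X"
      using A by (simp add: Y_def matrix_inv_mult flip: matrix_mul_assoc matrix_transpose_mul)
    ultimately show False using that by simp
  qed
qed

section \<open>Measurability of matrix operations\<close>

lemma borel_measurable_vecI:
  fixes f :: "'a \<Rightarrow> 'b::euclidean_space^'n"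
  assumes "\<And>i. (\<lambda>x. f x $ i) \<in> borel_measurable M"
  shows "f \<in> borel_measurable M"
proof (subst borel_measurable_euclidean_space, intro ballI)
  fix b :: "'b^'n" assume "b \<in> Basis"
  then obtain i u where "b = axis i u" by (auto simp: Basis_vec_def)
  then have "(\<lambda>x. f x \<bullet> b) = (\<lambda>x. f x $ i \<bullet> u)" by (simp add: inner_axis)
  then show "(\<lambda>x. f x \<bullet> b) \<in> borel_measurable M"
    using assms[of i] by simp
qed

lemma borel_measurable_matrixI:
  fixes f :: "'a \<Rightarrow> real^'n^'m"
  assumes "\<And>i j. (\<lambda>x. f x $ i $ j) \<in> borel_measurable M"
  shows "f \<in> borel_measurable M"
  by (intro borel_measurable_vecI assms)

lemma borel_measurable_vec_nth [measurable (raw)]: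
  fixes f :: "'a \<Rightarrow> 'b::euclidean_space^'n"
  assumes "f \<in> borel_measurable M"
  shows "(\<lambda>x. f x $ i) \<in> borel_measurable M"
proof -
  have "continuous_on UNIV (\<lambda>x::'b^'n. x $ i)" by (intro continuous_intros)
  from borel_measurable_continuous_onI[OF this] assms show ?thesis
    by (rule measurable_compose[rotated])
qed

lemma borel_measurable_matrix_mult [measurable (raw)]:
  fixes f :: "'a \<Rightarrow> real^'n^'m" and g :: "'a \<Rightarrow> real^'k^'n"
  assumes [measurable]: "f \<in> borel_measurable M" "g \<in> borel_measurable M"
  shows "(\<lambda>x. f x ** g x) \<in> borel_measurable M"
  by (intro borel_measurable_matrixI) (simp add: matrix_matrix_mult_def)

lemma borel_measurable_transpose [measurable (raw)]:
  fixes f :: "'a \<Rightarrow> real^'n^'m"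
  assumes [measurable]: "f \<in> borel_measurable M"
  shows "(\<lambda>x. transpose (f x)) \<in> borel_measurable M"
  by (intro borel_measurable_matrixI) (simp add: transpose_def)

lemma borel_measurable_trace [measurable (raw)]:
  fixes f :: "'a \<Rightarrow> real^'n^'n"
  assumes [measurable]: "f \<in> borel_measurable M"
  shows "(\<lambda>x. trace (f x)) \<in> borel_measurable M"
  by (simp add: trace_def)

lemma borel_measurable_det [measurable (raw)]:
  fixes f :: "'a \<Rightarrow> real^'n^'n"
  assumes [measurable]: "f \<in> borel_measurable M"
  shows "(\<lambda>x. det (f x)) \<in> borel_measurable M"
  by (simp add: det_def)

text \<open>Off the singular matrices the inverse is given by Cramer's rule; on them the underlying
  choice operator does not depend on its argument.\<close>

lemma borel_measurable_matrix_inv [measurable (raw)]: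
  fixes f :: "'a \<Rightarrow> real^'n^'n"
  assumes [measurable]: "f \<in> borel_measurable M"
  shows "(\<lambda>x. matrix_inv (f x)) \<in> borel_measurable M"
proof (rule borel_measurable_matrixI)
  fix k l
  have [measurable]: "(\<lambda>x. \<chi> i j. if j = k then axis l 1 $ i else f x $ i $ j :: real^'n^'n) \<in> borel_measurable M"
    by (intro borel_measurable_matrixI) simp
  have "matrix_inv A $ k $ l = (if det A = 0 then (SOME A' :: real^'n^'n. False) $ k $ l
      else det (\<chi> i j. if j = k then axis l 1 $ i else A $ i $ j) / det A)" for A :: "real^'n^'n"
  proof (cases "det A = 0")
    case True
    then have "\<not> invertible A" by (simp add: invertible_det_nz)
    then have "(\<lambda>A'. A ** A' = mat 1 \<and> A' ** A = mat 1) = (\<lambda>_. False)"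
      by (auto simp: invertible_def fun_eq_iff)
    then show ?thesis using True by (simp add: matrix_inv_def)
  next
    case False
    then have "A *v (matrix_inv A *v axis l 1) = axis l 1"
      by (simp add: matrix_vector_mul_assoc matrix_inv_mult invertible_det_nz)
    then have "matrix_inv A *v axis l 1 = (\<chi> k. det (\<chi> i j. if j = k then axis l 1 $ i else A $ i $ j) / det A)"
      using cramer[OF False] by blast
    then have "(matrix_inv A *v axis l 1) $ k = det (\<chi> i j. if j = k then axis l 1 $ i else A $ i $ j) / det A"
      by simp
    then show ?thesis
      using False by (simp add: matrix_vector_mul_component inner_axis)
  qed
  then show "(\<lambda>x. matrix_inv (f x) $ k $ l) \<in> borel_measurable M" by simp
qed

lemma borel_measurable_matrix_vector_mult [measurable (raw)]:
  fixes A :: "real^'n^'m"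
  assumes [measurable]: "f \<in> borel_measurable M"
  shows "(\<lambda>x. A *v f x) \<in> borel_measurable M"
  by (intro borel_measurable_vecI) (simp add: matrix_vector_mult_def)

lemma borel_measurable_stein_loss [measurable (raw)]:
  fixes D :: "'a \<Rightarrow> real^'p^'p"
  assumes [measurable]: "D \<in> borel_measurable M"
  shows "(\<lambda>x. stein_loss (D x) \<Sigma>) \<in> borel_measurable M"
  unfolding stein_loss_def by measurable

lemma borel_measurable_SigmaGB_hat [measurable (raw)]:
  fixes X :: "'a \<Rightarrow> real^'p^'m" and S :: "'a \<Rightarrow> real^'p^'p"
  assumes [measurable]: "X \<in> borel_measurable M" "S \<in> borel_measurable M"
  shows "(\<lambda>x. SigmaGB_hat n k (X x) (S x)) \<in> borel_measurable M"
  unfolding SigmaGB_hat_def Sigma0_hat_def by measurable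

section \<open>Gaussian data: nonsingularity and the logarithm of the determinant\<close>

definition std_normal :: "real measure" where
  "std_normal = density lborel (\<lambda>x. ennreal (std_normal_density x))"

lemma sets_std_normal [simp, measurable_cong]: "sets std_normal = sets borel"
  by (simp add: std_normal_def)

lemma space_std_normal [simp]: "space std_normal = UNIV"
  by (simp add: std_normal_def)

interpretation std_normal: prob_space std_normal
  unfolding std_normal_def by (rule prob_space_normal_density) simp

lemma std_normal_moments:
  "integrable std_normal (\<lambda>x. x)" "integral\<^sup>L std_normal (\<lambda>x. x) = 0"
  "integrable std_normal (\<lambda>x. x\<^sup>2)" "integral\<^sup>L std_normal (\<lambda>x. x\<^sup>2) = 1"
  using std_normal_moment_odd[of 0] std_normal_moment_even[of 1]
  by (auto simp: std_normal_def integrable_density integral_density has_bochner_integral_iff fact_numeral)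

text \<open>The value at \<open>0\<close> is \<open>\<infinity>\<close>, so that finiteness of an integral of \<open>neg_log \<circ> f\<close> also says
  that \<open>f\<close> almost surely does not vanish. Positive values of \<open>ln\<close> are cut off by \<^const>\<open>ennreal\<close>.\<close>

definition neg_log :: "real \<Rightarrow> ennreal" where
  "neg_log x = (if x = 0 then \<infinity> else ennreal (- ln \<bar>x\<bar>))"

lemma neg_log_0 [simp]: "neg_log 0 = \<infinity>"
  by (simp add: neg_log_def)

lemma neg_log_measurable [measurable]: "neg_log \<in> borel_measurable borel"
  unfolding neg_log_def[abs_def] by measurable

lemma neg_log_mult_le: "neg_log (x * y) \<le> neg_log x + neg_log y"
proof (cases "x = 0 \<or> y = 0")
  case False
  then have "- ln \<bar>x * y\<bar> \<le> max 0 (- ln \<bar>x\<bar>) + max 0 (- ln \<bar>y\<bar>)"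
    by (auto simp: abs_mult ln_mult)
  then have "ennreal (- ln \<bar>x * y\<bar>) \<le> ennreal (max 0 (- ln \<bar>x\<bar>) + max 0 (- ln \<bar>y\<bar>))"
    by (rule ennreal_leI)
  also have "\<dots> = ennreal (max 0 (- ln \<bar>x\<bar>)) + ennreal (max 0 (- ln \<bar>y\<bar>))"
    by (rule ennreal_plus) auto
  also have "ennreal (max 0 a) = ennreal a" for a by (simp add: max_def ennreal_neg)
  finally show ?thesis using False by (simp add: neg_log_def)
qed (auto simp: neg_log_def)

text \<open>The density is at most \<open>1\<close>, so the shift can be removed by translation invariance of Lebesgue
  measure; near \<open>0\<close> the integrand is at most \<open>2 \<bar>x\<bar>\<^sup>-\<^sup>1\<^sup>/\<^sup>2\<close>, whose integral over \<open>[0, 1]\<close> is \<open>4\<close>.\<close>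

lemma nn_integral_neg_log_shift_bounded:
  "(\<integral>\<^sup>+ z. neg_log (s + z) \<partial>std_normal) \<le> 8"
proof -
  define h where "h = (\<lambda>x::real. ennreal (2 * x powr (-1/2)) * indicator {0..1} x)"
  have [measurable]: "h \<in> borel_measurable borel" by (simp add: h_def)
  have h: "(\<integral>\<^sup>+ x. h x \<partial>lborel) = 4"
  proof -
    have "((\<lambda>x. 2 * x powr (-1/2)) has_integral 2 * (1 powr (-1/2+1) / (-1/2+1))) {0..1::real}"
      by (intro has_integral_mult_right has_integral_powr_from_0) auto
    from nn_integral_has_integral_lebesgue'[OF _ this] show ?thesis by (simp add: h_def)
  qed
  have le: "neg_log x \<le> h x + h (- x)" if "x \<noteq> 0" for x
  proof (cases "\<bar>x\<bar> < 1")
    case True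
    have "ln (1 / \<bar>x\<bar>) \<le> (1 / \<bar>x\<bar>) powr (1/2) / (1/2)"
      using True that by (intro ln_powr_bound) auto
    then have "- ln \<bar>x\<bar> \<le> 2 * \<bar>x\<bar> powr (-1/2)"
      using that by (simp add: ln_div powr_divide powr_minus_divide)
    then have "neg_log x \<le> ennreal (2 * \<bar>x\<bar> powr (-1/2))"
      using that by (simp add: neg_log_def ennreal_leI)
    also have "\<dots> \<le> h x + h (- x)"
      using True that by (cases "0 < x") (auto simp: h_def indicator_def)
    finally show ?thesis .
  next
    case False
    then show ?thesis using that by (simp add: neg_log_def ennreal_neg)
  qed
  have "(\<integral>\<^sup>+ z. neg_log (s + z) \<partial>std_normal) = (\<integral>\<^sup>+ z. ennreal (std_normal_density z) * neg_log (s + z) \<partial>lborel)"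
    unfolding std_normal_def by (rule nn_integral_density) auto
  also have "\<dots> \<le> (\<integral>\<^sup>+ z. neg_log (s + 1 * z) \<partial>lborel)"
  proof (intro nn_integral_mono)
    fix z :: real
    have "1 \<le> sqrt (2 * pi)" using pi_gt3 by simp
    then have "(1 / sqrt (2 * pi)) * exp (- z\<^sup>2 / 2) \<le> 1 * 1" by (intro mult_mono) auto
    then have "std_normal_density z \<le> 1" by (simp add: std_normal_density_def)
    then have "ennreal (std_normal_density z) * neg_log (s + z) \<le> 1 * neg_log (s + z)"
      by (intro mult_right_mono) auto
    then show "ennreal (std_normal_density z) * neg_log (s + z) \<le> neg_log (s + 1 * z)" by simp
  qed
  also have "\<dots> = (\<integral>\<^sup>+ z. neg_log z \<partial>lborel)"
    using nn_integral_real_affine[of neg_log 1 s] by simp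
  also have "\<dots> \<le> (\<integral>\<^sup>+ z. h z + h (0 + -1 * z) \<partial>lborel)"
    using AE_lborel_singleton[of "0::real"] le by (intro nn_integral_mono_AE) auto
  also have "\<dots> = (\<integral>\<^sup>+ z. h z \<partial>lborel) + (\<integral>\<^sup>+ z. h (0 + -1 * z) \<partial>lborel)"
    by (intro nn_integral_add) auto
  also have "(\<integral>\<^sup>+ z. h (0 + -1 * z) \<partial>lborel) = (\<integral>\<^sup>+ z. h z \<partial>lborel)"
    using nn_integral_real_affine[of h "-1" 0] by simp
  finally show ?thesis by (simp add: h)
qed

text \<open>A bounded loss of \<open>neg_log\<close> per Gaussian coordinate: uniformly in the intercept, an affine function
  of a standard normal variable is on the logarithmic scale not much smaller than its slope.\<close>

lemma nn_integral_neg_log_affine_le: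
  "(\<integral>\<^sup>+ z. neg_log (a + z * d) \<partial>std_normal) \<le> neg_log d + 8"
proof (cases "d = 0")
  case False
  have "(\<integral>\<^sup>+ z. neg_log (a + z * d) \<partial>std_normal) \<le> (\<integral>\<^sup>+ z. neg_log d + neg_log (a / d + z) \<partial>std_normal)"
  proof (intro nn_integral_mono)
    fix z
    have "a + z * d = d * (a / d + z)" using False by (simp add: field_simps)
    then show "neg_log (a + z * d) \<le> neg_log d + neg_log (a / d + z)"
      using neg_log_mult_le by simp
  qed
  also have "\<dots> = neg_log d + (\<integral>\<^sup>+ z. neg_log (a / d + z) \<partial>std_normal)"
    by (subst nn_integral_add) (auto simp: std_normal.emeasure_space_1[simplified])
  also have "\<dots> \<le> neg_log d + 8"
    by (intro add_left_mono nn_integral_neg_log_shift_bounded)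
  finally show ?thesis .
qed simp

text \<open>The law of an \<open>n \<times> p\<close> data matrix with independent standard normal entries. Indexing by pairs puts all
  entries into one product measure, from which single entries, rows and columns can be split off.\<close>

definition gauss :: "nat \<Rightarrow> (nat \<times> 'p::finite \<Rightarrow> real) measure" where
  "gauss n = PiM ({..<n} \<times> UNIV) (\<lambda>_. std_normal)"

interpretation coords: product_sigma_finite "\<lambda>_ :: nat \<times> 'p::finite. std_normal"
  by standard

interpretation gauss: prob_space "gauss n :: (nat \<times> 'p::finite \<Rightarrow> real) measure" for n
  unfolding gauss_def by (intro prob_space_PiM std_normal.prob_space_axioms)

lemma gauss_component_measurable [measurable]:
  assumes "i < n"
  shows "(\<lambda>g. g (i, j)) \<in> borel_measurable (gauss n)"
proof -
  have "(\<lambda>g. g (i, j)) \<in> gauss n \<rightarrow>\<^sub>M std_normal"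
    unfolding gauss_def using assms by (intro measurable_component_singleton) auto
  then show ?thesis using measurable_cong_sets[OF refl sets_std_normal] by blast
qed

definition gram :: "nat \<Rightarrow> (nat \<times> 'p::finite \<Rightarrow> real) \<Rightarrow> real^'p^'p" where
  "gram n g = (\<chi> j k. \<Sum>i<n. g (i, j) * g (i, k))"

lemma gram_measurable [measurable]: "gram n \<in> borel_measurable (gauss n)"
proof (rule borel_measurable_matrixI)
  fix j k :: 'a
  have "(\<lambda>g. \<Sum>i<n. g (i, j) * g (i, k)) \<in> borel_measurable (gauss n)"
    by (intro borel_measurable_sum borel_measurable_times gauss_component_measurable) auto
  then show "(\<lambda>g. gram n g $ j $ k) \<in> borel_measurable (gauss n)" by (simp add: gram_def)
qed

text \<open>Its determinant is the minor of the data matrix with rows \<open>\<rho> i\<close> and columns \<open>i\<close>, \<open>i \<in> K\<close>; the rows of the identity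
  matrix keep the size independent of \<open>K\<close>.\<close>

definition padded_minor :: "('p \<Rightarrow> nat) \<Rightarrow> 'p set \<Rightarrow> (nat \<times> 'p::finite \<Rightarrow> real) \<Rightarrow> real^'p^'p" where
  "padded_minor \<rho> K g = (\<chi> i j. if i \<in> K then g (\<rho> i, j) else if i = j then 1 else 0)"

lemma padded_minor_measurable:
  assumes "\<And>i. \<rho> i < n"
  shows "padded_minor \<rho> K \<in> borel_measurable (gauss n)"
proof (rule borel_measurable_matrixI)
  fix i j
  show "(\<lambda>g. padded_minor \<rho> K g $ i $ j) \<in> borel_measurable (gauss n)"
    using gauss_component_measurable[OF assms[of i], of j] by (simp add: padded_minor_def)
qed

text \<open>Adding a row to the minor costs at most \<open>8\<close>: by multilinearity the determinant is affine in
  the diagonal entry of the new row, with the previous determinant as slope.\<close>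

lemma nn_integral_neg_log_padded_minor_insert:
  fixes \<rho> :: "'p::finite \<Rightarrow> nat"
  assumes \<rho>: "inj \<rho>" "\<And>i. \<rho> i < n" and k: "k \<notin> K"
  shows "(\<integral>\<^sup>+ g. neg_log (det (padded_minor \<rho> (insert k K) g)) \<partial>gauss n)
    \<le> (\<integral>\<^sup>+ g. neg_log (det (padded_minor \<rho> K g)) \<partial>gauss n) + 8"
proof -
  define e where "e = (\<rho> k, k)"
  define I where "I = {..<n} \<times> (UNIV::'p set) - {e}"
  have I: "finite I" "e \<notin> I" and ins: "insert e I = {..<n} \<times> UNIV"
    using \<rho> by (auto simp: I_def e_def)
  have G: "gauss n = PiM (insert e I) (\<lambda>_. std_normal)" by (simp add: gauss_def ins)
  interpret PI: prob_space "PiM I (\<lambda>_. std_normal)"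
    by (intro prob_space_PiM std_normal.prob_space_axioms)
  have [measurable]: "padded_minor \<rho> K' \<in> borel_measurable (PiM (insert e I) (\<lambda>_. std_normal))" for K'
    using padded_minor_measurable[of \<rho> n K'] \<rho> G by simp
  have indep: "padded_minor \<rho> K (x(e := y)) = padded_minor \<rho> K x" for x y
  proof -
    have "(\<rho> i, j) \<noteq> e" if "i \<in> K" for i j
      using that k injD[OF \<rho>(1), of i k] by (auto simp: e_def)
    then show ?thesis by (simp add: padded_minor_def vec_eq_iff)
  qed
  have affine: "det (padded_minor \<rho> (insert k K) (x(e := y)))
      = det (padded_minor \<rho> (insert k K) (x(e := 0))) + y * det (padded_minor \<rho> K x)" for x y
  proof -
    let ?M = "padded_minor \<rho> K x"
    let ?r = "\<lambda>y. \<chi> j. (x(e := y)) (\<rho> k, j)"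
    have ins_eq: "padded_minor \<rho> (insert k K) (x(e := y)) = (\<chi> i. if i = k then ?r y else ?M $ i)" for y
      using \<rho>(1) by (auto simp: padded_minor_def vec_eq_iff e_def inj_eq)
    have axis_eq: "?M = (\<chi> i. if i = k then axis k 1 else ?M $ i)"
      using k by (auto simp: padded_minor_def vec_eq_iff axis_def)
    have r: "?r y = ?r 0 + y *s axis k 1"
      by (auto simp: vec_eq_iff e_def axis_def)
    have "det (\<chi> i. if i = k then ?r y else ?M $ i)
        = det (\<chi> i. if i = k then ?r 0 + y *s axis k 1 else ?M $ i)"
      by (rule arg_cong[OF r])
    also have "\<dots> = det (\<chi> i. if i = k then ?r 0 else ?M $ i) + det (\<chi> i. if i = k then y *s axis k 1 else ?M $ i)"
      by (rule det_row_add)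
    also have "det (\<chi> i. if i = k then y *s axis k 1 else ?M $ i) = y * det (\<chi> i. if i = k then axis k 1 else ?M $ i)"
      by (rule det_row_mul)
    finally show ?thesis unfolding ins_eq axis_eq[symmetric] .
  qed
  have "(\<integral>\<^sup>+ g. neg_log (det (padded_minor \<rho> (insert k K) g)) \<partial>gauss n)
      = (\<integral>\<^sup>+ x. (\<integral>\<^sup>+ y. neg_log (det (padded_minor \<rho> (insert k K) (x(e := y)))) \<partial>std_normal) \<partial>PiM I (\<lambda>_. std_normal))"
    unfolding G by (rule coords.product_nn_integral_insert[OF I]) measurable
  also have "\<dots> \<le> (\<integral>\<^sup>+ x. neg_log (det (padded_minor \<rho> K x)) + 8 \<partial>PiM I (\<lambda>_. std_normal))"
    by (intro nn_integral_mono, subst affine) (rule nn_integral_neg_log_affine_le)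
  also have "\<dots> = (\<integral>\<^sup>+ x. (\<integral>\<^sup>+ y. neg_log (det (padded_minor \<rho> K (x(e := y)))) + 8 \<partial>std_normal) \<partial>PiM I (\<lambda>_. std_normal))"
    unfolding indep by (simp add: std_normal.emeasure_space_1[simplified])
  also have "\<dots> = (\<integral>\<^sup>+ g. neg_log (det (padded_minor \<rho> K g)) + 8 \<partial>gauss n)"
    unfolding G by (rule coords.product_nn_integral_insert[OF I, symmetric]) measurable
  also have "\<dots> = (\<integral>\<^sup>+ g. neg_log (det (padded_minor \<rho> K g)) \<partial>gauss n) + 8"
  proof -
    have "padded_minor \<rho> K \<in> borel_measurable (gauss n)"
      by (rule padded_minor_measurable) (rule \<rho>)
    then have "(\<lambda>g. neg_log (det (padded_minor \<rho> K g))) \<in> borel_measurable (gauss n)" by measurable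
    then show ?thesis by (subst nn_integral_add) (simp_all add: gauss.emeasure_space_1)
  qed
  finally show ?thesis .
qed

lemma nn_integral_neg_log_padded_minor:
  fixes \<rho> :: "'p::finite \<Rightarrow> nat"
  assumes \<rho>: "inj \<rho>" "\<And>i. \<rho> i < n"
  shows "(\<integral>\<^sup>+ g. neg_log (det (padded_minor \<rho> K g)) \<partial>gauss n) < \<infinity>"
proof (induction K rule: finite_induct[OF finite_class.finite])
  case 1
  have "padded_minor \<rho> {} g = mat 1" for g :: "nat \<times> 'p \<Rightarrow> real"
    by (simp add: padded_minor_def mat_def)
  then show ?case by (simp add: neg_log_def)
next
  case (2 k K)
  then show ?case
    by (intro le_less_trans[OF nn_integral_neg_log_padded_minor_insert[OF \<rho> 2(2)]])
      (simp add: ennreal_add_less_top)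
qed

text \<open>Some \<open>p\<close> of the \<open>n\<close> rows suffice: they form a square matrix \<open>Z\<close>, and the other rows add a positive
  semidefinite matrix to \<open>Z\<^sup>T Z\<close>, which can only increase the determinant.\<close>

lemma gram_nonsingular_and_log_integrable:
  assumes n: "CARD('p::finite) \<le> n"
  shows "AE g in gauss n. pos_def (gram n g :: real^'p^'p)"
    and "(\<integral>\<^sup>+ g. neg_log (det (gram n g :: real^'p^'p)) \<partial>gauss n) < \<infinity>"
proof -
  obtain \<rho> :: "'p \<Rightarrow> nat" where \<rho>: "inj \<rho>" "\<And>i. \<rho> i < n"
    using card_le_inj[of "UNIV::'p set" "{..<n}"] n by auto
  define Z :: "(nat \<times> 'p \<Rightarrow> real) \<Rightarrow> real^'p^'p" where "Z = padded_minor \<rho> UNIV"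
  have [measurable]: "Z \<in> borel_measurable (gauss n)"
    unfolding Z_def by (intro padded_minor_measurable \<rho>)
  have fin: "(\<integral>\<^sup>+ g. neg_log (det (Z g)) \<partial>gauss n) < \<infinity>"
    unfolding Z_def by (intro nn_integral_neg_log_padded_minor \<rho>)
  have "AE g in gauss n. neg_log (det (Z g)) \<noteq> \<infinity>"
    using fin by (intro nn_integral_PInf_AE) auto
  then have AE: "AE g in gauss n. det (Z g) \<noteq> 0"
    by (rule AE_mp) (auto simp: neg_log_def)
  have key: "pos_def (gram n g)" "(det (Z g))\<^sup>2 \<le> det (gram n g)" if "det (Z g) \<noteq> 0" for g
  proof -
    define T :: "real^'p^'p" where "T = (\<chi> j k. \<Sum>i\<in>{..<n} - range \<rho>. g (i, j) * g (i, k))"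
    have pT: "pos_semidef T"
      unfolding T_def by (rule pos_semidef_sum_outer[where u = "\<lambda>i j. g (i, j)"])
    have inv: "invertible (transpose (Z g))"
      using that by (simp add: invertible_det_nz)
    have "pos_def (mat 1 :: real^'p^'p)" by (rule pos_def_mat_1)
    from pos_def_congruence[OF inv this] have ZZ: "pos_def (transpose (Z g) ** Z g)" by simp
    have gr: "gram n g = transpose (Z g) ** Z g + T"
    proof -
      have "(\<Sum>i<n. g (i, j) * g (i, k)) = (\<Sum>i\<in>range \<rho>. g (i, j) * g (i, k)) + T $ j $ k" for j k
        using sum.subset_diff[of "range \<rho>" "{..<n}" "\<lambda>i. g (i, j) * g (i, k)"] \<rho>
        by (auto simp: T_def add.commute)
      moreover have "(\<Sum>i\<in>range \<rho>. g (i, j) * g (i, k)) = (transpose (Z g) ** Z g) $ j $ k" for j k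
        using \<rho>(1) by (simp add: sum.reindex matrix_matrix_mult_def transpose_def Z_def padded_minor_def)
      ultimately show ?thesis by (simp add: vec_eq_iff gram_def)
    qed
    show "pos_def (gram n g)" "(det (Z g))\<^sup>2 \<le> det (gram n g)"
      using det_mono_pos_semidef[OF ZZ pT] pos_def_add_pos_semidef[OF ZZ pT]
      by (simp_all add: gr det_mul power2_eq_square)
  qed
  show "AE g in gauss n. pos_def (gram n g :: real^'p^'p)"
    using AE by (rule AE_mp) (auto simp: key)
  have "neg_log (det (gram n g)) \<le> neg_log (det (Z g)) + neg_log (det (Z g))" if "det (Z g) \<noteq> 0" for g
  proof -
    have "0 < (det (Z g))\<^sup>2" using that by simp
    then have "neg_log (det (gram n g)) \<le> neg_log ((det (Z g))\<^sup>2)"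
      using key(2)[OF that] by (auto simp: neg_log_def intro!: ennreal_leI)
    also have "\<dots> \<le> neg_log (det (Z g)) + neg_log (det (Z g))"
      unfolding power2_eq_square by (rule neg_log_mult_le)
    finally show ?thesis .
  qed
  then have "AE g in gauss n. neg_log (det (gram n g)) \<le> neg_log (det (Z g)) + neg_log (det (Z g))"
    using AE by (auto elim!: eventually_mono)
  then have "(\<integral>\<^sup>+ g. neg_log (det (gram n g :: real^'p^'p)) \<partial>gauss n)
      \<le> (\<integral>\<^sup>+ g. neg_log (det (Z g)) + neg_log (det (Z g)) \<partial>gauss n)"
    by (rule nn_integral_mono_AE)
  also have "\<dots> = (\<integral>\<^sup>+ g. neg_log (det (Z g)) \<partial>gauss n) + (\<integral>\<^sup>+ g. neg_log (det (Z g)) \<partial>gauss n)"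
    by (intro nn_integral_add) auto
  also have "\<dots> < \<infinity>" using fin by (simp add: ennreal_add_less_top)
  finally show "(\<integral>\<^sup>+ g. neg_log (det (gram n g :: real^'p^'p)) \<partial>gauss n) < \<infinity>" .
qed

lemma distr_gauss_component:
  assumes "i < n"
  shows "distr (gauss n) borel (\<lambda>g. g (i, j)) = std_normal"
proof -
  have "distr (gauss n) borel (\<lambda>g. g (i, j)) = distr (gauss n) std_normal (\<lambda>g. g (i, j))"
    by (rule distr_cong) simp_all
  also have "\<dots> = std_normal"
    unfolding gauss_def using assms
    by (intro distr_PiM_component std_normal.prob_space_axioms) auto
  finally show ?thesis .
qed

lemma gauss_component_moments:
  assumes i: "i < n"
  shows "integrable (gauss n) (\<lambda>g. g (i, j))" "(\<integral>g. g (i, j) \<partial>gauss n) = 0"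
    and "integrable (gauss n) (\<lambda>g. (g (i, j))\<^sup>2)" "(\<integral>g. (g (i, j))\<^sup>2 \<partial>gauss n) = 1"
proof -
  have *: "integrable (gauss n) (\<lambda>g. f (g (i, j))) \<longleftrightarrow> integrable std_normal f"
    "(\<integral>g. f (g (i, j)) \<partial>gauss n) = integral\<^sup>L std_normal f"
    if f: "f \<in> borel_measurable borel" for f :: "real \<Rightarrow> real"
    using integrable_distr_eq[OF gauss_component_measurable[OF i, of j] f]
      integral_distr[OF gauss_component_measurable[OF i, of j] f]
    unfolding distr_gauss_component[OF i] by (blast, metis)
  show "integrable (gauss n) (\<lambda>g. g (i, j))"
    by (rule *(1)[THEN iffD2, OF _ std_normal_moments(1)]) simp
  show "(\<integral>g. g (i, j) \<partial>gauss n) = 0"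
    by (rule trans[OF *(2) std_normal_moments(2)]) simp
  show "integrable (gauss n) (\<lambda>g. (g (i, j))\<^sup>2)"
    by (rule *(1)[THEN iffD2, OF _ std_normal_moments(3)]) simp
  show "(\<integral>g. (g (i, j))\<^sup>2 \<partial>gauss n) = 1"
    by (rule trans[OF *(2) std_normal_moments(4)]) simp
qed

text \<open>Because the risk of the usual estimator is finite, a negative expected difference of the losses
  becomes a strict inequality between the risks, which are elements of \<open>[0, \<infinity>]\<close>.\<close>

lemma integrable_stein_loss_Sigma0:
  assumes n: "CARD('p::finite) \<le> n"
  shows "integrable (gauss n) (\<lambda>g. stein_loss (Sigma0_hat n (gram n g :: real^'p^'p)) (mat 1))"
proof (rule integrableI_nonneg)
  let ?W = "\<lambda>g. gram n g :: real^'p^'p"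
  have n0: "0 < n" by (rule less_le_trans[OF zero_less_card_finite n])
  show "(\<lambda>g. stein_loss (Sigma0_hat n (?W g)) (mat 1)) \<in> borel_measurable (gauss n)"
    unfolding stein_loss_def Sigma0_hat_def
    by (simp add: trace_scaleR det_scaleR)
  show "AE g in gauss n. 0 \<le> stein_loss (Sigma0_hat n (?W g)) (mat 1)"
    using gram_nonsingular_and_log_integrable(1)[OF n]
    by eventually_elim (auto simp: Sigma0_hat_def n0 pos_def_mat_1 intro!: stein_loss_nonneg pos_def_scaleR)
  have "integrable (gauss n) (\<lambda>g. trace (?W g) / n)"
    unfolding trace_def gram_def using gauss_component_moments(3)
    by (auto simp flip: power2_eq_square intro!: integrable_divide Bochner_Integration.integrable_sum)
  then have tr: "(\<integral>\<^sup>+ g. ennreal \<bar>trace (?W g) / n\<bar> \<partial>gauss n) < \<infinity>"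
    by (simp add: integrable_iff_bounded)
  have "ennreal (stein_loss (Sigma0_hat n (?W g)) (mat 1))
      \<le> (ennreal \<bar>trace (?W g) / n\<bar> + neg_log ((1 / n) ^ CARD('p))) + neg_log (det (?W g))"
    if "pos_def (?W g)" for g
  proof -
    have d: "0 < det (Sigma0_hat n (?W g))"
      using that n0 by (simp add: Sigma0_hat_def pos_def_det_pos pos_def_scaleR)
    have "stein_loss (Sigma0_hat n (?W g)) (mat 1)
        \<le> \<bar>trace (?W g) / n\<bar> + max 0 (- ln (det (Sigma0_hat n (?W g))))"
    proof -
      have "trace (Sigma0_hat n (?W g)) = trace (?W g) / n" by (simp add: Sigma0_hat_def trace_scaleR)
      then show ?thesis
        unfolding stein_loss_def matrix_inv_mat_1 matrix_mul_rid by linarith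
    qed
    then have "ennreal (stein_loss (Sigma0_hat n (?W g)) (mat 1))
        \<le> ennreal (\<bar>trace (?W g) / n\<bar> + max 0 (- ln (det (Sigma0_hat n (?W g)))))"
      by (rule ennreal_leI)
    also have "\<dots> = ennreal \<bar>trace (?W g) / n\<bar> + ennreal (max 0 (- ln (det (Sigma0_hat n (?W g)))))"
      by (rule ennreal_plus) auto
    also have "ennreal (max 0 (- ln (det (Sigma0_hat n (?W g))))) = neg_log (det (Sigma0_hat n (?W g)))"
      using d by (simp add: neg_log_def max_def ennreal_neg)
    also have "\<dots> \<le> neg_log ((1 / n) ^ CARD('p)) + neg_log (det (?W g))"
      unfolding Sigma0_hat_def det_scaleR by (rule neg_log_mult_le)
    finally show ?thesis by (simp add: add.assoc add_left_mono)
  qed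
  then have "(\<integral>\<^sup>+ g. ennreal (stein_loss (Sigma0_hat n (?W g)) (mat 1)) \<partial>gauss n)
      \<le> (\<integral>\<^sup>+ g. (ennreal \<bar>trace (?W g) / n\<bar> + neg_log ((1 / n) ^ CARD('p))) + neg_log (det (?W g)) \<partial>gauss n)"
    using gram_nonsingular_and_log_integrable(1)[OF n]
    by (intro nn_integral_mono_AE) (auto elim!: eventually_mono)
  also have "\<dots> = (\<integral>\<^sup>+ g. ennreal \<bar>trace (?W g) / n\<bar> \<partial>gauss n) + neg_log ((1 / n) ^ CARD('p))
      + (\<integral>\<^sup>+ g. neg_log (det (?W g)) \<partial>gauss n)"
    by (simp add: nn_integral_add gauss.emeasure_space_1)
  also have "\<dots> < \<infinity>"
    using tr gram_nonsingular_and_log_integrable(2)[OF n] n0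
    by (simp add: ennreal_add_less_top neg_log_def)
  finally show "(\<integral>\<^sup>+ g. ennreal (stein_loss (Sigma0_hat n (?W g)) (mat 1)) \<partial>gauss n) < \<infinity>" .
qed

section \<open>Gaussian data: Schur complements of the Gram matrix\<close>

definition vec_restrict :: "'n set \<Rightarrow> real^'n \<Rightarrow> real^'n" where
  "vec_restrict N x = (\<chi> k. if k \<in> N then x $ k else 0)"

text \<open>The block of \<open>G\<close> with indices in \<open>N\<close>, filled up with the identity matrix; the inverse of the result is
  the inverse of the block, filled up in the same way.\<close>

definition padded_block :: "'n set \<Rightarrow> real^'n^'n \<Rightarrow> real^'n^'n" where
  "padded_block N G = (\<chi> k l. if k \<in> N \<and> l \<in> N then G $ k $ l else if k = l then 1 else 0)"

lemma padded_block_vec: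
  "padded_block N G *v x = vec_restrict N (G *v vec_restrict N x) + vec_restrict (- N) x"
proof -
  have "(\<Sum>l\<in>UNIV. (if k \<in> N \<and> l \<in> N then G $ k $ l else if k = l then 1 else 0) * x $ l)
      = (if k \<in> N then \<Sum>l\<in>UNIV. G $ k $ l * (if l \<in> N then x $ l else 0) else x $ k)" for k
  proof (cases "k \<in> N")
    case True
    then show ?thesis by (auto intro!: sum.cong)
  next
    case False
    then have "(\<Sum>l\<in>UNIV. (if k \<in> N \<and> l \<in> N then G $ k $ l else if k = l then 1 else 0) * x $ l)
        = (\<Sum>l\<in>UNIV. if k = l then x $ l else 0)"
      by (intro sum.cong) auto
    with False show ?thesis by simp
  qed
  then show ?thesis
    by (simp add: vec_eq_iff padded_block_def vec_restrict_def matrix_vector_mult_def)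
qed

lemma inner_vec_restrict: "x \<bullet> vec_restrict N y = vec_restrict N x \<bullet> y"
  by (auto simp: inner_vec_def vec_restrict_def intro!: sum.cong)

lemma vec_restrict_idem [simp]: "vec_restrict N (vec_restrict N x) = vec_restrict N x"
  by (simp add: vec_restrict_def vec_eq_iff)

lemma pos_def_padded_block:
  fixes G :: "real^'n^'n"
  assumes "pos_def G"
  shows "pos_def (padded_block N G)"
  unfolding pos_def_def
proof (intro conjI allI impI)
  have "G $ l $ k = G $ k $ l" for k l
    using assms by (auto simp: pos_def_def transpose_def vec_eq_iff)
  then show "transpose (padded_block N G) = padded_block N G"
    by (simp add: padded_block_def transpose_def vec_eq_iff)
next
  fix x :: "real^'n" assume x: "x \<noteq> 0"
  let ?u = "vec_restrict N x" and ?v = "vec_restrict (- N) x"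
  have "x \<bullet> (padded_block N G *v x) = ?u \<bullet> (G *v ?u) + ?v \<bullet> ?v"
    using inner_vec_restrict[of ?v "- N" x] by (simp add: padded_block_vec inner_add_right inner_vec_restrict)
  moreover have "?u \<noteq> 0 \<or> ?v \<noteq> 0"
  proof -
    have "?u + ?v = x" by (simp add: vec_restrict_def vec_eq_iff)
    with x show ?thesis by auto
  qed
  then have "0 < ?u \<bullet> (G *v ?u) \<or> 0 < ?v \<bullet> ?v"
    using assms by (auto simp: pos_def_def)
  moreover have "0 \<le> ?u \<bullet> (G *v ?u)"
    using pos_def_imp_pos_semidef[OF assms] by (simp add: pos_semidef_def)
  moreover have "0 \<le> ?v \<bullet> ?v" by (rule inner_ge_zero)
  ultimately show "0 < x \<bullet> (padded_block N G *v x)" by linarith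
qed

text \<open>The trial vector in the variational bound is, up to the factor \<open>c\<close>, the \<open>j\<close>-th unit vector minus its
  projection, in the inner product \<open>G\<close>, to the span of the unit vectors with index in \<open>N\<close>. Its squared \<open>G\<close>-length is the Schur complement
  \<open>G\<^sub>j\<^sub>j - s \<bullet> D s\<close>, and the penalty \<open>b\<close> sees only its \<open>j\<close>-th coordinate.\<close>

lemma regularized_inverse_diagonal_lower_bound:
  fixes G :: "real^'n^'n" and c :: real
  assumes G: "pos_def G" and b: "\<And>k. 0 \<le> b k" "\<And>k. k \<in> N \<Longrightarrow> b k = 0" and j: "j \<notin> N"
  defines "s \<equiv> vec_restrict N (G $ j)" and "D \<equiv> matrix_inv (padded_block N G)"
  shows "2 * c - c\<^sup>2 * (b j + (G $ j $ j - s \<bullet> (D *v s))) \<le> matrix_inv (G + diag_mat b) $ j $ j"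
proof -
  define e where "e = (axis j 1 :: real^'n)"
  define z where "z = D *v s"
  have "padded_block N G *v z = s"
    using pos_def_padded_block[OF G, of N]
    by (simp add: z_def D_def matrix_vector_mul_assoc matrix_inv_mult pos_def_invertible)
  then have eq: "vec_restrict N (G *v vec_restrict N z) + vec_restrict (- N) z = s"
    by (simp add: padded_block_vec)
  have "z $ k = 0" if "k \<notin> N" for k
    using arg_cong[OF eq, of "\<lambda>v. v $ k"] that by (simp add: vec_restrict_def s_def)
  then have z: "vec_restrict N z = z" by (auto simp: vec_restrict_def vec_eq_iff)
  have z': "vec_restrict (- N) z = 0"
    using \<open>\<And>k. k \<notin> N \<Longrightarrow> z $ k = 0\<close> by (simp add: vec_restrict_def vec_eq_iff)
  have zj: "z $ j = 0" using arg_cong[OF z, of "\<lambda>v. v $ j"] j by (simp add: vec_restrict_def)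
  have zGz: "z \<bullet> (G *v z) = s \<bullet> z"
    using arg_cong[OF eq, of "\<lambda>v. z \<bullet> v"] by (simp add: z z' inner_vec_restrict inner_commute)
  have eGz: "e \<bullet> (G *v z) = s \<bullet> z"
  proof -
    have "e \<bullet> (G *v z) = G $ j \<bullet> z"
      by (simp add: e_def inner_axis' matrix_vector_mul_component)
    also have "\<dots> = G $ j \<bullet> vec_restrict N z" by (simp add: z)
    finally show ?thesis by (simp add: inner_vec_restrict s_def)
  qed
  have zGe: "z \<bullet> (G *v e) = s \<bullet> z"
    using inner_transpose[of z G e] G eGz by (simp add: pos_def_def inner_commute)
  have eGe: "e \<bullet> (G *v e) = G $ j $ j"
    by (simp add: e_def inner_axis' matrix_vector_mul_component inner_axis)
  define x where "x = e - z"
  have xGx: "x \<bullet> (G *v x) = G $ j $ j - s \<bullet> z"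
    by (simp add: x_def matrix_vector_mult_diff_distrib inner_diff_left inner_diff_right eGz zGe zGz eGe)
  have "x \<bullet> (diag_mat b *v x) = (\<Sum>k\<in>UNIV. if k = j then b j else 0)"
    unfolding inner_vec_def diag_mat_vec
  proof (intro sum.cong refl)
    fix k
    have "z $ k = 0 \<or> b k = 0"
      using arg_cong[OF z, of "\<lambda>v. v $ k"] b(2) by (auto simp: vec_restrict_def split: if_splits)
    then show "x $ k \<bullet> (b k * x $ k) = (if k = j then b j else 0)"
      using zj by (auto simp: x_def e_def axis_def)
  qed
  then have xBx: "x \<bullet> (diag_mat b *v x) = b j" by simp
  have "pos_def (G + diag_mat b)"
    using G b by (intro pos_def_add_pos_semidef) (simp_all add: pos_semidef_diag_mat_iff)
  from matrix_inv_quadratic_form_lower_bound[OF this, of "c *\<^sub>R x" e]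
  have "2 * (c * (x \<bullet> e)) - c\<^sup>2 * (x \<bullet> (G *v x) + x \<bullet> (diag_mat b *v x)) \<le> e \<bullet> (matrix_inv (G + diag_mat b) *v e)"
    by (simp add: matrix_vector_mult_scaleR matrix_vector_mult_add_rdistrib inner_add_right power2_eq_square mult.assoc distrib_left)
  moreover have "e \<bullet> (matrix_inv (G + diag_mat b) *v e) = matrix_inv (G + diag_mat b) $ j $ j"
    by (simp add: e_def inner_axis' matrix_vector_mul_component inner_axis)
  moreover have "x \<bullet> e = 1" using zj by (simp add: x_def e_def inner_axis)
  ultimately show ?thesis by (simp add: xGx xBx z_def add.commute)
qed

lemma indep_gauss_components:
  assumes "0 < n"
  shows "prob_space.indep_vars (gauss n :: (nat \<times> 'p::finite \<Rightarrow> real) measure) (\<lambda>_. borel) (\<lambda>e g. g e) ({..<n} \<times> UNIV)"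
proof -
  let ?I = "{..<n} \<times> (UNIV :: 'p set)"
  have "distr (gauss n) (PiM ?I (\<lambda>_. borel)) (\<lambda>g. \<lambda>e\<in>?I. g e) = distr (gauss n) (gauss n) (\<lambda>g. g)"
  proof (rule distr_cong)
    show "sets (PiM ?I (\<lambda>_. borel)) = sets (gauss n :: (nat \<times> 'p \<Rightarrow> real) measure)"
      unfolding gauss_def by (intro sets_PiM_cong) auto
    show "(\<lambda>e\<in>?I. g e) = g" if "g \<in> space (gauss n)" for g :: "nat \<times> 'p \<Rightarrow> real"
      using that by (auto simp: gauss_def space_PiM PiE_def extensional_restrict)
  qed simp
  also have "\<dots> = gauss n" by simp
  also have "\<dots> = (\<Pi>\<^sub>M e\<in>?I. distr (gauss n) borel (\<lambda>g. g e))"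
    unfolding gauss_def[of n] by (intro PiM_cong) (auto simp: distr_gauss_component simp flip: gauss_def)
  finally have "distr (gauss n) (PiM ?I (\<lambda>_. borel)) (\<lambda>g. \<lambda>e\<in>?I. g e) = (\<Pi>\<^sub>M e\<in>?I. distr (gauss n) borel (\<lambda>g. g e))" .
  then show ?thesis
    using assms by (subst gauss.indep_vars_iff_distr_eq_PiM') auto
qed

definition restricted_row :: "'p set \<Rightarrow> nat \<Rightarrow> (nat \<times> 'p::finite \<Rightarrow> real) \<Rightarrow> real^'p" where
  "restricted_row N i g = (\<chi> k. if k \<in> N then g (i, k) else 0)"

text \<open>The entries of the matrix of the orthogonal projection of \<open>\<real>\<^sup>n\<close> to the span of the columns of
  the data matrix with index in \<open>N\<close>, provided that these are linearly independent.\<close>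

definition hat_matrix :: "nat \<Rightarrow> 'p set \<Rightarrow> nat \<Rightarrow> nat \<Rightarrow> (nat \<times> 'p::finite \<Rightarrow> real) \<Rightarrow> real" where
  "hat_matrix n N i i' g = restricted_row N i g
     \<bullet> (matrix_inv (padded_block N (gram n g)) *v restricted_row N i' g)"

text \<open>This is what makes the projection independent of the columns with index outside \<open>N\<close>.\<close>

lemma hat_matrix_restrict:
  assumes "i < n" "i' < n"
  shows "hat_matrix n N i i' (restrict g ({..<n} \<times> N)) = hat_matrix n N i i' g"
proof -
  have "padded_block N (gram n (restrict g ({..<n} \<times> N))) = padded_block N (gram n g)"
    by (auto simp: padded_block_def gram_def vec_eq_iff)
  moreover have "restricted_row N k (restrict g ({..<n} \<times> N)) = restricted_row N k g" if "k < n" for k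
    using that by (auto simp: restricted_row_def vec_eq_iff)
  ultimately show ?thesis using assms by (simp add: hat_matrix_def)
qed

lemma hat_matrix_measurable:
  fixes N :: "'p::finite set"
  assumes "i < n" "i' < n"
  shows "hat_matrix n N i i' \<in> borel_measurable (PiM ({..<n} \<times> N) (\<lambda>_. borel))"
proof -
  let ?M = "PiM ({..<n} \<times> N) (\<lambda>_. borel) :: (nat \<times> 'p \<Rightarrow> real) measure"
  have comp: "(\<lambda>g. g (k, l)) \<in> borel_measurable ?M" if "k < n" "l \<in> N" for k l
    using that by (intro measurable_component_singleton) auto
  have row: "restricted_row N k \<in> borel_measurable ?M" if "k < n" for k
  proof (rule borel_measurable_vecI)
    show "(\<lambda>g. restricted_row N k g $ l) \<in> borel_measurable ?M" for l
      using comp[OF that, of l] by (cases "l \<in> N") (simp_all add: restricted_row_def)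
  qed
  have "(\<lambda>g. padded_block N (gram n g)) \<in> borel_measurable ?M"
  proof (rule borel_measurable_matrixI)
    fix k l
    have "(\<lambda>g. \<Sum>i<n. g (i, k) * g (i, l)) \<in> borel_measurable ?M" if "k \<in> N" "l \<in> N"
      using that by (intro borel_measurable_sum borel_measurable_times comp) auto
    then show "(\<lambda>g. padded_block N (gram n g) $ k $ l) \<in> borel_measurable ?M"
      by (cases "k \<in> N \<and> l \<in> N") (auto simp: padded_block_def gram_def)
  qed
  note [measurable] = this row[OF assms(1)] row[OF assms(2)]
  show ?thesis
    unfolding hat_matrix_def[abs_def] inner_vec_def matrix_vector_mult_def by simp
qed

text \<open>The trace of a projection is the dimension of its range.\<close>

lemma hat_matrix_trace:
  assumes G: "pos_def (gram n g)"
  shows "(\<Sum>i<n. hat_matrix n N i i g) = real (card N)"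
proof -
  define P where "P = padded_block N (gram n g)"
  define D where "D = matrix_inv P"
  have DP: "D ** P = mat 1"
    using pos_def_padded_block[OF G, of N] by (simp add: D_def P_def matrix_inv_mult pos_def_invertible)
  define y where "y = (\<lambda>i. restricted_row N i g)"
  have yy: "(\<Sum>i<n. y i $ k * y i $ l) = (if k \<in> N then P $ l $ k else 0)" for k l
    by (auto simp: y_def restricted_row_def P_def padded_block_def gram_def mult.commute intro!: sum.cong)
  have "(\<Sum>i<n. hat_matrix n N i i g) = (\<Sum>i<n. \<Sum>k\<in>UNIV. \<Sum>l\<in>UNIV. D $ k $ l * (y i $ k * y i $ l))"
    by (simp add: hat_matrix_def D_def P_def y_def inner_vec_def matrix_vector_mult_def sum_distrib_left mult_ac)
  also have "\<dots> = (\<Sum>k\<in>UNIV. \<Sum>i<n. \<Sum>l\<in>UNIV. D $ k $ l * (y i $ k * y i $ l))"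
    by (rule sum.swap)
  also have "\<dots> = (\<Sum>k\<in>UNIV. \<Sum>l\<in>UNIV. \<Sum>i<n. D $ k $ l * (y i $ k * y i $ l))"
    by (intro sum.cong refl sum.swap)
  also have "\<dots> = (\<Sum>k\<in>UNIV. \<Sum>l\<in>UNIV. D $ k $ l * (if k \<in> N then P $ l $ k else 0))"
    by (simp add: yy flip: sum_distrib_left)
  also have "\<dots> = (\<Sum>k\<in>UNIV. if k \<in> N then (D ** P) $ k $ k else 0)"
    by (intro sum.cong) (auto simp: matrix_matrix_mult_def)
  also have "\<dots> = real (card N)"
    by (simp add: DP mat_def sum.If_cases)
  finally show ?thesis .
qed

text \<open>A crude bound, good enough for integrability: the form is positive semidefinite, so the absolute
  value of an entry is at most the mean of two diagonal entries, and the diagonal entries are nonnegative and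
  sum up to the trace.\<close>

lemma hat_matrix_bounded:
  assumes G: "pos_def (gram n g)" and i: "i < n" "i' < n"
  shows "\<bar>hat_matrix n N i i' g\<bar> \<le> real (card N)"
proof -
  define D where "D = matrix_inv (padded_block N (gram n g))"
  have "pos_def D"
    unfolding D_def by (intro pos_def_matrix_inv pos_def_padded_block G)
  then have pD: "pos_semidef D" by (rule pos_def_imp_pos_semidef)
  have nn: "0 \<le> hat_matrix n N k k g" for k
    using pD by (simp add: hat_matrix_def pos_semidef_def flip: D_def)
  have le: "hat_matrix n N k k g \<le> real (card N)" if "k < n" for k
    using that member_le_sum[of k "{..<n}" "\<lambda>k. hat_matrix n N k k g"] nn
    by (simp add: hat_matrix_trace[OF G])
  let ?x = "restricted_row N i g" and ?y = "restricted_row N i' g"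
  have sym: "?y \<bullet> (D *v ?x) = ?x \<bullet> (D *v ?y)"
    using inner_transpose[of ?y D ?x] pD by (simp add: pos_semidef_def inner_commute)
  have "0 \<le> (?x + ?y) \<bullet> (D *v (?x + ?y))" "0 \<le> (?x - ?y) \<bullet> (D *v (?x - ?y))"
    using pD by (simp_all add: pos_semidef_def)
  then have "2 * \<bar>?x \<bullet> (D *v ?y)\<bar> \<le> ?x \<bullet> (D *v ?x) + ?y \<bullet> (D *v ?y)"
    by (simp add: matrix_vector_right_distrib matrix_vector_mult_diff_distrib inner_add_left inner_add_right
        inner_diff_left inner_diff_right sym)
  then show ?thesis
    using le[OF i(1)] le[OF i(2)] by (simp add: hat_matrix_def flip: D_def)
qed

text \<open>The Schur complement is the squared distance of the \<open>j\<close>-th data column, a standard Gaussian vector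
  in \<open>\<real>\<^sup>n\<close>, from the span of the columns with index in \<open>N\<close>, which is independent of it and has dimension
  \<open>card N\<close>.\<close>

lemma expected_schur_complement:
  fixes N :: "'p::finite set"
  assumes n: "CARD('p) \<le> n" and j: "j \<notin> N"
  defines "d \<equiv> \<lambda>g. gram n g $ j $ j
    - vec_restrict N (gram n g $ j) \<bullet> (matrix_inv (padded_block N (gram n g)) *v vec_restrict N (gram n g $ j))"
  shows "integrable (gauss n) d" and "integral\<^sup>L (gauss n) d = real n - real (card N)"
proof -
  have n0: "0 < n" by (rule less_le_trans[OF zero_less_card_finite n])
  let ?h = "hat_matrix n N" and ?I = "{..<n} \<times> (UNIV :: 'p set)"
  have indep: "gauss.indep_vars n (\<lambda>_. borel) (\<lambda>e g. g e) ?I"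
    by (rule indep_gauss_components[OF n0])
  have AE_G: "AE g in gauss n. pos_def (gram n g :: real^'p^'p)"
    by (rule gram_nonsingular_and_log_integrable(1)[OF n])

  \<comment> \<open>Expanding the squared length of the projection of column \<open>j\<close> in products of its entries, the
    coefficients \<open>?h i i'\<close> are independent of these products, whose expectations are those of an identity
    matrix; what remains is the trace of the projection.\<close>
  have split: "gauss.indep_var n borel (\<lambda>g. g (i, j) * g (i', j)) borel (?h i i')"
    if i: "i < n" "i' < n" for i i'
  proof -
    let ?A = "{..<n} \<times> {j}" and ?B = "{..<n} \<times> N"
    have "gauss.indep_var n (PiM ?A (\<lambda>_. borel)) (\<lambda>g. restrict (\<lambda>e. g e) ?A)
        (PiM ?B (\<lambda>_. borel)) (\<lambda>g. restrict (\<lambda>e. g e) ?B)"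
      using j by (intro gauss.indep_var_restrict[OF indep]) auto
    moreover have "(\<lambda>g :: nat \<times> 'p \<Rightarrow> real. g (i, j) * g (i', j)) \<in> borel_measurable (PiM ?A (\<lambda>_. borel))"
      using i by (intro borel_measurable_times measurable_component_singleton) auto
    ultimately have "gauss.indep_var n borel ((\<lambda>g. g (i, j) * g (i', j)) \<circ> (\<lambda>g. restrict (\<lambda>e. g e) ?A))
        borel (?h i i' \<circ> (\<lambda>g. restrict (\<lambda>e. g e) ?B))"
      using hat_matrix_measurable[OF i, of N] by (rule gauss.indep_var_compose)
    moreover have "(\<lambda>g. g (i, j) * g (i', j)) \<circ> (\<lambda>g. restrict (\<lambda>e. g e) ?A) = (\<lambda>g :: nat \<times> 'p \<Rightarrow> real. g (i, j) * g (i', j))"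
      using i by (simp add: fun_eq_iff)
    moreover have "?h i i' \<circ> (\<lambda>g. restrict (\<lambda>e. g e) ?B) = ?h i i'"
      using i by (simp add: fun_eq_iff hat_matrix_restrict)
    ultimately show ?thesis by simp
  qed
  have cov: "integrable (gauss n) (\<lambda>g. g (i, j) * g (i', j))"
    "(\<integral>g. g (i, j) * g (i', j) \<partial>gauss n) = (if i = i' then 1 else 0)"
    if i: "i < n" "i' < n" for i i'
  proof -
    have "integrable (gauss n) (\<lambda>g. g (i, j) * g (i', j)) \<and>
      (\<integral>g. g (i, j) * g (i', j) \<partial>gauss n) = (if i = i' then 1 else 0)"
    proof (cases "i = i'")
      case True
      then show ?thesis
        using gauss_component_moments(3,4)[OF i(1), of j] by (simp add: power2_eq_square)
    next
      case False
      have "gauss.indep_var n (PiM {(i, j)} (\<lambda>_. borel)) (\<lambda>g. restrict (\<lambda>e. g e) {(i, j)})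
          (PiM {(i', j)} (\<lambda>_. borel)) (\<lambda>g. restrict (\<lambda>e. g e) {(i', j)})"
        using False i by (intro gauss.indep_var_restrict[OF indep]) auto
      then have "gauss.indep_var n borel ((\<lambda>g. g (i, j)) \<circ> (\<lambda>g. restrict (\<lambda>e. g e) {(i, j)}))
          borel ((\<lambda>g. g (i', j)) \<circ> (\<lambda>g. restrict (\<lambda>e. g e) {(i', j)}))"
        by (rule gauss.indep_var_compose) (intro measurable_component_singleton; simp)+
      then have iv: "gauss.indep_var n borel (\<lambda>g. g (i, j)) borel (\<lambda>g. g (i', j))"
        by (simp add: comp_def)
      note mom = gauss_component_moments(1)[OF i(1), of j] gauss_component_moments(1)[OF i(2), of j]
      show ?thesis
        using gauss.indep_var_lebesgue_integral[OF iv mom] gauss.indep_var_integrable[OF iv mom]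
          gauss_component_moments(2)[OF i(1), of j] False by simp
    qed
    then show "integrable (gauss n) (\<lambda>g. g (i, j) * g (i', j))"
      "(\<integral>g. g (i, j) * g (i', j) \<partial>gauss n) = (if i = i' then 1 else 0)" by auto
  qed
  have hat_int: "integrable (gauss n) (?h i i')" if i: "i < n" "i' < n" for i i'
  proof (rule gauss.integrable_const_bound)
    show "AE g in gauss n. norm (?h i i' g) \<le> real (card N)"
      using AE_G by eventually_elim (simp add: hat_matrix_bounded i)
    show "?h i i' \<in> borel_measurable (gauss n)"
      by (rule gauss.indep_var_rv2[OF split[OF i]])
  qed
  note prod_int = gauss.indep_var_integrable[OF split cov(1) hat_int]
  note prod_exp = gauss.indep_var_lebesgue_integral[OF split cov(1) hat_int]

  have d: "d g = (\<Sum>i<n. g (i, j) * g (i, j)) - (\<Sum>i<n. \<Sum>i'<n. g (i, j) * g (i', j) * ?h i i' g)" for g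
  proof -
    define D where "D = matrix_inv (padded_block N (gram n g))"
    define y where "y = (\<lambda>i. restricted_row N i g)"
    have s: "vec_restrict N (gram n g $ j) = (\<Sum>i<n. g (i, j) *\<^sub>R y i)"
      by (auto simp: vec_restrict_def gram_def y_def restricted_row_def vec_eq_iff)
    have "D *v (\<Sum>i<n. g (i, j) *\<^sub>R y i) = (\<Sum>i<n. g (i, j) *\<^sub>R (D *v y i))"
      by (simp add: linear_sum[OF matrix_vector_mul_linear] matrix_vector_mult_scaleR)
    then have "vec_restrict N (gram n g $ j) \<bullet> (D *v vec_restrict N (gram n g $ j))
        = (\<Sum>i<n. \<Sum>i'<n. g (i, j) * g (i', j) * (y i \<bullet> (D *v y i')))"
      by (simp add: s inner_sum_left inner_sum_right sum_distrib_left mult_ac)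
        (subst sum.swap, simp add: mult.left_commute)
    then show ?thesis
      by (simp add: d_def D_def y_def hat_matrix_def gram_def)
  qed
  show "integrable (gauss n) d"
    unfolding d by (intro Bochner_Integration.integrable_diff Bochner_Integration.integrable_sum prod_int cov(1)) auto
  have "integral\<^sup>L (gauss n) d
      = (\<integral>g. (\<Sum>i<n. g (i, j) * g (i, j)) \<partial>gauss n) - (\<integral>g. (\<Sum>i<n. \<Sum>i'<n. g (i, j) * g (i', j) * ?h i i' g) \<partial>gauss n)"
    unfolding d by (intro Bochner_Integration.integral_diff Bochner_Integration.integrable_sum prod_int cov(1)) auto
  also have "(\<integral>g. (\<Sum>i<n. g (i, j) * g (i, j)) \<partial>gauss n) = (\<Sum>i<n. 1)"
    by (subst Bochner_Integration.integral_sum) (auto intro!: cov(1) sum.cong simp: cov(2))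
  also have "(\<integral>g. (\<Sum>i<n. \<Sum>i'<n. g (i, j) * g (i', j) * ?h i i' g) \<partial>gauss n)
      = (\<Sum>i<n. (\<integral>g. (\<Sum>i'<n. g (i, j) * g (i', j) * ?h i i' g) \<partial>gauss n))"
    by (intro Bochner_Integration.integral_sum Bochner_Integration.integrable_sum prod_int) auto
  also have "\<dots> = (\<Sum>i<n. \<Sum>i'<n. (\<integral>g. g (i, j) * g (i', j) * ?h i i' g \<partial>gauss n))"
    by (intro sum.cong refl Bochner_Integration.integral_sum prod_int) auto
  also have "\<dots> = (\<Sum>i<n. \<Sum>i'<n. if i = i' then integral\<^sup>L (gauss n) (?h i i) else 0)"
    by (intro sum.cong refl) (auto simp: prod_exp cov(2))
  also have "\<dots> = (\<Sum>i<n. integral\<^sup>L (gauss n) (?h i i))" by simp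
  also have "\<dots> = (\<integral>g. (\<Sum>i<n. ?h i i g) \<partial>gauss n)"
    by (intro Bochner_Integration.integral_sum[symmetric] hat_int) auto
  also have "\<dots> = (\<integral>g. real (card N) \<partial>(gauss n :: (nat \<times> 'p \<Rightarrow> real) measure))"
  proof (rule integral_cong_AE)
    show "(\<lambda>g. \<Sum>i<n. ?h i i g) \<in> borel_measurable (gauss n)"
      by (intro borel_measurable_sum borel_measurable_integrable hat_int) auto
    show "AE g in gauss n. (\<Sum>i<n. ?h i i g) = real (card N)"
      using AE_G by eventually_elim (rule hat_matrix_trace)
  qed simp
  finally show "integral\<^sup>L (gauss n) d = real n - real (card N)"
    by (simp add: gauss.prob_space)
qed

text \<open>The tangent \<open>2 c - c\<^sup>2 u \<le> 1 / u\<close> at \<open>u = 1 / c\<close> makes this Jensen's inequality for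
  \<open>1 / (b\<^sub>j + d)\<close>, where \<open>d\<close> is the Schur complement.\<close>

lemma expected_regularized_inverse_diagonal:
  fixes b :: "'p::finite \<Rightarrow> real" and \<nu> :: real
  assumes n: "CARD('p) \<le> n" and b: "\<And>k. 0 \<le> b k" and j: "0 < b j"
    and \<nu>: "0 < \<nu>" "real n - real (card {k. b k = 0}) \<le> \<nu>"
  defines "r \<equiv> \<lambda>g. matrix_inv (gram n g + diag_mat b) $ j $ j"
  shows "integrable (gauss n) r" and "1 / (\<nu> + b j) \<le> integral\<^sup>L (gauss n) r"
proof -
  define N where "N = {k. b k = 0}"
  have jN: "j \<notin> N" using j by (simp add: N_def)
  have AE_G: "AE g in gauss n. pos_def (gram n g :: real^'p^'p)"
    by (rule gram_nonsingular_and_log_integrable(1)[OF n])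
  show int: "integrable (gauss n) r"
  proof (rule gauss.integrable_const_bound)
    show "AE g in gauss n. norm (r g) \<le> 1 / b j"
      using AE_G
    proof eventually_elim
      fix g :: "nat \<times> 'p \<Rightarrow> real" assume G: "pos_def (gram n g)"
      have "0 < r g" "b j * r g \<le> 1"
        unfolding r_def by (rule regularized_inverse_diagonal_bounds[of "gram n g" b j, OF G b])+
      then show "norm (r g) \<le> 1 / b j"
        using j by (simp add: pos_le_divide_eq mult.commute)
    qed
    show "r \<in> borel_measurable (gauss n)" unfolding r_def by measurable
  qed
  define c where "c = 1 / (\<nu> + b j)"
  define d where "d = (\<lambda>g. gram n g $ j $ j
    - vec_restrict N (gram n g $ j) \<bullet> (matrix_inv (padded_block N (gram n g)) *v vec_restrict N (gram n g $ j)))"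
  have d: "integrable (gauss n) d" "integral\<^sup>L (gauss n) d = real n - real (card N)"
    unfolding d_def by (rule expected_schur_complement[OF n jN])+
  have "(\<nu> + b j) * c = 1" using \<nu> j by (simp add: c_def)
  moreover have "c\<^sup>2 * (b j + \<nu>) = c * ((\<nu> + b j) * c)" by (simp add: power2_eq_square algebra_simps)
  ultimately have "c\<^sup>2 * (b j + \<nu>) = c" by simp
  then have "c = 2 * c - c\<^sup>2 * (b j + \<nu>)" by simp
  also have "\<dots> \<le> 2 * c - c\<^sup>2 * (b j + integral\<^sup>L (gauss n) d)"
    using \<nu> by (intro diff_left_mono mult_left_mono) (simp_all add: d N_def)
  also have "\<dots> = (\<integral>g. 2 * c - c\<^sup>2 * (b j + d g) \<partial>gauss n)"
    using d by (simp add: gauss.prob_space)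
  also have "\<dots> \<le> integral\<^sup>L (gauss n) r"
  proof (rule integral_mono_AE)
    show "integrable (gauss n) (\<lambda>g. 2 * c - c\<^sup>2 * (b j + d g))" using d by simp
    show "AE g in gauss n. 2 * c - c\<^sup>2 * (b j + d g) \<le> r g"
      using AE_G
    proof eventually_elim
      fix g :: "nat \<times> 'p \<Rightarrow> real" assume G: "pos_def (gram n g)"
      show "2 * c - c\<^sup>2 * (b j + d g) \<le> r g"
        unfolding d_def r_def by (rule regularized_inverse_diagonal_lower_bound[OF G b _ jN]) (simp add: N_def)
    qed
  qed (rule int)
  finally show "1 / (\<nu> + b j) \<le> integral\<^sup>L (gauss n) r" by (simp add: c_def)
qed

section \<open>Linear changes of variables for Lebesgue measure\<close>

lemma nn_integral_lborel_translate:
  fixes g :: "'a::euclidean_space \<Rightarrow> ennreal"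
  assumes [measurable]: "g \<in> borel_measurable borel"
  shows "(\<integral>\<^sup>+ x. g (c + x) \<partial>lborel) = (\<integral>\<^sup>+ x. g x \<partial>lborel)"
proof -
  have "(\<integral>\<^sup>+ x. g x \<partial>distr lborel borel ((+) c)) = (\<integral>\<^sup>+ x. g (c + x) \<partial>lborel)"
    by (rule nn_integral_distr) auto
  then show ?thesis by (simp add: lborel_distr_plus)
qed

lemma nn_integral_lborel_reflect:
  fixes g :: "'a::euclidean_space \<Rightarrow> ennreal"
  assumes [measurable]: "g \<in> borel_measurable borel"
  shows "(\<integral>\<^sup>+ x. g (c - x) \<partial>lborel) = (\<integral>\<^sup>+ x. g x \<partial>lborel)"
proof -
  have "(\<integral>\<^sup>+ x. g x \<partial>lborel) = (\<integral>\<^sup>+ x. g x \<partial>density (distr lborel borel (\<lambda>x. c + (-1) *\<^sub>R x)) (\<lambda>_. 1))"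
    using lborel_affine[of "-1" c] by simp
  also have "\<dots> = (\<integral>\<^sup>+ x. g (c + (-1) *\<^sub>R x) \<partial>lborel)"
    by (simp add: density_1 nn_integral_distr)
  finally show ?thesis by simp
qed

text \<open>The argument for the uniqueness of Haar measure: integrate \<open>g (f x) * h (f x + y)\<close> in both
  orders, using that both Lebesgue measure and its pullback along \<open>f\<close> are invariant under
  translations.\<close>

lemma nn_integral_lborel_linear_proportional:
  fixes f :: "real^'n \<Rightarrow> real^'n" and g h :: "real^'n \<Rightarrow> ennreal"
  assumes f: "linear f" "surj f"
    and [measurable]: "f \<in> borel_measurable borel" "g \<in> borel_measurable borel" "h \<in> borel_measurable borel"
  shows "(\<integral>\<^sup>+ x. g (f x) \<partial>lborel) * (\<integral>\<^sup>+ x. h x \<partial>lborel) = (\<integral>\<^sup>+ x. h (f x) \<partial>lborel) * (\<integral>\<^sup>+ x. g x \<partial>lborel)"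
proof -
  have "(\<integral>\<^sup>+ x. g (f x) \<partial>lborel) * (\<integral>\<^sup>+ x. h x \<partial>lborel)
      = (\<integral>\<^sup>+ x. (\<integral>\<^sup>+ y. g (f x) * h (f x + y) \<partial>lborel) \<partial>lborel)"
    by (simp add: nn_integral_cmult nn_integral_lborel_translate nn_integral_multc)
  also have "\<dots> = (\<integral>\<^sup>+ y. (\<integral>\<^sup>+ x. g (f x) * h (f x + y) \<partial>lborel) \<partial>lborel)"
    by (rule lborel_pair.Fubini') measurable
  also have "\<dots> = (\<integral>\<^sup>+ y. (\<integral>\<^sup>+ x. g (f x - y) * h (f x) \<partial>lborel) \<partial>lborel)"
  proof (rule nn_integral_cong)
    fix y
    obtain z where z: "y = f z" using f(2) by (rule surjE)
    have "(\<integral>\<^sup>+ x. g (f x - y) * h (f x) \<partial>lborel) = (\<integral>\<^sup>+ x. g (f (z + x) - y) * h (f (z + x)) \<partial>lborel)"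
      by (rule nn_integral_lborel_translate[symmetric]) measurable
    then show "(\<integral>\<^sup>+ x. g (f x) * h (f x + y) \<partial>lborel) = (\<integral>\<^sup>+ x. g (f x - y) * h (f x) \<partial>lborel)"
      by (simp add: z linear_add[OF f(1)] add.commute)
  qed
  also have "\<dots> = (\<integral>\<^sup>+ x. (\<integral>\<^sup>+ y. g (f x - y) * h (f x) \<partial>lborel) \<partial>lborel)"
    by (rule lborel_pair.Fubini') measurable
  also have "\<dots> = (\<integral>\<^sup>+ x. h (f x) \<partial>lborel) * (\<integral>\<^sup>+ x. g x \<partial>lborel)"
  proof -
    have "(\<integral>\<^sup>+ y. g (f x - y) * h (f x) \<partial>lborel) = (\<integral>\<^sup>+ x. g x \<partial>lborel) * h (f x)" for x
      by (simp add: nn_integral_multc nn_integral_lborel_reflect)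
    then show ?thesis by (simp add: nn_integral_cmult mult.commute)
  qed
  finally show ?thesis .
qed

text \<open>The proportionality factor is \<open>1\<close>, as one sees on the unit ball, which \<open>Q\<close> maps to itself.\<close>

lemma nn_integral_lborel_orthogonal:
  fixes Q :: "real^'n^'n"
  assumes Q: "orthogonal_matrix Q" and [measurable]: "g \<in> borel_measurable borel"
  shows "(\<integral>\<^sup>+ x. g (Q *v x) \<partial>lborel) = (\<integral>\<^sup>+ x. g x \<partial>lborel)"
proof -
  define h where "h = (indicator (ball 0 1) :: real^'n \<Rightarrow> ennreal)"
  have [measurable]: "h \<in> borel_measurable borel" unfolding h_def by (intro borel_measurable_indicator) auto
  have "norm (Q *v x) = norm x" for x
    using Q inner_transpose[of "Q *v x" Q x]
    by (simp add: norm_eq_sqrt_inner matrix_vector_mul_assoc orthogonal_matrix_def)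
  then have hQ: "h (Q *v x) = h x" for x by (simp add: h_def indicator_def)
  have "surj (\<lambda>x. Q *v x)"
    by (rule surjI[of _ "\<lambda>x. transpose Q *v x"]) (use Q in \<open>simp add: matrix_vector_mul_assoc orthogonal_matrix_def\<close>)
  then have "(\<integral>\<^sup>+ x. g (Q *v x) \<partial>lborel) * (\<integral>\<^sup>+ x. h x \<partial>lborel) = (\<integral>\<^sup>+ x. h (Q *v x) \<partial>lborel) * (\<integral>\<^sup>+ x. g x \<partial>lborel)"
    by (intro nn_integral_lborel_linear_proportional matrix_vector_mul_linear) measurable
  then have "(\<integral>\<^sup>+ x. h x \<partial>lborel) * (\<integral>\<^sup>+ x. g (Q *v x) \<partial>lborel) = (\<integral>\<^sup>+ x. h x \<partial>lborel) * (\<integral>\<^sup>+ x. g x \<partial>lborel)"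
    by (simp add: hQ mult.commute)
  moreover have "(\<integral>\<^sup>+ x. h x \<partial>lborel) = emeasure lborel (ball (0::real^'n) 1)"
    by (simp add: h_def)
  moreover have "emeasure lborel (ball (0::real^'n) 1) < \<infinity>" by (rule emeasure_lborel_ball_finite)
  moreover have "emeasure lborel (ball (0::real^'n) 1) \<noteq> 0"
    using content_ball_pos[of 1 "0::real^'n"] by (auto simp: measure_def)
  ultimately show ?thesis by (auto simp: ennreal_mult_cancel_left)
qed

lemma prod_Basis_vec: "(\<Prod>b\<in>Basis. x \<bullet> b) = (\<Prod>j\<in>UNIV. x $ j)" for x :: "real^'n"
proof -
  have "(Basis :: (real^'n) set) = range (\<lambda>j. axis j 1)" by (auto simp: Basis_vec_def)
  moreover have "inj (\<lambda>j. axis j (1::real) :: real^'n)" by (auto simp: inj_on_def axis_eq_axis)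
  ultimately show ?thesis
    using prod.reindex[of "\<lambda>j. axis j (1::real) :: real^'n" UNIV "\<lambda>b. x \<bullet> b"]
    by (simp only:) (simp add: inner_axis)
qed

lemma nn_integral_lborel_diag:
  fixes d :: "'n::finite \<Rightarrow> real"
  assumes d: "\<And>j. 0 < d j" and [measurable]: "g \<in> borel_measurable borel"
  shows "ennreal (prod d UNIV) * (\<integral>\<^sup>+ x. g (diag_mat d *v x) \<partial>lborel) = (\<integral>\<^sup>+ x. g x \<partial>lborel)"
proof -
  define v :: "real^'n" where "v = (\<chi> j. d j)"
  define c where "c = (\<lambda>b. v \<bullet> b)"
  have c: "c b \<noteq> 0" if "b \<in> Basis" for b
    using that d by (auto simp: Basis_vec_def c_def v_def inner_axis less_imp_neq[symmetric])
  have T: "0 + (\<Sum>b\<in>Basis. (c b * (x \<bullet> b)) *\<^sub>R b) = diag_mat d *v x" for x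
  proof (rule euclidean_eqI)
    fix b :: "real^'n" assume b: "b \<in> Basis"
    then obtain j where "b = axis j 1" by (auto simp: Basis_vec_def)
    then have "(diag_mat d *v x) \<bullet> b = c b * (x \<bullet> b)"
      by (simp add: inner_axis diag_mat_vec c_def v_def)
    then show "(0 + (\<Sum>b\<in>Basis. (c b * (x \<bullet> b)) *\<^sub>R b)) \<bullet> b = (diag_mat d *v x) \<bullet> b"
      using b by (simp add: inner_sum_left_Basis)
  qed
  have "(\<Prod>b\<in>Basis. \<bar>c b\<bar>) = \<bar>\<Prod>b\<in>Basis. v \<bullet> b\<bar>" by (simp add: c_def abs_prod)
  also have "\<dots> = prod d UNIV"
    unfolding prod_Basis_vec using d by (simp add: v_def prod_nonneg less_imp_le)
  finally have pr: "(\<Prod>b\<in>Basis. \<bar>c b\<bar>) = prod d UNIV" .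
  have "(\<integral>\<^sup>+ x. g x \<partial>lborel) = (\<integral>\<^sup>+ x. g x \<partial>density (distr lborel borel (\<lambda>x. diag_mat d *v x)) (\<lambda>_. ennreal (prod d UNIV)))"
    using lborel_affine_euclidean[of c 0, OF c] unfolding T pr by simp
  also have "\<dots> = (\<integral>\<^sup>+ x. ennreal (prod d UNIV) * g (diag_mat d *v x) \<partial>lborel)"
    by (simp add: nn_integral_density nn_integral_distr)
  finally show ?thesis by (simp add: nn_integral_cmult)
qed

text \<open>By the singular value decomposition, which comes from the spectral decomposition of
  \<open>A A\<^sup>T\<close>, it suffices to treat orthogonal and diagonal matrices.\<close>

lemma nn_integral_lborel_linear:
  fixes A :: "real^'n^'n"
  assumes A: "invertible A" and [measurable]: "g \<in> borel_measurable borel"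
  shows "ennreal \<bar>det A\<bar> * (\<integral>\<^sup>+ x. g (A *v x) \<partial>lborel) = (\<integral>\<^sup>+ x. g x \<partial>lborel)"
proof -
  have "pos_def (A ** transpose A)" using pos_def_congruence[OF A pos_def_mat_1] by simp
  then obtain Q d where Q: "orthogonal_matrix Q" and AA: "A ** transpose A = Q ** diag_mat d ** transpose Q"
    and d: "0 < d i" for i
  proof -
    obtain Q d where *: "orthogonal_matrix Q" "A ** transpose A = Q ** diag_mat d ** transpose Q"
      using symmetric_diagonalization[of "A ** transpose A"] by (auto simp: matrix_transpose_mul)
    moreover have "invertible Q" using * by (auto simp: orthogonal_matrix_def invertible_def)
    then have "pos_def (diag_mat d)"
      using \<open>pos_def (A ** transpose A)\<close> * pos_def_congruence_iff by metis
    ultimately show ?thesis using that by (auto simp: pos_def_diag_mat_iff)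
  qed
  define e where "e = (\<lambda>i. sqrt (d i))"
  define Q1 where "Q1 = diag_mat (\<lambda>i. 1 / e i) ** transpose Q ** A"
  have e: "0 < e i" "e i * e i = d i" for i using d[of i] by (auto simp: e_def)
  have QQ: "transpose Q ** Q = mat 1" "Q ** transpose Q = mat 1" using Q by (auto simp: orthogonal_matrix_def)
  have ei: "diag_mat e ** diag_mat (\<lambda>i. 1 / e i) = mat 1"
    using e by (simp add: diag_mat_mult diag_mat_one less_imp_neq[symmetric] flip: diag_mat_one)
  have "Q1 ** transpose Q1 = diag_mat (\<lambda>i. 1 / e i) ** transpose Q ** (A ** transpose A) ** Q ** diag_mat (\<lambda>i. 1 / e i)"
    by (simp add: Q1_def matrix_transpose_mul matrix_mul_assoc)
  also have "\<dots> = diag_mat (\<lambda>i. 1 / e i) ** (transpose Q ** Q) ** diag_mat d ** (transpose Q ** Q) ** diag_mat (\<lambda>i. 1 / e i)"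
    unfolding AA by (simp only: matrix_mul_assoc)
  also have "\<dots> = mat 1"
  proof -
    have "1 / e i * d i * (1 / e i) = 1" for i using e[of i] by (simp flip: e(2))
    then show ?thesis by (simp only: QQ matrix_mul_rid diag_mat_mult diag_mat_one)
  qed
  finally have Q1: "orthogonal_matrix Q1"
    by (simp add: orthogonal_matrix_def matrix_left_right_inverse)
  have "Q ** diag_mat e ** Q1 = Q ** (diag_mat e ** diag_mat (\<lambda>i. 1 / e i)) ** transpose Q ** A"
    by (simp add: Q1_def matrix_mul_assoc)
  then have A_eq: "A = Q ** diag_mat e ** Q1" by (simp add: ei QQ)
  have "\<bar>det A\<bar> = prod e UNIV"
    using det_orthogonal_matrix[OF Q] det_orthogonal_matrix[OF Q1] e(1)
    by (auto simp: A_eq det_mul abs_mult det_diag_mat prod_nonneg less_imp_le)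
  moreover have "(\<integral>\<^sup>+ x. g (A *v x) \<partial>lborel) = (\<integral>\<^sup>+ x. g (Q *v (diag_mat e *v (Q1 *v x))) \<partial>lborel)"
    by (simp add: A_eq matrix_vector_mul_assoc matrix_mul_assoc)
  moreover have "\<dots> = (\<integral>\<^sup>+ x. g (Q *v (diag_mat e *v x)) \<partial>lborel)"
    by (rule nn_integral_lborel_orthogonal[OF Q1]) measurable
  moreover have "ennreal (prod e UNIV) * (\<integral>\<^sup>+ x. g (Q *v (diag_mat e *v x)) \<partial>lborel) = (\<integral>\<^sup>+ x. g (Q *v x) \<partial>lborel)"
    by (rule nn_integral_lborel_diag[OF e(1)]) measurable
  moreover have "(\<integral>\<^sup>+ x. g (Q *v x) \<partial>lborel) = (\<integral>\<^sup>+ x. g x \<partial>lborel)"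
    by (rule nn_integral_lborel_orthogonal[OF Q]) measurable
  ultimately show ?thesis by simp
qed

lemma lborel_row:
  "distr lborel borel (\<lambda>v::'b::euclidean_space. (\<chi> _. v) :: 'b^1) = lborel"
proof (rule lborel_eqI[symmetric])
  fix l u :: "'b^1" assume le: "\<And>b. b \<in> Basis \<Longrightarrow> l \<bullet> b \<le> u \<bullet> b"
  have B: "(Basis :: ('b^1) set) = axis 1 ` Basis" by (auto simp: Basis_vec_def)
  have inj: "inj_on (axis 1 :: 'b \<Rightarrow> 'b^1) Basis" by (auto simp: inj_on_def axis_eq_axis)
  have [measurable]: "(\<lambda>v::'b. (\<chi> _. v) :: 'b^1) \<in> borel_measurable borel"
    by (rule borel_measurable_vecI) simp
  have "(\<lambda>v::'b. (\<chi> _. v) :: 'b^1) -` box l u \<inter> space lborel = box (l $ 1) (u $ 1)"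
    by (auto simp: mem_box B inner_axis)
  then have "emeasure (distr lborel borel (\<lambda>v::'b. (\<chi> _. v) :: 'b^1)) (box l u) = emeasure lborel (box (l $ 1) (u $ 1))"
    by (subst emeasure_distr) auto
  also have "\<dots> = (\<Prod>b\<in>Basis. (u $ 1 - l $ 1) \<bullet> b)"
  proof (rule emeasure_lborel_box)
    fix b :: 'b assume "b \<in> Basis"
    then show "l $ 1 \<bullet> b \<le> u $ 1 \<bullet> b"
      using le[of "axis 1 b"] by (simp add: B inner_axis)
  qed
  also have "\<dots> = (\<Prod>b\<in>Basis. (u - l) \<bullet> b)"
    by (simp add: B prod.reindex[OF inj] inner_axis)
  finally show "emeasure (distr lborel borel (\<lambda>v::'b. (\<chi> _. v) :: 'b^1)) (box l u) = (\<Prod>b\<in>Basis. (u - l) \<bullet> b)" .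
qed simp

interpretation lborel_coords: product_sigma_finite "\<lambda>_. lborel :: real measure"
  by standard

lemma vec_lambda_measurable [measurable]:
  "(\<lambda>w. \<chi> j. w j) \<in> borel_measurable (PiM (UNIV :: 'n::finite set) (\<lambda>_. lborel :: real measure))"
proof (rule borel_measurable_vecI)
  fix j
  have "(\<lambda>w. w j) \<in> PiM (UNIV :: 'n set) (\<lambda>_. lborel :: real measure) \<rightarrow>\<^sub>M lborel"
    by (rule measurable_component_singleton) simp
  then show "(\<lambda>w. (\<chi> j. w j) $ j) \<in> borel_measurable (PiM (UNIV :: 'n set) (\<lambda>_. lborel :: real measure))"
    by simp
qed

lemma lborel_vec:
  "distr (PiM UNIV (\<lambda>_. lborel)) borel (\<lambda>w. \<chi> j. w j) = (lborel :: (real^'n) measure)"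
proof (rule lborel_eqI[symmetric])
  fix l u :: "real^'n" assume le: "\<And>b. b \<in> Basis \<Longrightarrow> l \<bullet> b \<le> u \<bullet> b"
  have lu: "l $ j \<le> u $ j" for j
    using le[of "axis j 1"] by (simp add: inner_axis)
  have "(\<lambda>w. \<chi> j. w j) -` box l u \<inter> space (PiM UNIV (\<lambda>_. lborel)) = (\<Pi>\<^sub>E j\<in>UNIV. {l $ j <..< u $ j})"
    by (auto simp: mem_box_cart space_PiM PiE_iff)
  then have "emeasure (distr (PiM UNIV (\<lambda>_. lborel)) borel (\<lambda>w. \<chi> j. w j)) (box l u)
      = emeasure (PiM UNIV (\<lambda>_. lborel)) (\<Pi>\<^sub>E j\<in>UNIV. {l $ j <..< u $ j})"
    by (subst emeasure_distr) auto
  also have "\<dots> = (\<Prod>j\<in>UNIV. emeasure lborel {l $ j <..< u $ j})"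
    by (rule lborel_coords.emeasure_PiM) auto
  also have "\<dots> = ennreal (\<Prod>b\<in>Basis. (u - l) \<bullet> b)"
    unfolding prod_Basis_vec using lu by (simp add: prod_ennreal)
  finally show "emeasure (distr (PiM UNIV (\<lambda>_. lborel)) borel (\<lambda>w. \<chi> j. w j)) (box l u) = (\<Prod>b\<in>Basis. (u - l) \<bullet> b)" .
qed simp

section \<open>The Wishart law as the law of a Gram matrix\<close>

interpretation std_normal_coords: product_sigma_finite "\<lambda>_. std_normal"
  by standard

lemma distr_std_normal_vec:
  "distr (PiM UNIV (\<lambda>_. std_normal)) borel (\<lambda>w. \<chi> j. w j)
    = density lborel (\<lambda>x::real^'n. ennreal (exp (- (x \<bullet> x) / 2) / (2 * pi) powr (real CARD('n) / 2)))"
proof -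
  let ?\<phi> = "\<lambda>x. ennreal (std_normal_density x)"
  have "(\<lambda>w. \<Prod>j\<in>UNIV. ?\<phi> ((\<chi> j. w j) $ j)) \<in> borel_measurable (PiM (UNIV :: 'n set) (\<lambda>_. lborel :: real measure))"
    by measurable
  then have meas: "(\<lambda>w. \<Prod>j\<in>UNIV. ?\<phi> (w j)) \<in> borel_measurable (PiM (UNIV :: 'n set) (\<lambda>_. lborel :: real measure))"
    by simp
  have "density (PiM UNIV (\<lambda>_. lborel)) (\<lambda>w. \<Prod>j\<in>UNIV. ?\<phi> (w j)) = PiM (UNIV :: 'n set) (\<lambda>_. std_normal)"
  proof (rule std_normal_coords.PiM_eqI)
    show "sets (density (PiM UNIV (\<lambda>_. lborel)) (\<lambda>w. \<Prod>j\<in>UNIV. ?\<phi> (w j))) = sets (PiM (UNIV :: 'n set) (\<lambda>_. std_normal))"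
      by (simp only: sets_density) (rule sets_PiM_cong, simp_all)
    fix A :: "'n \<Rightarrow> real set" assume "\<And>j. j \<in> UNIV \<Longrightarrow> A j \<in> sets std_normal"
    then have [measurable]: "A j \<in> sets borel" for j by simp
    have "(\<Pi>\<^sub>E j\<in>UNIV. A j) \<in> sets (PiM (UNIV :: 'n set) (\<lambda>_. lborel :: real measure))"
      by (intro sets_PiM_I_finite) auto
    then have "emeasure (density (PiM UNIV (\<lambda>_. lborel)) (\<lambda>w. \<Prod>j\<in>UNIV. ?\<phi> (w j))) (\<Pi>\<^sub>E j\<in>UNIV. A j)
        = (\<integral>\<^sup>+ w. (\<Prod>j\<in>UNIV. ?\<phi> (w j)) * indicator (\<Pi>\<^sub>E j\<in>UNIV. A j) w \<partial>PiM UNIV (\<lambda>_. lborel))"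
      using meas by (intro emeasure_density) auto
    also have "\<dots> = (\<integral>\<^sup>+ w. (\<Prod>j\<in>UNIV. ?\<phi> (w j) * indicator (A j) (w j)) \<partial>PiM UNIV (\<lambda>_. lborel))"
    proof (rule nn_integral_cong)
      fix w :: "'n \<Rightarrow> real"
      have "indicator (\<Pi>\<^sub>E j\<in>UNIV. A j) w = (\<Prod>j\<in>UNIV. indicator (A j) (w j) :: ennreal)"
        by (auto simp: indicator_def PiE_iff prod_zero_iff)
      then show "(\<Prod>j\<in>UNIV. ?\<phi> (w j)) * indicator (\<Pi>\<^sub>E j\<in>UNIV. A j) w = (\<Prod>j\<in>UNIV. ?\<phi> (w j) * indicator (A j) (w j))"
        by (simp add: prod.distrib)
    qed
    also have "\<dots> = (\<Prod>j\<in>UNIV. \<integral>\<^sup>+ x. ?\<phi> x * indicator (A j) x \<partial>lborel)"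
      by (rule lborel_coords.product_nn_integral_prod) auto
    also have "\<dots> = (\<Prod>j\<in>UNIV. emeasure std_normal (A j))"
      by (simp add: std_normal_def emeasure_density)
    finally show "emeasure (density (PiM UNIV (\<lambda>_. lborel)) (\<lambda>w. \<Prod>j\<in>UNIV. ?\<phi> (w j))) (\<Pi>\<^sub>E j\<in>UNIV. A j)
        = (\<Prod>j\<in>UNIV. emeasure std_normal (A j))" .
  qed simp
  then have "distr (PiM (UNIV :: 'n set) (\<lambda>_. std_normal)) borel (\<lambda>w. \<chi> j. w j)
      = distr (density (PiM UNIV (\<lambda>_. lborel)) (\<lambda>w. \<Prod>j\<in>UNIV. ?\<phi> ((\<chi> j. w j) $ j))) borel (\<lambda>w. \<chi> j. w j)"
    by simp
  also have "\<dots> = density (distr (PiM UNIV (\<lambda>_. lborel)) borel (\<lambda>w. \<chi> j. w j)) (\<lambda>x. \<Prod>j\<in>UNIV. ?\<phi> (x $ j))"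
    by (rule density_distr[symmetric]) measurable
  also have "\<dots> = density lborel (\<lambda>x::real^'n. \<Prod>j\<in>UNIV. ?\<phi> (x $ j))"
    by (simp only: lborel_vec)
  also have "(\<lambda>x::real^'n. \<Prod>j\<in>UNIV. ?\<phi> (x $ j))
      = (\<lambda>x. ennreal (exp (- (x \<bullet> x) / 2) / (2 * pi) powr (real CARD('n) / 2)))"
  proof
    fix x :: "real^'n"
    have "(\<Prod>j\<in>UNIV. std_normal_density (x $ j)) = (1 / sqrt (2 * pi)) ^ CARD('n) * (\<Prod>j\<in>UNIV. exp (- (x $ j)\<^sup>2 / 2))"
      by (simp only: std_normal_density_def prod.distrib prod_constant)
    also have "(\<Prod>j\<in>UNIV. exp (- (x $ j)\<^sup>2 / 2)) = exp (- (x \<bullet> x) / 2)"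
      by (simp add: inner_vec_def power2_eq_square sum_negf sum_divide_distrib flip: exp_sum)
    also have "(1 / sqrt (2 * pi)) ^ CARD('n) = 1 / (2 * pi) powr (real CARD('n) / 2)"
    proof -
      have "(2 * pi) powr (real CARD('n) / 2) = ((2 * pi) powr (1 / 2)) powr real CARD('n)"
        by (simp only: powr_powr) simp
      also have "\<dots> = sqrt (2 * pi) ^ CARD('n)"
        by (subst powr_half_sqrt) (simp_all add: powr_realpow)
      finally show ?thesis by (simp only: power_divide power_one)
    qed
    finally show "(\<Prod>j\<in>UNIV. ?\<phi> (x $ j)) = ennreal (exp (- (x \<bullet> x) / 2) / (2 * pi) powr (real CARD('n) / 2))"
      by (simp add: prod_ennreal)
  qed
  finally show ?thesis .
qed

text \<open>A linear change of variables by \<open>A\<close>: it carries the standard Gaussian density to the density of the matrix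
  normal distribution because \<open>(A x) \<bullet> (A A\<^sup>T)\<^sup>-\<^sup>1 (A x) = x \<bullet> x\<close> and \<open>(det (A A\<^sup>T))\<^sup>1\<^sup>/\<^sup>2 = \<bar>det A\<bar>\<close>.\<close>

lemma matrix_normal_row:
  fixes A :: "real^'p^'p"
  assumes A: "invertible A"
  shows "distr (PiM UNIV (\<lambda>_. std_normal)) borel (\<lambda>w. (\<chi> _. A *v (\<chi> j. w j)) :: real^'p^1)
    = matrix_normal 0 (mat 1) (A ** transpose A)"
proof (rule measure_eqI)
  let ?\<Sigma> = "A ** transpose A"
  define \<gamma> where "\<gamma> = (\<lambda>x::real^'p. ennreal (exp (- (x \<bullet> x) / 2) / (2 * pi) powr (real CARD('p) / 2)))"
  define f where "f = (\<lambda>Y::real^'p^1. ennreal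
     (exp (- (1/2) * trace (matrix_inv (mat 1) ** (Y - 0) ** matrix_inv ?\<Sigma> ** transpose (Y - 0)))
      / ((2 * pi) powr (real CARD(1) * real CARD('p) / 2)
         * det (mat 1 :: real^1^1) powr (real CARD('p) / 2) * det ?\<Sigma> powr (real CARD(1) / 2))))"
  define row where "row = (\<lambda>v::real^'p. (\<chi> _. v) :: real^'p^1)"
  have [measurable]: "row \<in> borel_measurable borel"
    unfolding row_def by (rule borel_measurable_vecI) simp
  have [measurable]: "\<gamma> \<in> borel_measurable borel" unfolding \<gamma>_def by measurable
  have [measurable]: "f \<in> borel_measurable borel" unfolding f_def by measurable
  have MN: "matrix_normal 0 (mat 1) ?\<Sigma> = density lborel f"
    by (simp only: matrix_normal_def f_def)
  have vec: "distr (PiM UNIV (\<lambda>_. std_normal)) borel (\<lambda>w. \<chi> j. w j) = density lborel \<gamma>"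
    unfolding \<gamma>_def by (rule distr_std_normal_vec)
  have vm: "(\<lambda>w. \<chi> j. w j) \<in> borel_measurable (PiM (UNIV :: 'p set) (\<lambda>_. std_normal))"
  proof -
    have "sets (PiM (UNIV :: 'p set) (\<lambda>_. std_normal)) = sets (PiM (UNIV :: 'p set) (\<lambda>_. lborel :: real measure))"
      by (rule sets_PiM_cong) simp_all
    from measurable_cong_sets[OF this refl] vec_lambda_measurable show ?thesis by blast
  qed
  have dens: "ennreal \<bar>det A\<bar> * f (row (A *v x)) = \<gamma> x" for x
  proof -
    have d: "det A \<noteq> 0" using A by (simp add: invertible_det_nz)
    have inv: "matrix_inv ?\<Sigma> = transpose (matrix_inv A) ** matrix_inv A"
      using matrix_inv_congruence[OF A, of "mat 1"] by (simp add: pos_def_invertible[OF pos_def_mat_1])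
    have tr: "trace (row v ** N ** transpose (row v)) = v \<bullet> (N *v v)" for v and N :: "real^'p^'p"
    proof -
      have "trace (row v ** N ** transpose (row v)) = (\<Sum>k\<in>UNIV. (\<Sum>j\<in>UNIV. v $ j * N $ j $ k) * v $ k)"
        by (simp add: trace_def matrix_matrix_mult_def transpose_def row_def)
      also have "\<dots> = (\<Sum>k\<in>UNIV. \<Sum>j\<in>UNIV. v $ j * N $ j $ k * v $ k)"
        by (simp add: sum_distrib_right)
      also have "\<dots> = (\<Sum>j\<in>UNIV. \<Sum>k\<in>UNIV. v $ j * N $ j $ k * v $ k)"
        by (rule sum.swap)
      finally show ?thesis
        by (simp add: inner_vec_def matrix_vector_mult_def sum_distrib_left mult.assoc)
    qed
    have "(A *v x) \<bullet> (matrix_inv ?\<Sigma> *v (A *v x)) = (matrix_inv A *v (A *v x)) \<bullet> (matrix_inv A *v (A *v x))"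
      using inner_transpose[of "A *v x" "transpose (matrix_inv A)"]
      by (simp add: inv flip: matrix_vector_mul_assoc)
    also have "\<dots> = x \<bullet> x"
      using A by (simp add: matrix_vector_mul_assoc matrix_inv_mult)
    finally have q: "(A *v x) \<bullet> (matrix_inv ?\<Sigma> *v (A *v x)) = x \<bullet> x" .
    have "det ?\<Sigma> powr (real CARD(1) / 2) = \<bar>det A\<bar>"
      by (simp add: det_mul powr_half_sqrt flip: power2_eq_square)
    then have "f (row (A *v x)) = ennreal (exp (- (x \<bullet> x) / 2) / ((2 * pi) powr (real CARD('p) / 2) * \<bar>det A\<bar>))"
      by (simp add: f_def tr q)
    then show ?thesis
      using d by (simp add: \<gamma>_def flip: ennreal_mult')
  qed
  show "sets (distr (PiM UNIV (\<lambda>_. std_normal)) borel (\<lambda>w. (\<chi> _. A *v (\<chi> j. w j)) :: real^'p^1))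
      = sets (matrix_normal 0 (mat 1) ?\<Sigma>)"
    by (simp add: MN)
  fix B :: "(real^'p^1) set"
  assume "B \<in> sets (distr (PiM UNIV (\<lambda>_. std_normal)) borel (\<lambda>w. (\<chi> _. A *v (\<chi> j. w j)) :: real^'p^1))"
  then have [measurable]: "B \<in> sets borel" by simp
  have "distr (PiM UNIV (\<lambda>_. std_normal)) borel (\<lambda>w. (\<chi> _. A *v (\<chi> j. w j)) :: real^'p^1)
      = distr (distr (PiM UNIV (\<lambda>_. std_normal)) borel (\<lambda>w. \<chi> j. w j)) borel (\<lambda>x. row (A *v x))"
  proof -
    have rA: "(\<lambda>x. row (A *v x)) \<in> borel_measurable borel" by measurable
    show ?thesis by (subst distr_distr[OF rA vm]) (simp add: comp_def row_def)
  qed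
  also have "\<dots> = distr (density lborel \<gamma>) borel (\<lambda>x. row (A *v x))" by (simp only: vec)
  finally have "emeasure (distr (PiM UNIV (\<lambda>_. std_normal)) borel (\<lambda>w. (\<chi> _. A *v (\<chi> j. w j)) :: real^'p^1)) B
      = (\<integral>\<^sup>+ y. indicator B y \<partial>distr (density lborel \<gamma>) borel (\<lambda>x. row (A *v x)))"
    by simp
  also have "\<dots> = (\<integral>\<^sup>+ x. indicator B (row (A *v x)) \<partial>density lborel \<gamma>)"
    by (rule nn_integral_distr) measurable
  also have "\<dots> = (\<integral>\<^sup>+ x. \<gamma> x * indicator B (row (A *v x)) \<partial>lborel)"
    by (rule nn_integral_density) measurable
  also have "\<dots> = (\<integral>\<^sup>+ x. ennreal \<bar>det A\<bar> * (f (row (A *v x)) * indicator B (row (A *v x))) \<partial>lborel)"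
    by (simp add: mult.assoc flip: dens)
  also have "\<dots> = ennreal \<bar>det A\<bar> * (\<integral>\<^sup>+ x. f (row (A *v x)) * indicator B (row (A *v x)) \<partial>lborel)"
    by (rule nn_integral_cmult) measurable
  also have "\<dots> = (\<integral>\<^sup>+ x. f (row x) * indicator B (row x) \<partial>lborel)"
    by (rule nn_integral_lborel_linear[OF A]) measurable
  also have "\<dots> = (\<integral>\<^sup>+ y. f y * indicator B y \<partial>distr lborel borel row)"
    by (rule nn_integral_distr[symmetric]) measurable
  also have "\<dots> = (\<integral>\<^sup>+ y. f y * indicator B y \<partial>lborel)"
    unfolding row_def by (simp only: lborel_row)
  also have "\<dots> = emeasure (matrix_normal 0 (mat 1) ?\<Sigma>) B"
    by (simp add: MN emeasure_density)
  finally show "emeasure (distr (PiM UNIV (\<lambda>_. std_normal)) borel (\<lambda>w. (\<chi> _. A *v (\<chi> j. w j)) :: real^'p^1)) B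
      = emeasure (matrix_normal 0 (mat 1) ?\<Sigma>) B" .
qed

text \<open>The rows of the data matrix are independent and each of them, multiplied by \<open>A\<close>, has the law of
  \<open>matrix_normal_row\<close>; the sum of the outer products of the images is \<open>A W A\<^sup>T\<close>.\<close>

lemma wishart_eq_distr_gram:
  fixes A :: "real^'p^'p"
  assumes A: "invertible A" and n: "0 < n"
  shows "wishart n (A ** transpose A) = distr (gauss n) borel (\<lambda>g. A ** gram n g ** transpose A)"
proof -
  let ?I = "{..<n} \<times> (UNIV :: 'p set)" and ?MN = "matrix_normal 0 (mat 1) (A ** transpose A) :: (real^'p^1) measure"
  define z :: "nat \<Rightarrow> (nat \<times> 'p \<Rightarrow> real) \<Rightarrow> real^'p" where "z = (\<lambda>i g. \<chi> j. g (i, j))"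
  define Z :: "nat \<Rightarrow> (nat \<times> 'p \<Rightarrow> real) \<Rightarrow> real^'p^1" where "Z = (\<lambda>i g. \<chi> _. A *v z i g)"
  have Zm: "Z i \<in> borel_measurable M"
    if "\<And>j. (\<lambda>g. g (i, j)) \<in> borel_measurable M" for i and M :: "(nat \<times> 'p \<Rightarrow> real) measure"
  proof -
    have "z i \<in> borel_measurable M" unfolding z_def by (rule borel_measurable_vecI) (simp add: that)
    then show ?thesis unfolding Z_def by (intro borel_measurable_vecI) simp
  qed
  have Zm': "Z i \<in> borel_measurable (gauss n)" if "i < n" for i
    using that by (intro Zm gauss_component_measurable)
  have "gauss.indep_vars n (\<lambda>i. PiM ({i} \<times> UNIV) (\<lambda>_. borel)) (\<lambda>i g. restrict (\<lambda>e. g e) ({i} \<times> UNIV)) {..<n}"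
    by (rule gauss.indep_vars_restrict[OF indep_gauss_components[OF n]]) (auto simp: disjoint_family_on_def)
  then have "gauss.indep_vars n (\<lambda>_. borel) (\<lambda>i g. Z i (restrict (\<lambda>e. g e) ({i} \<times> UNIV))) {..<n}"
    by (rule gauss.indep_vars_compose2) (intro Zm measurable_component_singleton, auto)
  moreover have "Z i (restrict (\<lambda>e. g e) ({i} \<times> UNIV)) = Z i g" for i g
    by (simp add: Z_def z_def)
  ultimately have "gauss.indep_vars n (\<lambda>_. borel) Z {..<n}" by simp
  then have joint: "distr (gauss n) (PiM {..<n} (\<lambda>_. borel)) (\<lambda>g. \<lambda>i\<in>{..<n}. Z i g)
      = (\<Pi>\<^sub>M i\<in>{..<n}. distr (gauss n) borel (Z i))"
    using n Zm' by (subst (asm) gauss.indep_vars_iff_distr_eq_PiM') auto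
  have marginal: "distr (gauss n) borel (Z i) = ?MN" if i: "i < n" for i
  proof -
    let ?P = "PiM (UNIV :: 'p set) (\<lambda>_. std_normal)"
    have proj: "distr (gauss n) ?P (\<lambda>g. \<lambda>j\<in>UNIV. g (i, j)) = ?P"
      unfolding gauss_def using i
      by (intro distr_PiM_reindex[where f = "\<lambda>j. (i, j)"] std_normal.prob_space_axioms) (auto simp: inj_on_def)
    have pm: "(\<lambda>g. \<lambda>j\<in>UNIV. g (i, j)) \<in> gauss n \<rightarrow>\<^sub>M ?P"
      using i measurable_cong_sets[OF refl sets_std_normal]
      by (intro measurable_restrict) (auto intro: gauss_component_measurable)
    have "sets ?P = sets (PiM (UNIV :: 'p set) (\<lambda>_. lborel :: real measure))"
      by (rule sets_PiM_cong) simp_all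
    then have vm: "(\<lambda>w. \<chi> j. w j) \<in> borel_measurable ?P"
      using measurable_cong_sets[OF _ refl] vec_lambda_measurable by blast
    have rm: "(\<lambda>w. (\<chi> _. A *v (\<chi> j. w j)) :: real^'p^1) \<in> borel_measurable ?P"
      using vm by (intro borel_measurable_vecI) simp
    have "distr (gauss n) borel (Z i)
        = distr (distr (gauss n) ?P (\<lambda>g. \<lambda>j\<in>UNIV. g (i, j))) borel (\<lambda>w. (\<chi> _. A *v (\<chi> j. w j)) :: real^'p^1)"
      by (subst distr_distr[OF rm pm]) (simp add: comp_def Z_def z_def restrict_def)
    then show ?thesis by (simp only: proj matrix_normal_row[OF A])
  qed
  have "(\<Pi>\<^sub>M i\<in>{..<n}. distr (gauss n) borel (Z i)) = PiM {..<n} (\<lambda>_. ?MN)"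
    by (rule PiM_cong) (simp_all add: marginal)
  with joint have joint': "PiM {..<n} (\<lambda>_. ?MN) = distr (gauss n) (PiM {..<n} (\<lambda>_. borel)) (\<lambda>g. \<lambda>i\<in>{..<n}. Z i g)"
    by simp
  have m1: "(\<lambda>Z. \<Sum>i<n. transpose (Z i) ** Z i) \<in> borel_measurable (PiM {..<n} (\<lambda>_. borel :: (real^'p^1) measure))"
    by (intro borel_measurable_sum borel_measurable_matrix_mult borel_measurable_transpose measurable_component_singleton)
  have m2: "(\<lambda>g. \<lambda>i\<in>{..<n}. Z i g) \<in> gauss n \<rightarrow>\<^sub>M PiM {..<n} (\<lambda>_. borel)"
    by (intro measurable_restrict Zm') simp
  have "wishart n (A ** transpose A)
      = distr (gauss n) borel ((\<lambda>Z. \<Sum>i<n. transpose (Z i) ** Z i) \<circ> (\<lambda>g. \<lambda>i\<in>{..<n}. Z i g))"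
    unfolding wishart_def joint' by (rule distr_distr[OF m1 m2])
  also have "(\<lambda>Z. \<Sum>i<n. transpose (Z i) ** Z i) \<circ> (\<lambda>g. \<lambda>i\<in>{..<n}. Z i g) = (\<lambda>g. A ** gram n g ** transpose A)"
  proof
    fix g :: "nat \<times> 'p \<Rightarrow> real"
    define U where "U = (\<lambda>i. (\<chi> j k. g (i, j) * g (i, k)) :: real^'p^'p)"
    have "transpose (Z i g) ** Z i g = A ** U i ** transpose A" for i
    proof -
      have "(transpose (Z i g) ** Z i g) $ j $ k = (\<Sum>l'\<in>UNIV. \<Sum>l\<in>UNIV. A $ j $ l * g (i, l) * (A $ k $ l' * g (i, l')))" for j k
        by (simp add: Z_def z_def matrix_matrix_mult_def transpose_def matrix_vector_mult_def sum_product)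
          (rule sum.swap)
      also have "\<dots> j k = (A ** U i ** transpose A) $ j $ k" for j k
        by (simp add: U_def matrix_matrix_mult_def transpose_def sum_distrib_right sum_distrib_left mult_ac)
      finally show ?thesis by (simp add: vec_eq_iff)
    qed
    moreover have "gram n g = (\<Sum>i<n. U i)" by (simp add: gram_def U_def vec_eq_iff)
    moreover have "A ** (\<Sum>i<n. U i) ** transpose A = (\<Sum>i<n. A ** U i ** transpose A)"
      by (induction n) (simp_all add: matrix_distribs)
    ultimately show "((\<lambda>Z. \<Sum>i<n. transpose (Z i) ** Z i) \<circ> (\<lambda>g. \<lambda>i\<in>{..<n}. Z i g)) g = A ** gram n g ** transpose A"
      by simp
  qed
  finally show ?thesis .
qed

section \<open>Comparison of the risks\<close>

text \<open>The loss is invariant under \<open>(D, \<Sigma>) \<mapsto> (A D A\<^sup>T, A \<Sigma> A\<^sup>T)\<close>.\<close>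

lemma stein_loss_Sigma0_invariant:
  fixes A W :: "real^'p^'p"
  assumes A: "invertible A"
  shows "stein_loss (Sigma0_hat n (A ** W ** transpose A)) (A ** transpose A) = stein_loss (Sigma0_hat n W) (mat 1)"
proof -
  define V where "V = Sigma0_hat n W"
  have inv: "matrix_inv (A ** transpose A) = transpose (matrix_inv A) ** matrix_inv A"
    using matrix_inv_congruence[OF A, of "mat 1"] by (simp add: pos_def_invertible[OF pos_def_mat_1])
  have "transpose A ** transpose (matrix_inv A) = mat 1"
    using A by (simp add: matrix_inv_mult flip: matrix_transpose_mul)
  moreover have "Sigma0_hat n (A ** W ** transpose A) ** matrix_inv (A ** transpose A)
      = A ** V ** (transpose A ** transpose (matrix_inv A)) ** matrix_inv A"
    by (simp add: V_def Sigma0_hat_def inv matrix_distribs matrix_mul_assoc)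
  ultimately have eq: "Sigma0_hat n (A ** W ** transpose A) ** matrix_inv (A ** transpose A) = A ** V ** matrix_inv A"
    by simp
  have "det A * det (matrix_inv A) = 1"
    using A by (simp add: matrix_inv_mult flip: det_mul)
  then have "det (A ** V ** matrix_inv A) = det V" by (simp add: det_mul mult_ac)
  then show ?thesis
    by (simp add: stein_loss_def eq trace_conjugate[OF A] flip: V_def)
qed

text \<open>The expectation over \<open>S\<close> for fixed \<open>X\<close>. With \<open>e\<^sub>j = E (b\<^sub>j r\<^sub>j)\<close>, the bound \<open>E r\<^sub>j \<ge> 1 / (\<nu> + b\<^sub>j)\<close> reads
  \<open>b\<^sub>j - b\<^sub>j e\<^sub>j \<le> \<nu> e\<^sub>j\<close>, so the expected loss changes by at most a negative multiple of \<open>\<Sum>\<^sub>j e\<^sub>j\<close>, which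
  is positive unless \<open>X = 0\<close>.\<close>

lemma conditional_risk_SigmaGB:
  fixes X :: "real^'p^'m" and \<Sigma> :: "real^'p^'p"
  assumes \<Sigma>: "pos_def \<Sigma>" and n: "CARD('p) \<le> n" and k: "0 < k" "k < 1"
    and thr: "k * (real n - real CARD('p) + real CARD('m)) / real n < (1 - k) * ln (1 / (1 - k))"
  defines "r0 \<equiv> \<integral>\<^sup>+ S. ennreal (stein_loss (Sigma0_hat n S) \<Sigma>) \<partial>wishart n \<Sigma>"
    and "rGB \<equiv> \<integral>\<^sup>+ S. ennreal (stein_loss (SigmaGB_hat n k X S) \<Sigma>) \<partial>wishart n \<Sigma>"
  shows "r0 < \<infinity>" and "rGB \<le> r0" and "X \<noteq> 0 \<Longrightarrow> rGB < r0"
proof -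
  have n0: "0 < n" by (rule less_le_trans[OF zero_less_card_finite n])
  define \<nu> where "\<nu> = real n - real CARD('p) + real CARD('m)"
  have "real CARD('p) \<le> real n" "0 < real CARD('m)" using n by simp_all
  then have \<nu>: "0 < \<nu>" unfolding \<nu>_def by linarith
  define \<theta> where "\<theta> = (1 - k) * ln (1 / (1 - k))"
  have \<theta>: "k * \<nu> / real n < \<theta>" using thr by (simp add: \<theta>_def \<nu>_def)
  obtain A :: "real^'p^'p" and l where A: "invertible A" and \<Sigma>A: "\<Sigma> = A ** transpose A"
    and XX: "transpose X ** X = A ** diag_mat l ** transpose A"
    using pos_def_simultaneous_diagonalization[OF \<Sigma>, of "transpose X ** X"]
    by (auto simp: matrix_transpose_mul)
  note gd = gram_diagonalization[OF A XX]
  define b where "b = (\<lambda>j. (1 - k) * l j)"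
  have b_fold: "(1 - k) * l j = b j" for j by (simp add: b_def)
  have b: "0 \<le> b j" for j using k gd(1)[of j] by (simp add: b_def)
  have b_eq: "b j = 0 \<longleftrightarrow> l j = 0" for j using k by (simp add: b_def)
  define \<rho> where "\<rho> = (\<lambda>j g. b j * matrix_inv (gram n g + diag_mat b) $ j $ j)"
  define e where "e = (\<lambda>j. integral\<^sup>L (gauss n) (\<rho> j))"

  \<comment> \<open>The rank of \<open>X\<close> is at most \<open>m\<close>, hence at least \<open>p - m\<close> coordinates are unpenalized.\<close>
  have \<nu>_card: "real n - real (card {k. b k = 0}) \<le> \<nu>"
  proof -
    have "{k. b k = 0} = UNIV - {k. l k \<noteq> 0}" by (auto simp: b_eq)
    then have "card {k. b k = 0} = CARD('p) - card {k. l k \<noteq> 0}" by (simp only: card_Diff_subset[OF finite subset_UNIV])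
    then have "CARD('p) \<le> card {k. b k = 0} + CARD('m)" using gd(2) by linarith
    then have "real CARD('p) \<le> real (card {k. b k = 0}) + real CARD('m)"
      by (simp only: of_nat_le_iff flip: of_nat_add)
    then show ?thesis by (simp add: \<nu>_def)
  qed
  have \<rho>: "integrable (gauss n) (\<rho> j)" "b j - b j * e j \<le> \<nu> * e j" "0 \<le> e j" "b j \<noteq> 0 \<Longrightarrow> 0 < e j" for j
  proof -
    have *: "integrable (gauss n) (\<rho> j) \<and> b j - b j * e j \<le> \<nu> * e j \<and> 0 \<le> e j \<and> (b j \<noteq> 0 \<longrightarrow> 0 < e j)"
    proof (cases "b j = 0")
      case True
      then show ?thesis by (simp add: \<rho>_def e_def)
    next
      case False
      then have bj: "0 < b j" using b[of j] by simp
      note ex = expected_regularized_inverse_diagonal[OF n b bj \<nu> \<nu>_card]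
      have ej: "e j = b j * (\<integral>g. matrix_inv (gram n g + diag_mat b) $ j $ j \<partial>gauss n)"
        unfolding e_def \<rho>_def by (rule integral_mult_right_zero)
      have le: "b j / (\<nu> + b j) \<le> e j"
        using mult_left_mono[OF ex(2) b[of j]] by (simp add: ej)
      then have "b j \<le> e j * (\<nu> + b j)"
        using \<nu> bj by (simp add: pos_divide_le_eq)
      then have "b j - b j * e j \<le> \<nu> * e j" by (simp add: algebra_simps)
      moreover have "0 < b j / (\<nu> + b j)" using \<nu> bj by simp
      then have "0 < e j" using le by (rule less_le_trans)
      moreover have "integrable (gauss n) (\<rho> j)"
        unfolding \<rho>_def using ex(1) by (rule integrable_mult_right)
      ultimately show ?thesis by simp
    qed
    then show "integrable (gauss n) (\<rho> j)" "b j - b j * e j \<le> \<nu> * e j" "0 \<le> e j" "b j \<noteq> 0 \<Longrightarrow> 0 < e j" by auto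
  qed

  define L0 where "L0 = (\<lambda>g. stein_loss (Sigma0_hat n (gram n g :: real^'p^'p)) (mat 1))"
  define LGB where "LGB = (\<lambda>g. stein_loss (SigmaGB_hat n k X (A ** gram n g ** transpose A)) \<Sigma>)"
  \<comment> \<open>\<open>U\<close> bounds the loss of the shrunken estimator from above and is affine in the \<open>\<rho> j\<close>, whose expectations
    are controlled.\<close>
  define U where "U = (\<lambda>g. L0 g + (k / real n * (\<Sum>j\<in>UNIV. b j - b j * \<rho> j g) - \<theta> * (\<Sum>j\<in>UNIV. \<rho> j g)) / (1 - k))"
  have AE_G: "AE g in gauss n. pos_def (gram n g :: real^'p^'p)"
    by (rule gram_nonsingular_and_log_integrable(1)[OF n])
  have L0: "integrable (gauss n) L0" unfolding L0_def by (rule integrable_stein_loss_Sigma0[OF n])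
  have L0_nn: "AE g in gauss n. 0 \<le> L0 g"
    using AE_G by eventually_elim (auto simp: L0_def Sigma0_hat_def n0 pos_def_mat_1 intro!: stein_loss_nonneg pos_def_scaleR)
  have LGB_le: "AE g in gauss n. 0 \<le> LGB g \<and> LGB g \<le> U g"
    using AE_G
  proof eventually_elim
    fix g :: "nat \<times> 'p \<Rightarrow> real" assume W: "pos_def (gram n g)"
    note le = stein_loss_SigmaGB_le[OF W k n0 A refl XX gd(1)]
    have "0 \<le> LGB g" unfolding LGB_def by (rule stein_loss_nonneg[OF le(1) \<Sigma>])
    moreover have "LGB g \<le> U g"
    proof -
      have "(1 - k) * (LGB g - L0 g) \<le> k / real n * (\<Sum>j\<in>UNIV. b j - b j * \<rho> j g) - \<theta> * (\<Sum>j\<in>UNIV. \<rho> j g)"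
        using le(2)[folded b_def, unfolded b_fold]
        by (simp add: LGB_def L0_def \<Sigma>A stein_loss_Sigma0_invariant[OF A] \<rho>_def \<theta>_def power2_eq_square mult.assoc)
      then have "LGB g - L0 g \<le> (k / real n * (\<Sum>j\<in>UNIV. b j - b j * \<rho> j g) - \<theta> * (\<Sum>j\<in>UNIV. \<rho> j g)) / (1 - k)"
        using k by (simp add: pos_le_divide_eq mult.commute)
      then show ?thesis by (simp add: U_def)
    qed
    ultimately show "0 \<le> LGB g \<and> LGB g \<le> U g" by simp
  qed
  have U: "integrable (gauss n) U"
    unfolding U_def by (intro Bochner_Integration.integrable_add L0 integrable_divide Bochner_Integration.integrable_diff
        integrable_mult_right Bochner_Integration.integrable_sum \<rho>(1)) (auto intro: \<rho>(1))
  have EU: "integral\<^sup>L (gauss n) U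
      = integral\<^sup>L (gauss n) L0 + (k / real n * (\<Sum>j\<in>UNIV. b j - b j * e j) - \<theta> * (\<Sum>j\<in>UNIV. e j)) / (1 - k)"
    unfolding U_def e_def using L0 \<rho>(1) by (simp add: gauss.prob_space Bochner_Integration.integral_sum)
  have gap: "k / real n * (\<Sum>j\<in>UNIV. b j - b j * e j) - \<theta> * (\<Sum>j\<in>UNIV. e j) \<le> (k * \<nu> / real n - \<theta>) * (\<Sum>j\<in>UNIV. e j)"
  proof -
    have "(\<Sum>j\<in>UNIV. b j - b j * e j) \<le> (\<Sum>j\<in>UNIV. \<nu> * e j)" by (intro sum_mono \<rho>(2))
    then have "k / real n * (\<Sum>j\<in>UNIV. b j - b j * e j) \<le> k / real n * (\<nu> * (\<Sum>j\<in>UNIV. e j))"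
      using k by (intro mult_left_mono) (auto simp: sum_distrib_left)
    then show ?thesis by (simp add: algebra_simps)
  qed
  have sum_e: "0 \<le> (\<Sum>j\<in>UNIV. e j)" by (intro sum_nonneg \<rho>(3))
  have EU_le: "integral\<^sup>L (gauss n) U \<le> integral\<^sup>L (gauss n) L0"
  proof -
    have "(k * \<nu> / real n - \<theta>) * (\<Sum>j\<in>UNIV. e j) \<le> 0"
      using \<theta> sum_e by (intro mult_nonpos_nonneg) auto
    with gap k show ?thesis by (simp add: EU divide_le_0_iff)
  qed
  have EU_less: "integral\<^sup>L (gauss n) U < integral\<^sup>L (gauss n) L0" if X: "X \<noteq> 0"
  proof -
    obtain j where "l j \<noteq> 0" using gd(3)[OF X] by auto
    then have "0 < e j" by (intro \<rho>(4)) (simp add: b_eq)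
    then have "0 < (\<Sum>j\<in>UNIV. e j)" using \<rho>(3) by (intro sum_pos2[of _ j]) auto
    then have "(k * \<nu> / real n - \<theta>) * (\<Sum>j\<in>UNIV. e j) < 0"
      using \<theta> by (intro mult_neg_pos) auto
    with gap k show ?thesis by (simp add: EU divide_less_0_iff)
  qed

  have wm: "(\<lambda>g. A ** gram n g ** transpose A) \<in> borel_measurable (gauss n)" by measurable
  have "r0 = (\<integral>\<^sup>+ g. ennreal (stein_loss (Sigma0_hat n (A ** gram n g ** transpose A)) \<Sigma>) \<partial>gauss n)"
    unfolding r0_def \<Sigma>A wishart_eq_distr_gram[OF A n0] Sigma0_hat_def
    by (rule nn_integral_distr[OF wm]) measurable
  also have "\<dots> = (\<integral>\<^sup>+ g. ennreal (L0 g) \<partial>gauss n)"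
    by (simp add: \<Sigma>A stein_loss_Sigma0_invariant[OF A] L0_def)
  finally have r0: "r0 = ennreal (integral\<^sup>L (gauss n) L0)"
    using nn_integral_eq_integral[OF L0 L0_nn] by simp
  then show "r0 < \<infinity>" by simp
  have "rGB = (\<integral>\<^sup>+ g. ennreal (LGB g) \<partial>gauss n)"
    unfolding rGB_def LGB_def \<Sigma>A wishart_eq_distr_gram[OF A n0]
    by (rule nn_integral_distr[OF wm]) measurable
  also have "\<dots> \<le> (\<integral>\<^sup>+ g. ennreal (U g) \<partial>gauss n)"
  proof (rule nn_integral_mono_AE)
    show "AE g in gauss n. ennreal (LGB g) \<le> ennreal (U g)"
      using LGB_le by eventually_elim (simp add: ennreal_leI)
  qed
  also have U_nn: "AE g in gauss n. 0 \<le> U g"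
    using LGB_le by eventually_elim auto
  have "(\<integral>\<^sup>+ g. ennreal (U g) \<partial>gauss n) = ennreal (integral\<^sup>L (gauss n) U)"
    by (rule nn_integral_eq_integral[OF U U_nn])
  finally have rGB: "rGB \<le> ennreal (integral\<^sup>L (gauss n) U)" .
  then show "rGB \<le> r0"
    using EU_le by (auto simp: r0 intro: order_trans ennreal_leI)
  show "rGB < r0" if "X \<noteq> 0"
  proof -
    have "0 \<le> integral\<^sup>L (gauss n) U" using U_nn by (rule integral_nonneg_AE)
    then have "ennreal (integral\<^sup>L (gauss n) U) < r0"
      using EU_less[OF that] by (simp add: r0 ennreal_less_iff)
    with rGB show ?thesis by (rule le_less_trans)
  qed
qed

text \<open>Both measures agree on rectangles, by the definition of independence.\<close>

lemma indep_rvs_joint_distr: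
  fixes X :: "'w \<Rightarrow> 'a::{second_countable_topology}" and S :: "'w \<Rightarrow> 'b::{second_countable_topology}"
  assumes P: "prob_space P" and ind: "indep_rvs P X S"
  shows "distr P (borel \<Otimes>\<^sub>M borel) (\<lambda>\<omega>. (X \<omega>, S \<omega>)) = distr P borel X \<Otimes>\<^sub>M distr P borel S"
proof (rule pair_measure_eqI[symmetric])
  interpret prob_space P by (rule P)
  have [measurable]: "X \<in> borel_measurable P" "S \<in> borel_measurable P"
    and iset: "indep_set {X -` A \<inter> space P | A. A \<in> sets borel} {S -` B \<inter> space P | B. B \<in> sets borel}"
    using ind by (auto simp: indep_rvs_def)
  interpret X: prob_space "distr P borel X" by (rule prob_space_distr) measurable
  interpret S: prob_space "distr P borel S" by (rule prob_space_distr) measurable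
  show "sigma_finite_measure (distr P borel X)" "sigma_finite_measure (distr P borel S)" by unfold_locales
  show "sets (distr P borel X \<Otimes>\<^sub>M distr P borel S) = sets (distr P (borel \<Otimes>\<^sub>M borel) (\<lambda>\<omega>. (X \<omega>, S \<omega>)))"
    by (simp cong: sets_pair_measure_cong)
  fix A B assume "A \<in> sets (distr P borel X)" "B \<in> sets (distr P borel S)"
  then have [measurable]: "A \<in> sets borel" "B \<in> sets borel" by simp_all
  have "emeasure (distr P (borel \<Otimes>\<^sub>M borel) (\<lambda>\<omega>. (X \<omega>, S \<omega>))) (A \<times> B)
      = emeasure P ((\<lambda>\<omega>. (X \<omega>, S \<omega>)) -` (A \<times> B) \<inter> space P)"
    by (rule emeasure_distr) measurable
  also have "(\<lambda>\<omega>. (X \<omega>, S \<omega>)) -` (A \<times> B) \<inter> space P = (X -` A \<inter> space P) \<inter> (S -` B \<inter> space P)" by auto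
  also have "emeasure P \<dots> = emeasure P (X -` A \<inter> space P) * emeasure P (S -` B \<inter> space P)"
  proof -
    have "prob ((X -` A \<inter> space P) \<inter> (S -` B \<inter> space P)) = prob (X -` A \<inter> space P) * prob (S -` B \<inter> space P)"
      by (rule indep_setD[OF iset]) auto
    then show ?thesis by (simp add: emeasure_eq_measure ennreal_mult)
  qed
  finally show "emeasure (distr P borel X) A * emeasure (distr P borel S) B
      = emeasure (distr P (borel \<Otimes>\<^sub>M borel) (\<lambda>\<omega>. (X \<omega>, S \<omega>))) (A \<times> B)"
    by (simp add: emeasure_distr)
qed

text \<open>By independence the risk is the average over \<open>X\<close> of the conditional risk, and \<open>X = 0\<close> is a null event
  since \<open>X\<close> has a density.\<close>

lemma risk_SigmaGB_less:
  fixes X :: "'w \<Rightarrow> real^'p^'m" and S :: "'w \<Rightarrow> real^'p^'p"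
  assumes P: "prob_space P" and ind: "indep_rvs P X S"
    and X: "distr P borel X = matrix_normal \<Theta> (mat 1) \<Sigma>" and S: "distr P borel S = wishart n \<Sigma>"
    and \<Sigma>: "pos_def \<Sigma>" and n: "CARD('p) \<le> n" and k: "0 < k" "k < 1"
    and thr: "k * (real n - real CARD('p) + real CARD('m)) / real n < (1 - k) * ln (1 / (1 - k))"
  shows "risk P stein_loss (\<lambda>\<omega>. SigmaGB_hat n k (X \<omega>) (S \<omega>)) \<Sigma> < risk P stein_loss (\<lambda>\<omega>. Sigma0_hat n (S \<omega>)) \<Sigma>"
proof -
  interpret prob_space P by (rule P)
  have [measurable]: "X \<in> borel_measurable P" "S \<in> borel_measurable P"
    using ind by (auto simp: indep_rvs_def)
  interpret X: prob_space "distr P borel X" by (rule prob_space_distr) measurable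
  interpret S: prob_space "distr P borel S" by (rule prob_space_distr) measurable
  define r0 where "r0 = (\<integral>\<^sup>+ s. ennreal (stein_loss (Sigma0_hat n s) \<Sigma>) \<partial>wishart n \<Sigma>)"
  define rGB where "rGB = (\<lambda>x :: real^'p^'m. \<integral>\<^sup>+ s. ennreal (stein_loss (SigmaGB_hat n k x s) \<Sigma>) \<partial>wishart n \<Sigma>)"
  have cond: "r0 < \<infinity>" "rGB x \<le> r0" "x \<noteq> 0 \<Longrightarrow> rGB x < r0" for x
    unfolding r0_def rGB_def using conditional_risk_SigmaGB[OF \<Sigma> n k thr] by blast+
  have "risk P stein_loss (\<lambda>\<omega>. Sigma0_hat n (S \<omega>)) \<Sigma>
      = (\<integral>\<^sup>+ s. ennreal (stein_loss (Sigma0_hat n s) \<Sigma>) \<partial>distr P borel S)"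
    unfolding risk_def Sigma0_hat_def by (rule nn_integral_distr[symmetric]) measurable
  then have risk0: "risk P stein_loss (\<lambda>\<omega>. Sigma0_hat n (S \<omega>)) \<Sigma> = r0" by (simp add: S r0_def)
  have f: "(\<lambda>(x, s). ennreal (stein_loss (SigmaGB_hat n k x s) \<Sigma>))
      \<in> borel_measurable ((borel :: (real^'p^'m) measure) \<Otimes>\<^sub>M (borel :: (real^'p^'p) measure))"
    by measurable
  then have f': "(\<lambda>(x, s). ennreal (stein_loss (SigmaGB_hat n k x s) \<Sigma>))
      \<in> borel_measurable (distr P borel X \<Otimes>\<^sub>M distr P borel S)"
    by (simp cong: measurable_cong_sets sets_pair_measure_cong)
  have "risk P stein_loss (\<lambda>\<omega>. SigmaGB_hat n k (X \<omega>) (S \<omega>)) \<Sigma>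
      = (\<integral>\<^sup>+ z. (case z of (x, s) \<Rightarrow> ennreal (stein_loss (SigmaGB_hat n k x s) \<Sigma>)) \<partial>distr P (borel \<Otimes>\<^sub>M borel) (\<lambda>\<omega>. (X \<omega>, S \<omega>)))"
    unfolding risk_def using f by (subst nn_integral_distr) auto
  also have "\<dots> = (\<integral>\<^sup>+ x. \<integral>\<^sup>+ s. ennreal (stein_loss (SigmaGB_hat n k x s) \<Sigma>) \<partial>distr P borel S \<partial>distr P borel X)"
    unfolding indep_rvs_joint_distr[OF P ind] using S.nn_integral_fst[OF f'] by simp
  finally have riskGB: "risk P stein_loss (\<lambda>\<omega>. SigmaGB_hat n k (X \<omega>) (S \<omega>)) \<Sigma> = (\<integral>\<^sup>+ x. rGB x \<partial>distr P borel X)"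
    by (simp add: S rGB_def)
  have "rGB \<in> borel_measurable (distr P borel X)"
    using S.borel_measurable_nn_integral_fst[OF f'] by (simp add: S rGB_def)
  moreover have "(\<integral>\<^sup>+ x. rGB x \<partial>distr P borel X) \<noteq> \<infinity>"
  proof -
    have "(\<integral>\<^sup>+ x. rGB x \<partial>distr P borel X) \<le> (\<integral>\<^sup>+ x. r0 \<partial>distr P borel X)"
      by (intro nn_integral_mono cond(2))
    also have "\<dots> = r0" by (simp add: X.emeasure_space_1[simplified])
    also have "\<dots> < \<infinity>" by (rule cond(1))
    finally show ?thesis by simp
  qed
  moreover have "\<not> (AE x in distr P borel X. r0 \<le> rGB x)"
  proof
    assume "AE x in distr P borel X. r0 \<le> rGB x"
    moreover have "AE x in distr P borel X. x \<noteq> 0"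
    proof -
      have "AE x in lborel. x \<noteq> (0 :: real^'p^'m)" by (rule AE_lborel_singleton)
      then show ?thesis
        unfolding X matrix_normal_def by (subst AE_density) (auto elim!: eventually_mono)
    qed
    ultimately have "AE x in distr P borel X. False"
      by eventually_elim (use cond(3) in \<open>auto simp: not_le[symmetric]\<close>)
    then show False using X.AE_False by simp
  qed
  ultimately have "(\<integral>\<^sup>+ x. rGB x \<partial>distr P borel X) < (\<integral>\<^sup>+ x. r0 \<partial>distr P borel X)"
    by (intro nn_integral_less) (auto intro: cond(2))
  also have "\<dots> = r0" by (simp add: X.emeasure_space_1[simplified])
  finally show ?thesis unfolding riskGB risk0 .
qed

theorem corollary4p2:
  fixes P :: "real^'p^'m \<Rightarrow> real^'p^'p \<Rightarrow> 'w measure"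
    and X :: "'w \<Rightarrow> real^'p^'m" and S :: "'w \<Rightarrow> real^'p^'p"
    and n :: nat and a c k\<^sub>0 m p :: real
  defines "m \<equiv> real CARD('m)" and "p \<equiv> real CARD('p)"
  assumes "CARD('p) \<le> n"
    and "\<And>\<Theta> \<Sigma>. pos_def \<Sigma> \<Longrightarrow> prob_space (P \<Theta> \<Sigma>)"
    and "\<And>\<Theta> \<Sigma>. pos_def \<Sigma> \<Longrightarrow> indep_rvs (P \<Theta> \<Sigma>) X S"
    and "\<And>\<Theta> \<Sigma>. pos_def \<Sigma> \<Longrightarrow> distr (P \<Theta> \<Sigma>) borel X = matrix_normal \<Theta> (mat 1) \<Sigma>"
    and "\<And>\<Theta> \<Sigma>. pos_def \<Sigma> \<Longrightarrow> distr (P \<Theta> \<Sigma>) borel S = wishart n \<Sigma>"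
    and "CARD('m) < CARD('p)"
    and "a + 2 * m + p = real n"
    and "k\<^sub>0 = (a - c + p + m - 1) / (a + 2 * m + p)"
    and "max (-2) (real n * (real n - p + m) / (real n + p - m) - m - 1) < c"
    and "c < real n - 2 * m"
  shows "k\<^sub>0 = (real n - (m + c + 1)) / real n \<and>
    dominates P stein_loss (\<lambda>\<omega>. SigmaGB_hat n k\<^sub>0 (X \<omega>) (S \<omega>)) (\<lambda>\<omega>. Sigma0_hat n (S \<omega>))"
proof
  have m: "1 \<le> m" using zero_less_card_finite[where 'a='m] by (simp add: m_def Suc_le_eq)
  have mp: "m < p" and pn: "p \<le> real n" using assms(3,8) by (simp_all add: m_def p_def)
  have n0: "0 < real n" using m mp pn by linarith
  have "a - c + p + m - 1 = real n - (m + c + 1)" using assms(9) by linarith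
  then show k_eq: "k\<^sub>0 = (real n - (m + c + 1)) / real n"
    unfolding assms(10) assms(9) by simp
  define \<nu> where "\<nu> = real n - p + m"
  have \<nu>: "0 < \<nu>" "\<nu> < real n" using m mp pn by (simp_all add: \<nu>_def)
  have \<kappa>_eq: "1 - k\<^sub>0 = (m + c + 1) / real n" using n0 by (simp add: k_eq field_simps)
  have "real n * \<nu> / (2 * real n - \<nu>) < m + c + 1"
    using assms(11) by (simp add: \<nu>_def algebra_simps)
  then have "(real n * \<nu> / (2 * real n - \<nu>)) / real n < 1 - k\<^sub>0"
    unfolding \<kappa>_eq using n0 by (intro divide_strict_right_mono)
  then have \<kappa>: "\<nu> / (2 * real n - \<nu>) < 1 - k\<^sub>0" using n0 by simp
  moreover have "0 < \<nu> / (2 * real n - \<nu>)" using \<nu> by simp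
  ultimately have k1: "k\<^sub>0 < 1" by linarith
  have k0: "0 < k\<^sub>0" unfolding k_eq using assms(12) m n0 by (intro divide_pos_pos) auto
  have thr: "k\<^sub>0 * (real n - real CARD('p) + real CARD('m)) / real n < (1 - k\<^sub>0) * ln (1 / (1 - k\<^sub>0))"
    using shrinkage_threshold[of "1 - k\<^sub>0" \<nu> "real n"] k0 k1 \<nu> \<kappa> by (simp add: \<nu>_def m_def p_def)
  have less: "risk (P \<Theta> \<Sigma>) stein_loss (\<lambda>\<omega>. SigmaGB_hat n k\<^sub>0 (X \<omega>) (S \<omega>)) \<Sigma>
      < risk (P \<Theta> \<Sigma>) stein_loss (\<lambda>\<omega>. Sigma0_hat n (S \<omega>)) \<Sigma>" if "pos_def \<Sigma>" for \<Theta> \<Sigma>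
    using that assms(4-7) by (intro risk_SigmaGB_less[OF _ _ _ _ that assms(3) k0 k1 thr]) auto
  then show "dominates P stein_loss (\<lambda>\<omega>. SigmaGB_hat n k\<^sub>0 (X \<omega>) (S \<omega>)) (\<lambda>\<omega>. Sigma0_hat n (S \<omega>))"
    unfolding dominates_def using pos_def_mat_1 by (meson less_imp_le)
qed

end
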